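(* The Lie algebra of $\mathbb{G}$ is $\Gamma=\{X\in\mathcal{B}(H^1_0): X^*A+AX=0\}$.
   Context: Let $\Omega\subset\mathbb{R}^n$ be open, $L^2=L^2(\Omega,dx)$ the complex Lebesgue space with its usual inner product $\langle\cdot,\cdot\rangle$, and $H^1_0=H^1_0(\Omega)$ the closure in the Sobolev norm of the complex-valued $C^\infty$ functions with compact support in $\Omega$. $H^1_0$ is a Hilbert space with inner product $[f,g]=\int_\Omega f\bar g\,dx+\int_\Omega\nabla f\cdot\nabla\bar g\,dx$. $\mathcal{B}(H^1_0)$ is the algebra of bounded linear operators on $H^1_0$ with the operator norm, $Gl(H^1_0)$ its group of invertible elements, and $X^*$ denotes the adjoint of $X\in\mathcal{B}(H^1_0)$ with respect to $[\cdot,\cdot]$. $A\in\mathcal{B}(H^1_0)$ is the positive operator determined by $[Af,g]=\langle f,g\rangle$ for all $f,g\in H^1_0$. $\mathbb{G}=\{G\in Gl(H^1_0):\langle Gf,Gg\rangle=\langle f,g\rangle\ \text{for all } f,g\in H^1_0\}$; equivalently $\mathbb{G}=\{G\in Gl(H^1_0):G^*AG=A\}$, a closed subgroup of $Gl(H^1_0)$. The Lie algebra of $\mathbb{G}$ is $\{Y\in\mathcal{B}(H^1_0): e^{tY}\in\mathbb{G}\ \text{for all } t\in\mathbb{R}\}$. *)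

theory Defs
  imports "HOL-Analysis.Analysis"
begin

section \<open>Lebesgue measurable functions modulo null sets\<close>

definition ae_equal :: "(real^'n \<Rightarrow> complex) \<Rightarrow> (real^'n \<Rightarrow> complex) \<Rightarrow> bool" where
  "ae_equal f g \<longleftrightarrow> f \<in> borel_measurable lebesgue \<and> g \<in> borel_measurable lebesgue \<and>
     (AE x in lebesgue. f x = g x)"

lemma part_equivp_ae_equal: "part_equivp (ae_equal :: (real^'n::finite \<Rightarrow> complex) \<Rightarrow> _)"
proof (rule part_equivpI)
  show "\<exists>f::real^'n \<Rightarrow> complex. ae_equal f f"
    by (rule exI[of _ "\<lambda>x. 0"]) (simp add: ae_equal_def)
  show "symp (ae_equal :: (real^'n \<Rightarrow> complex) \<Rightarrow> _)"
    by (auto simp: symp_def ae_equal_def elim: eventually_mono)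
  show "transp (ae_equal :: (real^'n \<Rightarrow> complex) \<Rightarrow> _)"
    by (auto simp: transp_def ae_equal_def elim: eventually_elim2)
qed

quotient_type 'n mfun = "real^'n::finite \<Rightarrow> complex" / partial: ae_equal
  by (rule part_equivp_ae_equal)

instantiation mfun :: (finite) ab_group_add
begin

lift_definition zero_mfun :: "'a mfun" is "\<lambda>x. 0"
  by (simp add: ae_equal_def)

lift_definition plus_mfun :: "'a mfun \<Rightarrow> 'a mfun \<Rightarrow> 'a mfun" is "\<lambda>f g x. f x + g x"
  by (auto simp: ae_equal_def elim: eventually_elim2)

lift_definition minus_mfun :: "'a mfun \<Rightarrow> 'a mfun \<Rightarrow> 'a mfun" is "\<lambda>f g x. f x - g x"
  by (auto simp: ae_equal_def elim: eventually_elim2)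

lift_definition uminus_mfun :: "'a mfun \<Rightarrow> 'a mfun" is "\<lambda>f x. - f x"
  by (auto simp: ae_equal_def elim: eventually_mono)

instance
  by standard (transfer; simp add: ae_equal_def algebra_simps)+

end

lift_definition cscale :: "complex \<Rightarrow> 'n::finite mfun \<Rightarrow> 'n mfun" is "\<lambda>c f x. c * f x"
  by (auto simp: ae_equal_def elim: eventually_mono)


section \<open>The space \<open>L\<^sup>2(\<Omega>)\<close>\<close>

text \<open>
  A function on \<open>\<Omega>\<close> is represented by its extension by zero to the whole of \<open>\<real>\<^sup>n\<close>.
  Elements of \<open>L\<^sup>2(\<Omega>)\<close> are therefore the square integrable classes vanishing almost
  everywhere outside \<open>\<Omega>\<close>, and integrals over \<open>\<Omega>\<close> become integrals over \<open>\<real>\<^sup>n\<close>.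
\<close>

lift_definition is_L2 :: "(real^'n) set \<Rightarrow> 'n::finite mfun \<Rightarrow> bool" is
  "\<lambda>\<Omega> f. integrable lebesgue (\<lambda>x. (cmod (f x))\<^sup>2) \<and> (AE x in lebesgue. x \<notin> \<Omega> \<longrightarrow> f x = 0)"
proof -
  fix \<Omega> and f g :: "real^'n \<Rightarrow> complex"
  assume "ae_equal f g"
  then have m: "f \<in> borel_measurable lebesgue" "g \<in> borel_measurable lebesgue"
    and e: "AE x in lebesgue. f x = g x" by (auto simp: ae_equal_def)
  have "integrable lebesgue (\<lambda>x. (cmod (f x))\<^sup>2) \<longleftrightarrow> integrable lebesgue (\<lambda>x. (cmod (g x))\<^sup>2)"
    by (rule integrable_cong_AE) (use m e in \<open>auto elim: eventually_mono\<close>)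
  moreover have "(AE x in lebesgue. x \<notin> \<Omega> \<longrightarrow> f x = 0) \<longleftrightarrow> (AE x in lebesgue. x \<notin> \<Omega> \<longrightarrow> g x = 0)"
    by (rule eventually_subst) (use e in \<open>auto elim: eventually_mono\<close>)
  ultimately show "(integrable lebesgue (\<lambda>x. (cmod (f x))\<^sup>2) \<and> (AE x in lebesgue. x \<notin> \<Omega> \<longrightarrow> f x = 0)) =
      (integrable lebesgue (\<lambda>x. (cmod (g x))\<^sup>2) \<and> (AE x in lebesgue. x \<notin> \<Omega> \<longrightarrow> g x = 0))"
    by blast
qed

definition L2 :: "(real^'n) set \<Rightarrow> 'n::finite mfun set" where
  "L2 \<Omega> = {f. is_L2 \<Omega> f}"

lift_definition l2_inner :: "'n::finite mfun \<Rightarrow> 'n mfun \<Rightarrow> complex" is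
  "\<lambda>f g. LINT x|lebesgue. f x * cnj (g x)"
proof -
  fix f f' g g' :: "real^'n \<Rightarrow> complex"
  assume "ae_equal f f'" "ae_equal g g'"
  then have m: "f \<in> borel_measurable lebesgue" "f' \<in> borel_measurable lebesgue"
      "g \<in> borel_measurable lebesgue" "g' \<in> borel_measurable lebesgue"
    and e: "AE x in lebesgue. f x = f' x" "AE x in lebesgue. g x = g' x"
    by (auto simp: ae_equal_def)
  have [measurable]: "cnj \<in> borel_measurable borel"
    by (intro borel_measurable_continuous_onI continuous_intros)
  note m[measurable]
  show "(LINT x|lebesgue. f x * cnj (g x)) = (LINT x|lebesgue. f' x * cnj (g' x))"
  proof (rule integral_cong_AE)
    show "(\<lambda>x. f x * cnj (g x)) \<in> borel_measurable lebesgue" by measurable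
    show "(\<lambda>x. f' x * cnj (g' x)) \<in> borel_measurable lebesgue" by measurable
    show "AE x in lebesgue. f x * cnj (g x) = f' x * cnj (g' x)"
      using e by eventually_elim simp
  qed
qed


section \<open>Test functions and weak derivatives\<close>

text \<open>
  Test functions on \<open>\<Omega>\<close> are likewise extended by zero. Both sides of the defining equation of
  a weak derivative then only involve values on \<open>\<Omega>\<close>.
\<close>

definition partial :: "'n \<Rightarrow> (real^'n::finite \<Rightarrow> complex) \<Rightarrow> real^'n \<Rightarrow> complex" where
  "partial i f x = frechet_derivative f (at x) (axis i 1)"

primrec C_k :: "nat \<Rightarrow> (real^'n::finite \<Rightarrow> complex) \<Rightarrow> bool" where
  "C_k 0 f \<longleftrightarrow> continuous_on UNIV f"
| "C_k (Suc k) f \<longleftrightarrow> (\<forall>x. f differentiable (at x)) \<and> (\<forall>i. C_k k (partial i f))"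

definition test_fun :: "(real^'n) set \<Rightarrow> (real^'n::finite \<Rightarrow> complex) \<Rightarrow> bool" where
  "test_fun \<Omega> \<phi> \<longleftrightarrow> (\<forall>k. C_k k \<phi>) \<and> compact (closure {x. \<phi> x \<noteq> 0}) \<and> closure {x. \<phi> x \<noteq> 0} \<subseteq> \<Omega>"

lemma test_fun_measurable:
  assumes "test_fun \<Omega> \<phi>"
  shows "\<phi> \<in> borel_measurable lebesgue" "partial i \<phi> \<in> borel_measurable lebesgue"
proof -
  have "C_k 0 \<phi>" "C_k (Suc 0) \<phi>"
    using assms by (auto simp: test_fun_def simp del: C_k.simps)
  then have c: "continuous_on UNIV \<phi>" "continuous_on UNIV (partial i \<phi>)"
    by auto
  show "\<phi> \<in> borel_measurable lebesgue" "partial i \<phi> \<in> borel_measurable lebesgue"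
    using c[THEN borel_measurable_continuous_onI] by (auto intro: measurable_completion)
qed

lift_definition weak_partial :: "(real^'n) set \<Rightarrow> 'n \<Rightarrow> 'n::finite mfun \<Rightarrow> 'n mfun \<Rightarrow> bool" is
  "\<lambda>\<Omega> i f g. \<forall>\<phi>. test_fun \<Omega> \<phi> \<longrightarrow>
     (LINT x|lebesgue. f x * partial i \<phi> x) = - (LINT x|lebesgue. g x * \<phi> x)"
proof -
  fix \<Omega> and i :: 'n and f f' g g' :: "real^'n \<Rightarrow> complex"
  assume ff: "ae_equal f f'" and gg: "ae_equal g g'"
  have "(LINT x|lebesgue. f x * partial i \<phi> x) = (LINT x|lebesgue. f' x * partial i \<phi> x)"
       "(LINT x|lebesgue. g x * \<phi> x) = (LINT x|lebesgue. g' x * \<phi> x)"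
    if "test_fun \<Omega> \<phi>" for \<phi>
  proof -
    note [measurable] = test_fun_measurable[OF that]
    have [measurable]: "f \<in> borel_measurable lebesgue" "f' \<in> borel_measurable lebesgue"
      "g \<in> borel_measurable lebesgue" "g' \<in> borel_measurable lebesgue"
      using ff gg by (auto simp: ae_equal_def)
    show "(LINT x|lebesgue. f x * partial i \<phi> x) = (LINT x|lebesgue. f' x * partial i \<phi> x)"
      by (rule integral_cong_AE) (use ff in \<open>auto simp: ae_equal_def elim: eventually_mono\<close>)
    show "(LINT x|lebesgue. g x * \<phi> x) = (LINT x|lebesgue. g' x * \<phi> x)"
      by (rule integral_cong_AE) (use gg in \<open>auto simp: ae_equal_def elim: eventually_mono\<close>)
  qed
  then show "(\<forall>\<phi>. test_fun \<Omega> \<phi> \<longrightarrow> (LINT x|lebesgue. f x * partial i \<phi> x) = - (LINT x|lebesgue. g x * \<phi> x)) =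
      (\<forall>\<phi>. test_fun \<Omega> \<phi> \<longrightarrow> (LINT x|lebesgue. f' x * partial i \<phi> x) = - (LINT x|lebesgue. g' x * \<phi> x))"
    by simp
qed


section \<open>Sobolev spaces\<close>

text \<open>
  The closure of the test functions is taken in \<open>H\<^sup>1(\<Omega>)\<close>, the functions in \<open>L\<^sup>2(\<Omega>)\<close> whose weak
  partial derivatives are in \<open>L\<^sup>2(\<Omega>)\<close>. The gradient in the Sobolev inner product is the weak one.
\<close>

definition H1 :: "(real^'n) set \<Rightarrow> 'n::finite mfun set" where
  "H1 \<Omega> = {f \<in> L2 \<Omega>. \<forall>i. \<exists>g \<in> L2 \<Omega>. weak_partial \<Omega> i f g}"

definition wderiv :: "(real^'n) set \<Rightarrow> 'n \<Rightarrow> 'n::finite mfun \<Rightarrow> 'n mfun" where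
  "wderiv \<Omega> i f = (THE g. g \<in> L2 \<Omega> \<and> weak_partial \<Omega> i f g)"

definition h1_inner :: "(real^'n) set \<Rightarrow> 'n::finite mfun \<Rightarrow> 'n mfun \<Rightarrow> complex" where
  "h1_inner \<Omega> f g = l2_inner f g + (\<Sum>i\<in>UNIV. l2_inner (wderiv \<Omega> i f) (wderiv \<Omega> i g))"

definition h1_norm :: "(real^'n) set \<Rightarrow> 'n::finite mfun \<Rightarrow> real" where
  "h1_norm \<Omega> f = sqrt (Re (h1_inner \<Omega> f f))"

definition H10 :: "(real^'n) set \<Rightarrow> 'n::finite mfun set" where
  "H10 \<Omega> = {f \<in> H1 \<Omega>. \<exists>\<phi>. (\<forall>k::nat. test_fun \<Omega> (\<phi> k)) \<and>
                            (\<lambda>k. h1_norm \<Omega> (f - abs_mfun (\<phi> k))) \<longlonglongrightarrow> 0}"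


section \<open>Bounded operators on \<open>H\<^sup>1\<^sub>0(\<Omega>)\<close>\<close>

text \<open>
  Operators are extensional functions, so that equality of operators is equality in HOL.
  The set under the supremum in the operator norm is nonempty, as it contains the norm of
  the image of \<open>0\<close>, and it is bounded above for bounded operators.
\<close>

definition bounded_ops :: "(real^'n) set \<Rightarrow> ('n::finite mfun \<Rightarrow> 'n mfun) set" where
  "bounded_ops \<Omega> = {T \<in> H10 \<Omega> \<rightarrow>\<^sub>E H10 \<Omega>.
     (\<forall>f\<in>H10 \<Omega>. \<forall>g\<in>H10 \<Omega>. T (f + g) = T f + T g) \<and>
     (\<forall>c. \<forall>f\<in>H10 \<Omega>. T (cscale c f) = cscale c (T f)) \<and>
     (\<exists>K. \<forall>f\<in>H10 \<Omega>. h1_norm \<Omega> (T f) \<le> K * h1_norm \<Omega> f)}"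

definition op_norm :: "(real^'n) set \<Rightarrow> ('n::finite mfun \<Rightarrow> 'n mfun) \<Rightarrow> real" where
  "op_norm \<Omega> T = (SUP f\<in>{f \<in> H10 \<Omega>. h1_norm \<Omega> f \<le> 1}. h1_norm \<Omega> (T f))"

definition op_zero :: "(real^'n) set \<Rightarrow> 'n::finite mfun \<Rightarrow> 'n mfun" where
  "op_zero \<Omega> = (\<lambda>f\<in>H10 \<Omega>. 0)"

definition op_one :: "(real^'n) set \<Rightarrow> 'n::finite mfun \<Rightarrow> 'n mfun" where
  "op_one \<Omega> = (\<lambda>f\<in>H10 \<Omega>. f)"

definition op_add :: "(real^'n) set \<Rightarrow> ('n::finite mfun \<Rightarrow> 'n mfun) \<Rightarrow> ('n mfun \<Rightarrow> 'n mfun) \<Rightarrow> 'n mfun \<Rightarrow> 'n mfun" where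
  "op_add \<Omega> S T = (\<lambda>f\<in>H10 \<Omega>. S f + T f)"

definition op_diff :: "(real^'n) set \<Rightarrow> ('n::finite mfun \<Rightarrow> 'n mfun) \<Rightarrow> ('n mfun \<Rightarrow> 'n mfun) \<Rightarrow> 'n mfun \<Rightarrow> 'n mfun" where
  "op_diff \<Omega> S T = (\<lambda>f\<in>H10 \<Omega>. S f - T f)"

definition op_scale :: "(real^'n) set \<Rightarrow> complex \<Rightarrow> ('n::finite mfun \<Rightarrow> 'n mfun) \<Rightarrow> 'n mfun \<Rightarrow> 'n mfun" where
  "op_scale \<Omega> c T = (\<lambda>f\<in>H10 \<Omega>. cscale c (T f))"

definition op_mult :: "(real^'n) set \<Rightarrow> ('n::finite mfun \<Rightarrow> 'n mfun) \<Rightarrow> ('n mfun \<Rightarrow> 'n mfun) \<Rightarrow> 'n mfun \<Rightarrow> 'n mfun" where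
  "op_mult \<Omega> S T = compose (H10 \<Omega>) S T"

definition op_exp_partial :: "(real^'n) set \<Rightarrow> ('n::finite mfun \<Rightarrow> 'n mfun) \<Rightarrow> nat \<Rightarrow> 'n mfun \<Rightarrow> 'n mfun" where
  "op_exp_partial \<Omega> T N = (\<lambda>f\<in>H10 \<Omega>. \<Sum>k<N. cscale (1 / fact k) ((T ^^ k) f))"

text \<open>The exponential is the sum of its power series, in the operator norm.\<close>

definition op_exp :: "(real^'n) set \<Rightarrow> ('n::finite mfun \<Rightarrow> 'n mfun) \<Rightarrow> 'n mfun \<Rightarrow> 'n mfun" where
  "op_exp \<Omega> T = (THE S. S \<in> bounded_ops \<Omega> \<and>
     (\<lambda>N. op_norm \<Omega> (op_diff \<Omega> (op_exp_partial \<Omega> T N) S)) \<longlonglongrightarrow> 0)"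

definition op_adjoint :: "(real^'n) set \<Rightarrow> ('n::finite mfun \<Rightarrow> 'n mfun) \<Rightarrow> 'n mfun \<Rightarrow> 'n mfun" where
  "op_adjoint \<Omega> T = (THE S. S \<in> bounded_ops \<Omega> \<and>
     (\<forall>f\<in>H10 \<Omega>. \<forall>g\<in>H10 \<Omega>. h1_inner \<Omega> (T f) g = h1_inner \<Omega> f (S g)))"

definition op_A :: "(real^'n) set \<Rightarrow> 'n::finite mfun \<Rightarrow> 'n mfun" where
  "op_A \<Omega> = (THE S. S \<in> bounded_ops \<Omega> \<and>
     (\<forall>f\<in>H10 \<Omega>. \<forall>g\<in>H10 \<Omega>. h1_inner \<Omega> (S f) g = l2_inner f g))"

definition Gl :: "(real^'n) set \<Rightarrow> ('n::finite mfun \<Rightarrow> 'n mfun) set" where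
  "Gl \<Omega> = {T \<in> bounded_ops \<Omega>. \<exists>S\<in>bounded_ops \<Omega>.
     op_mult \<Omega> S T = op_one \<Omega> \<and> op_mult \<Omega> T S = op_one \<Omega>}"


section \<open>The group, its Lie algebra, and \<open>\<Gamma>\<close>\<close>

definition GG :: "(real^'n) set \<Rightarrow> ('n::finite mfun \<Rightarrow> 'n mfun) set" where
  "GG \<Omega> = {G \<in> Gl \<Omega>. \<forall>f\<in>H10 \<Omega>. \<forall>g\<in>H10 \<Omega>. l2_inner (G f) (G g) = l2_inner f g}"

definition lie_algebra_GG :: "(real^'n) set \<Rightarrow> ('n::finite mfun \<Rightarrow> 'n mfun) set" where
  "lie_algebra_GG \<Omega> =
     {Y \<in> bounded_ops \<Omega>. \<forall>t::real. op_exp \<Omega> (op_scale \<Omega> (complex_of_real t) Y) \<in> GG \<Omega>}"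

definition Gamma_alg :: "(real^'n) set \<Rightarrow> ('n::finite mfun \<Rightarrow> 'n mfun) set" where
  "Gamma_alg \<Omega> = {X \<in> bounded_ops \<Omega>.
     op_add \<Omega> (op_mult \<Omega> (op_adjoint \<Omega> X) (op_A \<Omega>)) (op_mult \<Omega> (op_A \<Omega>) X) = op_zero \<Omega>}"

end

theory Submission
  imports Defs
begin

text \<open>
  Pairing with an arbitrary \<open>g\<close> turns the operator equation that defines \<open>\<Gamma>\<close> into a statement about
  the form \<open>\<langle>\<cdot>,\<cdot>\<rangle>\<close>: since \<open>[Af, g] = \<langle>f, g\<rangle>\<close>, the equation \<open>X\<^sup>*A + AX = 0\<close> says that
  \<open>\<langle>Xf, g\<rangle> + \<langle>f, Xg\<rangle> = 0\<close> for all \<open>f\<close> and \<open>g\<close> (\<open>Gamma_alg_iff\<close>). Because the \<open>L\<^sup>2\<close> norm is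
  dominated by the Sobolev norm, this form is bounded and can be treated as an abstract bounded
  sesquilinear form \<open>B\<close> on a Hilbert space. If every \<open>e\<^sup>t\<^sup>Y\<close> preserves \<open>B\<close>, differentiating
  \<open>B(e\<^sup>t\<^sup>Yf, e\<^sup>t\<^sup>Yg) = B(f, g)\<close> at \<open>t = 0\<close> gives \<open>B(Yf, g) + B(f, Yg) = 0\<close>. Conversely, if \<open>Y\<close> is
  skew for \<open>B\<close>, then each power of \<open>Y\<close> moves across \<open>B\<close> at the cost of a sign, so
  \<open>B(e\<^sup>t\<^sup>Yf, h) = B(f, e\<^sup>-\<^sup>t\<^sup>Yh)\<close>, and \<open>h = e\<^sup>t\<^sup>Yg\<close> gives invariance because the two exponentials are
  inverse to each other. This equivalence is \<open>exp_op_preserves_form_iff\<close>.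

  The Hilbert space theory behind it (the Riesz representation theorem, which yields \<open>A\<close> and the
  adjoints, and the exponential series) is developed for a space given by a carrier set. To apply it,
  \<open>H\<^sup>1\<^sub>0(\<Omega>)\<close> has to be a Hilbert space. Completeness starts from the Riesz-Fischer theorem for \<open>L\<^sup>2\<close>.
  The weak derivative is unique, by the fundamental lemma of the calculus of variations, and its
  defining equations pass to \<open>L\<^sup>2\<close> limits; hence \<open>H\<^sup>1(\<Omega>)\<close> is complete. Integration by parts puts the
  test functions into \<open>H\<^sup>1(\<Omega>)\<close>, and \<open>H\<^sup>1\<^sub>0(\<Omega>)\<close> is the closure of this subspace.
\<close>

section \<open>Complex inner product spaces on a carrier set\<close>

text \<open>
  The carrier is a set and not a type because the spaces of interest depend on the variable \<open>\<Omega>\<close>.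
\<close>

locale complex_inner_space = vector_space scale
  for scale :: "complex \<Rightarrow> 'a::ab_group_add \<Rightarrow> 'a" (infixr "\<odot>" 75) +
  fixes H :: "'a set" and ip :: "'a \<Rightarrow> 'a \<Rightarrow> complex"
  assumes subspace_carrier: "subspace H"
    and ip_add_left: "\<lbrakk>f \<in> H; g \<in> H; h \<in> H\<rbrakk> \<Longrightarrow> ip (f + g) h = ip f h + ip g h"
    and ip_scale_left: "\<lbrakk>f \<in> H; g \<in> H\<rbrakk> \<Longrightarrow> ip (c \<odot> f) g = c * ip f g"
    and ip_commute: "\<lbrakk>f \<in> H; g \<in> H\<rbrakk> \<Longrightarrow> ip f g = cnj (ip g f)"
    and ip_self_nonneg: "f \<in> H \<Longrightarrow> 0 \<le> Re (ip f f)"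
    and ip_self_eq_0: "\<lbrakk>f \<in> H; ip f f = 0\<rbrakk> \<Longrightarrow> f = 0"
begin

definition nrm :: "'a \<Rightarrow> real" where
  "nrm f = sqrt (Re (ip f f))"

lemma carrier_closed [simp, intro]:
  "0 \<in> H" "\<lbrakk>f \<in> H; g \<in> H\<rbrakk> \<Longrightarrow> f + g \<in> H" "\<lbrakk>f \<in> H; g \<in> H\<rbrakk> \<Longrightarrow> f - g \<in> H"
  "f \<in> H \<Longrightarrow> c \<odot> f \<in> H" "f \<in> H \<Longrightarrow> - f \<in> H"
  "(\<And>i. i \<in> I \<Longrightarrow> F i \<in> H) \<Longrightarrow> sum F I \<in> H"
  using subspace_carrier
  by (auto intro: subspace_0 subspace_add subspace_diff subspace_scale subspace_neg subspace_sum)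

lemma ip_add_right: "\<lbrakk>f \<in> H; g \<in> H; h \<in> H\<rbrakk> \<Longrightarrow> ip f (g + h) = ip f g + ip f h"
  by (simp add: ip_commute[of f] ip_add_left)

lemma ip_scale_right: "\<lbrakk>f \<in> H; g \<in> H\<rbrakk> \<Longrightarrow> ip f (c \<odot> g) = cnj c * ip f g"
  using ip_commute[of f "c \<odot> g"] ip_commute[of f g] by (simp add: ip_scale_left)

lemma ip_minus_left: "\<lbrakk>f \<in> H; g \<in> H\<rbrakk> \<Longrightarrow> ip (- f) g = - ip f g"
  using ip_scale_left[of f g "-1"] by simp

lemma ip_minus_right: "\<lbrakk>f \<in> H; g \<in> H\<rbrakk> \<Longrightarrow> ip f (- g) = - ip f g"
  using ip_scale_right[of f g "-1"] by simp

lemma ip_diff_left: "\<lbrakk>f \<in> H; g \<in> H; h \<in> H\<rbrakk> \<Longrightarrow> ip (f - g) h = ip f h - ip g h"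
  using ip_add_left[of f "- g" h] by (simp add: ip_minus_left)

lemma ip_zero [simp]: "f \<in> H \<Longrightarrow> ip 0 f = 0" "f \<in> H \<Longrightarrow> ip f 0 = 0"
  using ip_scale_left[of 0 f 0] ip_scale_right[of f 0 0] by auto

lemma nrm_nonneg [simp]: "f \<in> H \<Longrightarrow> 0 \<le> nrm f"
  by (simp add: nrm_def ip_self_nonneg)

lemma nrm_power2: "f \<in> H \<Longrightarrow> (nrm f)\<^sup>2 = Re (ip f f)"
  by (simp add: nrm_def ip_self_nonneg)

lemma ip_self: "f \<in> H \<Longrightarrow> ip f f = of_real ((nrm f)\<^sup>2)"
  using ip_commute[of f f] by (simp add: nrm_power2 complex_eq_iff)

lemma nrm_zero [simp]: "nrm 0 = 0"
  by (simp add: nrm_def)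

lemma nrm_eq_0: "f \<in> H \<Longrightarrow> nrm f = 0 \<Longrightarrow> f = 0"
  using ip_self[of f] ip_self_eq_0 by simp

lemma nrm_scale: "f \<in> H \<Longrightarrow> nrm (c \<odot> f) = cmod c * nrm f"
proof -
  assume f: "f \<in> H"
  have "ip (c \<odot> f) (c \<odot> f) = of_real ((cmod c)\<^sup>2) * ip f f"
    using f unfolding complex_norm_square by (simp add: ip_scale_left ip_scale_right)
  then have "(nrm (c \<odot> f))\<^sup>2 = (cmod c * nrm f)\<^sup>2"
    using f by (simp add: nrm_power2 power_mult_distrib)
  then show ?thesis
    using f by (simp add: power2_eq_iff_nonneg)
qed

lemma nrm_minus: "f \<in> H \<Longrightarrow> nrm (- f) = nrm f"
  using nrm_scale[of f "-1"] by simp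

lemma nrm_minus_commute: "\<lbrakk>f \<in> H; g \<in> H\<rbrakk> \<Longrightarrow> nrm (f - g) = nrm (g - f)"
  using nrm_minus[of "f - g"] by simp

lemma nrm_add_power2:
  "\<lbrakk>f \<in> H; g \<in> H\<rbrakk> \<Longrightarrow> (nrm (f + g))\<^sup>2 = (nrm f)\<^sup>2 + (nrm g)\<^sup>2 + 2 * Re (ip f g)"
  using ip_commute[of g f] by (simp add: nrm_power2 ip_add_left ip_add_right)

lemma nrm_diff_power2:
  "\<lbrakk>f \<in> H; g \<in> H\<rbrakk> \<Longrightarrow> (nrm (f - g))\<^sup>2 = (nrm f)\<^sup>2 + (nrm g)\<^sup>2 - 2 * Re (ip f g)"
  using nrm_add_power2[of f "- g"] by (simp add: nrm_minus ip_minus_right)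

lemma Cauchy_Schwarz: 
  assumes f: "f \<in> H" and g: "g \<in> H"
  shows "cmod (ip f g) \<le> nrm f * nrm g"
proof (cases "g = 0")
  case True
  then show ?thesis using f by simp
next
  case False
  then have pos: "nrm g > 0"
    using nrm_eq_0[OF g] nrm_nonneg[OF g] by fastforce
  \<comment> \<open>The coefficient of the orthogonal projection of \<open>f\<close> onto the line through \<open>g\<close>.\<close>
  define c where "c = ip f g / of_real ((nrm g)\<^sup>2)"
  have "0 \<le> (nrm (f - c \<odot> g))\<^sup>2" by simp
  also have "\<dots> = (nrm f)\<^sup>2 + (cmod c * nrm g)\<^sup>2 - 2 * Re (cnj c * ip f g)"
    using f g by (simp add: nrm_diff_power2 nrm_scale ip_scale_right)
  also have "cnj c * ip f g = of_real ((cmod (ip f g))\<^sup>2 / (nrm g)\<^sup>2)"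
    unfolding c_def of_real_divide complex_norm_square by simp
  also have "(cmod c * nrm g)\<^sup>2 = (cmod (ip f g))\<^sup>2 / (nrm g)\<^sup>2"
    using pos by (simp add: c_def norm_divide norm_power power_divide power_mult_distrib)
      (simp add: power2_eq_square power4_eq_xxxx)
  finally have "(cmod (ip f g))\<^sup>2 / (nrm g)\<^sup>2 \<le> (nrm f)\<^sup>2"
    by simp
  then have "(cmod (ip f g))\<^sup>2 \<le> (nrm f * nrm g)\<^sup>2"
    using pos by (simp add: divide_le_eq power_mult_distrib)
  then show ?thesis
    using f g by (meson abs_le_square_iff mult_nonneg_nonneg nrm_nonneg norm_ge_zero power2_le_imp_le)
qed

lemma nrm_triangle:
  assumes "f \<in> H" "g \<in> H"
  shows "nrm (f + g) \<le> nrm f + nrm g"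
proof (rule power2_le_imp_le)
  have "Re (ip f g) \<le> nrm f * nrm g"
    using Cauchy_Schwarz[OF assms] complex_Re_le_cmod order_trans by blast
  then show "(nrm (f + g))\<^sup>2 \<le> (nrm f + nrm g)\<^sup>2"
    using assms by (simp add: nrm_add_power2 power2_sum)
qed (use assms in simp)

lemma nrm_triangle_diff:
  "\<lbrakk>f \<in> H; g \<in> H; h \<in> H\<rbrakk> \<Longrightarrow> nrm (f - h) \<le> nrm (f - g) + nrm (g - h)"
  using nrm_triangle[of "f - g" "g - h"] by simp

lemma nrm_sum_le:
  "finite I \<Longrightarrow> (\<And>i. i \<in> I \<Longrightarrow> F i \<in> H) \<Longrightarrow> nrm (sum F I) \<le> (\<Sum>i\<in>I. nrm (F i))"
proof (induction I rule: finite_induct)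
  case (insert i I)
  then have "nrm (F i + sum F I) \<le> nrm (F i) + nrm (sum F I)"
    by (intro nrm_triangle) auto
  with insert show ?case by simp
qed simp

lemma nrm_limit_unique:
  assumes "\<And>n. x n \<in> H" "l \<in> H" "l' \<in> H" and F: "F \<noteq> bot"
    and lim: "((\<lambda>n. nrm (x n - l)) \<longlongrightarrow> 0) F" "((\<lambda>n. nrm (x n - l')) \<longlongrightarrow> 0) F"
  shows "l = l'"
proof -
  have "nrm (l - l') \<le> nrm (x n - l) + nrm (x n - l')" for n
    using nrm_triangle_diff[of l "x n" l'] assms(1-3) by (simp add: nrm_minus_commute[of l])
  then have "nrm (l - l') \<le> 0"
    using tendsto_lowerbound[OF tendsto_add[OF lim] _ F] by (auto intro: always_eventually)
  then have "nrm (l - l') = 0"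
    using assms nrm_nonneg[of "l - l'"] by (simp del: nrm_nonneg)
  then show ?thesis
    using nrm_eq_0[of "l - l'"] assms by simp
qed

lemma nrm_tendsto_squeeze:
  assumes "(b \<longlongrightarrow> 0) F" "\<forall>\<^sub>F n in F. nrm (x n) \<le> b n" "\<And>n. x n \<in> H"
  shows "((\<lambda>n. nrm (x n)) \<longlongrightarrow> 0) F"
  by (rule tendsto_sandwich[OF _ assms(2) tendsto_const assms(1)]) (use assms(3) in simp)

lemma ip_eqI:
  assumes "f \<in> H" "g \<in> H" "\<And>h. h \<in> H \<Longrightarrow> ip f h = ip g h"
  shows "f = g"
  using ip_self_eq_0[of "f - g"] assms by (simp add: ip_diff_left)

section \<open>Bounded forms and bounded operators\<close>

definition bounded_form :: "('a \<Rightarrow> 'a \<Rightarrow> complex) \<Rightarrow> bool" where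
  "bounded_form B \<longleftrightarrow>
     (\<forall>f\<in>H. \<forall>g\<in>H. \<forall>h\<in>H. B (f + g) h = B f h + B g h \<and> B h (f + g) = B h f + B h g) \<and>
     (\<forall>c. \<forall>f\<in>H. \<forall>g\<in>H. B (c \<odot> f) g = c * B f g \<and> B f (c \<odot> g) = cnj c * B f g) \<and>
     (\<exists>C. \<forall>f\<in>H. \<forall>g\<in>H. cmod (B f g) \<le> C * nrm f * nrm g)"

lemma bounded_form_ip: "bounded_form ip"
  unfolding bounded_form_def
  using Cauchy_Schwarz
  by (auto simp: ip_add_left ip_add_right ip_scale_left ip_scale_right intro!: exI[of _ 1])

lemma bounded_form_add:
  "\<lbrakk>bounded_form B; f \<in> H; g \<in> H; h \<in> H\<rbrakk> \<Longrightarrow> B (f + g) h = B f h + B g h"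
  "\<lbrakk>bounded_form B; f \<in> H; g \<in> H; h \<in> H\<rbrakk> \<Longrightarrow> B h (f + g) = B h f + B h g"
  unfolding bounded_form_def by auto

lemma bounded_form_scale:
  "\<lbrakk>bounded_form B; f \<in> H; g \<in> H\<rbrakk> \<Longrightarrow> B (c \<odot> f) g = c * B f g"
  "\<lbrakk>bounded_form B; f \<in> H; g \<in> H\<rbrakk> \<Longrightarrow> B f (c \<odot> g) = cnj c * B f g"
  unfolding bounded_form_def by blast+

lemma bounded_form_diff:
  assumes "bounded_form B" "f \<in> H" "g \<in> H" "h \<in> H"
  shows "B (f - g) h = B f h - B g h" "B h (f - g) = B h f - B h g"
  using bounded_form_add[OF assms(1), of "f - g" g h] assms by auto

lemma bounded_form_sum:
  assumes B: "bounded_form B" and g: "g \<in> H"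
  shows "(\<And>i. i \<in> I \<Longrightarrow> F i \<in> H) \<Longrightarrow> B (sum F I) g = (\<Sum>i\<in>I. B (F i) g)"
    "(\<And>i. i \<in> I \<Longrightarrow> F i \<in> H) \<Longrightarrow> B g (sum F I) = (\<Sum>i\<in>I. B g (F i))"
proof -
  have z: "B 0 g = 0" "B g 0 = 0"
    using bounded_form_diff[OF B g g g] by auto
  show "(\<And>i. i \<in> I \<Longrightarrow> F i \<in> H) \<Longrightarrow> B (sum F I) g = (\<Sum>i\<in>I. B (F i) g)"
    by (induction I rule: infinite_finite_induct) (auto simp: z bounded_form_add[OF B] g)
  show "(\<And>i. i \<in> I \<Longrightarrow> F i \<in> H) \<Longrightarrow> B g (sum F I) = (\<Sum>i\<in>I. B g (F i))"
    by (induction I rule: infinite_finite_induct) (auto simp: z bounded_form_add[OF B] g)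
qed

lemma bounded_form_tendsto:
  assumes B: "bounded_form B" and mem: "\<And>n. x n \<in> H" "\<And>n. y n \<in> H" "f \<in> H" "g \<in> H"
    and x: "((\<lambda>n. nrm (x n - f)) \<longlongrightarrow> 0) F" and y: "((\<lambda>n. nrm (y n - g)) \<longlongrightarrow> 0) F"
  shows "((\<lambda>n. B (x n) (y n)) \<longlongrightarrow> B f g) F"
proof -
  obtain C where C: "\<And>f g. f \<in> H \<Longrightarrow> g \<in> H \<Longrightarrow> cmod (B f g) \<le> C * nrm f * nrm g"
    using B unfolding bounded_form_def by blast
  let ?b = "\<lambda>n. C * nrm (x n - f) * nrm (y n - g) + C * nrm (x n - f) * nrm g
      + C * nrm f * nrm (y n - g)"
  have "norm (B (x n) (y n) - B f g) \<le> ?b n" for n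
  proof -
    have "B (x n) (y n) - B f g
        = B (x n - f) (y n - g) + B (x n - f) g + B f (y n - g)"
      using mem by (simp add: bounded_form_diff[OF B])
    also have "norm \<dots> \<le> norm (B (x n - f) (y n - g)) + norm (B (x n - f) g) + norm (B f (y n - g))"
      by (meson add_mono norm_triangle_ineq order_trans order_refl)
    also have "\<dots> \<le> ?b n"
      by (intro add_mono C) (use mem in auto)
    finally show ?thesis .
  qed
  then have "\<forall>\<^sub>F n in F. norm (B (x n) (y n) - B f g) \<le> ?b n"
    by (rule always_eventually[OF allI])
  moreover have "(?b \<longlongrightarrow> C * 0 * 0 + C * 0 * nrm g + C * nrm f * 0) F"
    by (intro tendsto_intros x y)
  ultimately have "((\<lambda>n. B (x n) (y n) - B f g) \<longlongrightarrow> 0) F"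
    by (simp only: mult_zero_right mult_zero_left add_0_right Lim_null_comparison)
  then show ?thesis
    by (simp add: LIM_zero_iff)
qed

definition bounded_operator :: "('a \<Rightarrow> 'a) \<Rightarrow> bool" where
  "bounded_operator T \<longleftrightarrow> (\<forall>f\<in>H. T f \<in> H) \<and>
     (\<forall>f\<in>H. \<forall>g\<in>H. T (f + g) = T f + T g) \<and>
     (\<forall>c. \<forall>f\<in>H. T (c \<odot> f) = c \<odot> T f) \<and>
     (\<exists>K. \<forall>f\<in>H. nrm (T f) \<le> K * nrm f)"

lemma bounded_operator_closed [simp]: "\<lbrakk>bounded_operator T; f \<in> H\<rbrakk> \<Longrightarrow> T f \<in> H"
  by (simp add: bounded_operator_def)

lemma bounded_operator_add:
  "\<lbrakk>bounded_operator T; f \<in> H; g \<in> H\<rbrakk> \<Longrightarrow> T (f + g) = T f + T g"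
  by (simp add: bounded_operator_def)

lemma bounded_operator_scale:
  "\<lbrakk>bounded_operator T; f \<in> H\<rbrakk> \<Longrightarrow> T (c \<odot> f) = c \<odot> T f"
  by (simp add: bounded_operator_def)

lemma bounded_operator_diff:
  "\<lbrakk>bounded_operator T; f \<in> H; g \<in> H\<rbrakk> \<Longrightarrow> T (f - g) = T f - T g"
  using bounded_operator_add[of T "f - g" g] by (simp add: algebra_simps)

lemma bounded_operator_sum:
  assumes T: "bounded_operator T"
  shows "(\<And>i. i \<in> I \<Longrightarrow> F i \<in> H) \<Longrightarrow> T (sum F I) = (\<Sum>i\<in>I. T (F i))"
proof -
  have "T 0 = 0"
    using bounded_operator_diff[OF T, of 0 0] by simp
  then show "(\<And>i. i \<in> I \<Longrightarrow> F i \<in> H) \<Longrightarrow> T (sum F I) = (\<Sum>i\<in>I. T (F i))"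
    by (induction I rule: infinite_finite_induct) (auto simp: bounded_operator_add[OF T])
qed

lemma bounded_operator_bound:
  assumes "bounded_operator T"
  obtains K where "K \<ge> 0" "\<And>f. f \<in> H \<Longrightarrow> nrm (T f) \<le> K * nrm f"
proof -
  obtain K where K: "\<And>f. f \<in> H \<Longrightarrow> nrm (T f) \<le> K * nrm f"
    using assms unfolding bounded_operator_def by blast
  have "nrm (T f) \<le> max K 0 * nrm f" if "f \<in> H" for f
    using K[OF that] mult_right_mono[of K "max K 0" "nrm f"] that by (simp del: max.bounded_iff)
  then show ?thesis using that[of "max K 0"] by simp
qed

lemma bounded_operator_scaled:
  assumes T: "bounded_operator T"
  shows "bounded_operator (\<lambda>f. c \<odot> T f)"
proof -
  obtain K where K: "\<And>f. f \<in> H \<Longrightarrow> nrm (T f) \<le> K * nrm f"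
    using bounded_operator_bound[OF T] by blast
  have "nrm (c \<odot> T f) \<le> (cmod c * K) * nrm f" if "f \<in> H" for f
    using mult_left_mono[OF K[OF that], of "cmod c"] that T by (simp add: nrm_scale mult.assoc)
  then show ?thesis
    using T bounded_operator_add[OF T] bounded_operator_scale[OF T] unfolding bounded_operator_def
    by (intro conjI exI[of _ "cmod c * K"]) (simp_all add: scale_right_distrib mult.commute)
qed

lemma funpow_bounded:
  assumes T: "bounded_operator T" and K: "K \<ge> 0" "\<And>f. f \<in> H \<Longrightarrow> nrm (T f) \<le> K * nrm f" 
    and f: "f \<in> H"
  shows "(T ^^ k) f \<in> H" "nrm ((T ^^ k) f) \<le> K ^ k * nrm f"
proof -
  have "(T ^^ k) f \<in> H \<and> nrm ((T ^^ k) f) \<le> K ^ k * nrm f"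
  proof (induction k)
    case (Suc k)
    then have "nrm (T ((T ^^ k) f)) \<le> K * (K ^ k * nrm f)"
      using K by (meson mult_left_mono order_trans)
    with Suc T show ?case by (simp add: mult.assoc)
  qed (use f in simp)
  then show "(T ^^ k) f \<in> H" "nrm ((T ^^ k) f) \<le> K ^ k * nrm f" by auto
qed

lemma bounded_operator_funpow:
  assumes T: "bounded_operator T"
  shows "bounded_operator (T ^^ k)"
proof -
  obtain K where K: "K \<ge> 0" "\<And>f. f \<in> H \<Longrightarrow> nrm (T f) \<le> K * nrm f"
    using bounded_operator_bound[OF T] by blast
  note closed = funpow_bounded(1)[OF T K]
  have "(T ^^ k) (f + g) = (T ^^ k) f + (T ^^ k) g" if "f \<in> H" "g \<in> H" for f g
    by (induction k) (use that in \<open>auto simp: bounded_operator_add[OF T] closed\<close>)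
  moreover have "(T ^^ k) (c \<odot> f) = c \<odot> (T ^^ k) f" if "f \<in> H" for c f
    by (induction k) (use that in \<open>auto simp: bounded_operator_scale[OF T] closed\<close>)
  ultimately show ?thesis
    unfolding bounded_operator_def
    by (intro conjI exI[of _ "K ^ k"]) (simp_all add: funpow_bounded[OF T K])
qed

section \<open>Partial sums of the exponential series\<close>

definition exp_partial :: "('a \<Rightarrow> 'a) \<Rightarrow> nat \<Rightarrow> 'a \<Rightarrow> 'a" where
  "exp_partial T N f = (\<Sum>k<N. (1 / fact k) \<odot> (T ^^ k) f)"

lemma bounded_operator_exp_partial_closed [simp]:
  "\<lbrakk>bounded_operator T; f \<in> H\<rbrakk> \<Longrightarrow> exp_partial T N f \<in> H"
  unfolding exp_partial_def using bounded_operator_funpow by auto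

lemma exp_partial_add:
  assumes T: "bounded_operator T" and "f \<in> H" "g \<in> H"
  shows "exp_partial T N (f + g) = exp_partial T N f + exp_partial T N g"
  unfolding exp_partial_def sum.distrib[symmetric]
  by (intro sum.cong refl)
     (use assms in \<open>simp add: bounded_operator_add[OF bounded_operator_funpow[OF T]] scale_right_distrib\<close>)

lemma exp_partial_scale:
  assumes T: "bounded_operator T" and "f \<in> H"
  shows "exp_partial T N (c \<odot> f) = c \<odot> exp_partial T N f"
  unfolding exp_partial_def scale_sum_right
  by (intro sum.cong refl)
     (use assms in \<open>simp add: bounded_operator_scale[OF bounded_operator_funpow[OF T]] scale_left_commute\<close>)

text \<open>
  Every estimate for the exponential series is a comparison with the scalar series at an upper bound
  \<open>K\<close> of the operator norm.
\<close>

lemma exp_partial_diff_bound: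
  assumes T: "bounded_operator T" and K: "K \<ge> 0" "\<And>f. f \<in> H \<Longrightarrow> nrm (T f) \<le> K * nrm f"
    and f: "f \<in> H" and "M \<le> N"
  shows "nrm (exp_partial T M f - exp_partial T N f)
    \<le> ((\<Sum>k<N. K ^ k / fact k) - (\<Sum>k<M. K ^ k / fact k)) * nrm f"
proof -
  let ?t = "\<lambda>k. (1 / fact k) \<odot> (T ^^ k) f"
  have "exp_partial T N f - exp_partial T M f = sum ?t {M..<N}"
    unfolding exp_partial_def lessThan_atLeast0 by (rule sum_diff_nat_ivl) (use \<open>M \<le> N\<close> in auto)
  moreover have "nrm (sum ?t {M..<N}) \<le> (\<Sum>k\<in>{M..<N}. nrm (?t k))"
    by (rule nrm_sum_le) (use funpow_bounded(1)[OF T K f] in auto)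
  moreover have "\<dots> \<le> (\<Sum>k\<in>{M..<N}. K ^ k / fact k * nrm f)"
  proof (rule sum_mono)
    fix k
    show "nrm (?t k) \<le> K ^ k / fact k * nrm f"
      using funpow_bounded[OF T K f, of k]
      by (simp add: nrm_scale norm_divide divide_right_mono)
  qed
  moreover have "(\<Sum>k\<in>{M..<N}. K ^ k / fact k * nrm f)
      = ((\<Sum>k<N. K ^ k / fact k) - (\<Sum>k<M. K ^ k / fact k)) * nrm f"
    unfolding sum_distrib_right[symmetric] lessThan_atLeast0
    using sum_diff_nat_ivl[of 0 M N "\<lambda>k. K ^ k / fact k"] \<open>M \<le> N\<close> by simp
  ultimately show ?thesis
    using T f by (simp add: nrm_minus_commute[of "exp_partial T M f"])
qed

lemma exp_partial_bound:
  assumes T: "bounded_operator T" and K: "K \<ge> 0" "\<And>f. f \<in> H \<Longrightarrow> nrm (T f) \<le> K * nrm f"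
    and f: "f \<in> H"
  shows "nrm (exp_partial T N f) \<le> (\<Sum>k<N. K ^ k / fact k) * nrm f"
  using exp_partial_diff_bound[OF T K f, of 0 N] T f
    nrm_minus[OF bounded_operator_exp_partial_closed[OF T f]]
  by (simp add: exp_partial_def)

lemma bounded_operator_cong:
  assumes T: "bounded_operator T" and eq: "\<And>f. f \<in> H \<Longrightarrow> S f = T f"
  shows "bounded_operator S"
proof -
  obtain K where "\<And>f. f \<in> H \<Longrightarrow> nrm (T f) \<le> K * nrm f"
    using bounded_operator_bound[OF T] by blast
  then show ?thesis
    unfolding bounded_operator_def
    by (intro conjI exI[of _ K])
       (simp_all add: eq T bounded_operator_add[OF T] bounded_operator_scale[OF T])
qed

lemma bounded_operator_minus:
  assumes P: "bounded_operator P" and S: "bounded_operator S"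
  shows "bounded_operator (\<lambda>f. P f - S f)"
proof -
  obtain K where K: "\<And>f. f \<in> H \<Longrightarrow> nrm (P f) \<le> K * nrm f"
    using bounded_operator_bound[OF P] by blast
  obtain L where L: "\<And>f. f \<in> H \<Longrightarrow> nrm (S f) \<le> L * nrm f"
    using bounded_operator_bound[OF S] by blast
  have "nrm (P f - S f) \<le> (K + L) * nrm f" if "f \<in> H" for f
    using nrm_triangle[of "P f" "- S f"] K[OF that] L[OF that] that P S
    by (simp add: nrm_minus distrib_right)
  then show ?thesis
    unfolding bounded_operator_def
    by (intro conjI exI[of _ "K + L"])
       (simp_all add: P S bounded_operator_add[OF P] bounded_operator_add[OF S]
         bounded_operator_scale[OF P] bounded_operator_scale[OF S] scale_right_diff_distrib)
qed

lemma bounded_operator_exp_partial: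
  assumes T: "bounded_operator T"
  shows "bounded_operator (exp_partial T N)"
proof -
  obtain K where K: "K \<ge> 0" "\<And>f. f \<in> H \<Longrightarrow> nrm (T f) \<le> K * nrm f"
    using bounded_operator_bound[OF T] by blast
  show ?thesis
    unfolding bounded_operator_def
    by (intro conjI exI[of _ "\<Sum>k<N. K ^ k / fact k"])
       (simp_all add: T exp_partial_add[OF T] exp_partial_scale[OF T] exp_partial_bound[OF T K])
qed

lemma exp_partial_cong:
  assumes T: "bounded_operator T" and eq: "\<And>f. f \<in> H \<Longrightarrow> S f = T f" and f: "f \<in> H"
  shows "exp_partial S N f = exp_partial T N f"
proof -
  have "(S ^^ k) f = (T ^^ k) f" for k
    by (induction k) (use f bounded_operator_closed[OF bounded_operator_funpow[OF T]] in \<open>auto simp: eq\<close>)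
  then show ?thesis
    by (simp add: exp_partial_def)
qed

lemma bounded_form_operator_left:
  assumes B: "bounded_form B" and T: "bounded_operator T"
  shows "bounded_form (\<lambda>f g. B (T f) g)"
proof -
  obtain C where C: "\<And>f g. f \<in> H \<Longrightarrow> g \<in> H \<Longrightarrow> cmod (B f g) \<le> C * nrm f * nrm g"
    using B unfolding bounded_form_def by blast
  obtain K where K: "K \<ge> 0" "\<And>f. f \<in> H \<Longrightarrow> nrm (T f) \<le> K * nrm f"
    using bounded_operator_bound[OF T] by blast
  have "cmod (B (T f) g) \<le> (\<bar>C\<bar> * K) * nrm f * nrm g" if "f \<in> H" "g \<in> H" for f g
  proof -
    have "cmod (B (T f) g) \<le> C * nrm (T f) * nrm g"
      using C that T by simp
    also have "\<dots> \<le> \<bar>C\<bar> * nrm (T f) * nrm g"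
      using that T by (intro mult_right_mono) auto
    also have "\<dots> \<le> \<bar>C\<bar> * (K * nrm f) * nrm g"
      using that K by (intro mult_right_mono mult_left_mono) auto
    finally show ?thesis
      by (simp add: mult.assoc)
  qed
  then show ?thesis
    unfolding bounded_form_def
    by (intro conjI exI[of _ "\<bar>C\<bar> * K"])
       (simp_all add: T bounded_form_add[OF B] bounded_form_scale[OF B] bounded_operator_add[OF T]
         bounded_operator_scale[OF T])
qed

end

lemma exp_sums_real: "(\<lambda>N. \<Sum>k<N. K ^ k / fact k) \<longlonglongrightarrow> exp (K::real)"
  using exp_converges[of K] by (simp add: sums_def divide_inverse mult.commute)

lemma exp_partial_sum_le: "K \<ge> 0 \<Longrightarrow> (\<Sum>k<N. K ^ k / fact k) \<le> exp (K::real)"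
  using sum_le_suminf[of "\<lambda>k. K ^ k / fact k" "{..<N}"] exp_sums_real[of K]
  by (simp add: sums_def[symmetric] sums_iff)

lemma sum_exp_coefficients:
  fixes a b :: "'a::field_char_0"
  shows "(\<Sum>i\<le>n. (a ^ i / fact i) * (b ^ (n - i) / fact (n - i))) = (a + b) ^ n / fact n"
proof -
  have "(a ^ i / fact i) * (b ^ (n - i) / fact (n - i)) = of_nat (n choose i) * a ^ i * b ^ (n - i) / fact n"
    if "i \<le> n" for i
    using binomial_fact[OF that, where 'a = 'a] by simp
  then show ?thesis
    by (simp add: binomial_ring sum_divide_distrib)
qed

section \<open>Hilbert spaces and the Riesz representation theorem\<close>

text \<open>
  The first order condition at a minimum: a nonnegative parabola through the origin has slope zero there.
\<close>

lemma linear_coefficient_zero: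
  fixes c d :: real
  assumes "d \<ge> 0" "\<And>t. 0 \<le> 2 * t * c + t\<^sup>2 * d"
  shows "c = 0"
proof (rule ccontr)
  assume "c \<noteq> 0"
  have "0 \<le> (2 * (- c / (d + 1)) * c + (- c / (d + 1))\<^sup>2 * d) * (d + 1)\<^sup>2"
    using assms(2)[of "- c / (d + 1)"] by (intro mult_nonneg_nonneg) auto
  also have "\<dots> = - (c\<^sup>2 * (d + 2))"
    using assms(1) by (simp add: divide_simps) (simp add: power2_eq_square algebra_simps)
  also have "\<dots> < 0"
    using \<open>c \<noteq> 0\<close> assms(1) by simp
  finally show False by simp
qed

locale complex_hilbert_space = complex_inner_space +
  assumes complete: "\<lbrakk>\<And>n::nat. x n \<in> H; \<And>e. e > 0 \<Longrightarrow> \<exists>N. \<forall>m\<ge>N. \<forall>n\<ge>N. nrm (x m - x n) < e\<rbrakk>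
    \<Longrightarrow> \<exists>l\<in>H. (\<lambda>n. nrm (x n - l)) \<longlonglongrightarrow> 0"
begin

text \<open>
  The representing vector minimises \<open>J f = \<parallel>f\<parallel>\<^sup>2 - 2 Re (\<phi> f)\<close>. By the parallelogram law, \<open>\<parallel>f - g\<parallel>\<^sup>2\<close> is
  controlled by how far \<open>J f\<close> and \<open>J g\<close> are above the infimum, so minimising sequences converge. The
  first order condition is read off from the sequence itself, so that only continuity of the inner
  product enters.
\<close>

theorem Riesz_representation:
  assumes add: "\<And>f g. \<lbrakk>f \<in> H; g \<in> H\<rbrakk> \<Longrightarrow> \<phi> (f + g) = \<phi> f + \<phi> g"
    and scale: "\<And>c f. f \<in> H \<Longrightarrow> \<phi> (c \<odot> f) = c * \<phi> f"
    and bound: "\<And>f. f \<in> H \<Longrightarrow> cmod (\<phi> f) \<le> K * nrm f"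
  shows "\<exists>z\<in>H. \<forall>f\<in>H. \<phi> f = ip f z"
proof -
  define J where "J f = (nrm f)\<^sup>2 - 2 * Re (\<phi> f)" for f
  have J_lower: "- K\<^sup>2 \<le> J f" if "f \<in> H" for f
  proof -
    have "Re (\<phi> f) \<le> K * nrm f"
      using bound[OF that] complex_Re_le_cmod order_trans by blast
    moreover have "0 \<le> (nrm f - K)\<^sup>2" by simp
    ultimately show ?thesis by (simp add: J_def power2_diff algebra_simps)
  qed
  define m where "m = Inf (J ` H)"
  have bdd: "bdd_below (J ` H)"
    using J_lower by (auto simp: bdd_below_def)
  have m_le: "m \<le> J f" if "f \<in> H" for f
    unfolding m_def using that bdd by (auto intro: cInf_lower)
  have "\<exists>f\<in>H. J f < m + 1 / Suc n" for n
    using cInf_lessD[of "J ` H" "m + 1 / Suc n"] carrier_closed(1) by (auto simp: m_def simp del: carrier_closed)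
  then obtain x where x: "\<And>n. x n \<in> H" "\<And>n. J (x n) < m + 1 / Suc n"
    by metis
  \<comment> \<open>The parallelogram law, solved for the difference.\<close>
  have quarter: "(nrm (f - g))\<^sup>2 = 2 * (J f + J g - 2 * J ((1/2) \<odot> (f + g)))" if "f \<in> H" "g \<in> H" for f g
  proof -
    have "J ((1/2) \<odot> (f + g)) = (nrm (f + g))\<^sup>2 / 4 - Re (\<phi> f) - Re (\<phi> g)"
      using that unfolding J_def
      by (simp add: nrm_scale scale add power_divide add_divide_distrib del: scale_right_distrib)
    then show ?thesis
      using that by (simp add: J_def nrm_add_power2 nrm_diff_power2 field_simps)
  qed
  have "\<exists>N. \<forall>m\<ge>N. \<forall>n\<ge>N. nrm (x m - x n) < e" if "e > 0" for e
  proof -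
    obtain N where N: "4 / Suc N < e\<^sup>2"
      using reals_Archimedean[of "e\<^sup>2 / 4"] \<open>e > 0\<close> by (auto simp: field_simps)
    have "nrm (x i - x j) < e" if "i \<ge> N" "j \<ge> N" for i j
    proof (rule power_less_imp_less_base)
      have "1 / real (Suc i) \<le> 1 / Suc N" "1 / real (Suc j) \<le> 1 / Suc N"
        using that by (auto intro!: divide_left_mono)
      then have "J (x i) + J (x j) - 2 * J ((1/2) \<odot> (x i + x j)) < 2 / Suc N"
        using x(2)[of i] x(2)[of j] m_le[of "(1/2) \<odot> (x i + x j)"] x(1) by auto
      then show "(nrm (x i - x j))\<^sup>2 < e\<^sup>2"
        using N quarter[of "x i" "x j"] x(1) by simp
    qed (use \<open>e > 0\<close> in simp)
    then show ?thesis by blast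
  qed
  then obtain z where z: "z \<in> H" "(\<lambda>n. nrm (x n - z)) \<longlonglongrightarrow> 0"
    using complete x(1) by blast
  have real_part: "Re (\<phi> v) = Re (ip v z)" if v: "v \<in> H" for v
  proof -
    have lim: "(\<lambda>n. ip (x n) v) \<longlonglongrightarrow> ip z v"
      by (rule bounded_form_tendsto[OF bounded_form_ip]) (use x z v in simp_all)
    have "0 \<le> 2 * t * (Re (ip z v) - Re (\<phi> v)) + t\<^sup>2 * (nrm v)\<^sup>2" for t
    proof -
      have "0 \<le> 2 * t * (Re (ip (x n) v) - Re (\<phi> v)) + t\<^sup>2 * (nrm v)\<^sup>2 + 1 / Suc n" for n
      proof -
        have "J (x n) - 1 / Suc n \<le> J (x n + of_real t \<odot> v)"
          using x(2)[of n] m_le[of "x n + of_real t \<odot> v"] x(1) v by simp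
        then show ?thesis
          using x(1) v by (simp add: J_def nrm_add_power2 nrm_scale power_mult_distrib
              ip_scale_right add scale algebra_simps)
      qed
      moreover have "(\<lambda>n. 2 * t * (Re (ip (x n) v) - Re (\<phi> v)) + t\<^sup>2 * (nrm v)\<^sup>2 + 1 / Suc n)
          \<longlonglongrightarrow> 2 * t * (Re (ip z v) - Re (\<phi> v)) + t\<^sup>2 * (nrm v)\<^sup>2 + 0"
        by (intro tendsto_intros lim LIMSEQ_Suc[OF lim_1_over_n, unfolded of_nat_Suc] lim_1_over_n[THEN LIMSEQ_Suc])
      ultimately show ?thesis
        using tendsto_lowerbound by (simp add: LIMSEQ_le_const)
    qed
    from linear_coefficient_zero[OF _ this] show ?thesis
      using ip_commute[of z v] z v by simp
  qed
  have "\<phi> v = ip v z" if v: "v \<in> H" for v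
    using real_part[OF v] real_part[of "\<i> \<odot> v"] v z scale[OF v, of \<i>]
    by (simp add: ip_scale_left complex_eq_iff)
  with z show ?thesis by blast
qed

text \<open>
  The vector \<open>S g\<close> represents the functional \<open>f \<mapsto> B f g\<close>. Both adjoints (\<open>B f g = [T f, g]\<close>) and the
  operator \<open>A\<close> (\<open>B f g = \<langle>f, g\<rangle>\<close>) arise in this way.
\<close>

theorem adjoint_exists:
  assumes B: "bounded_form B"
  shows "\<exists>S. bounded_operator S \<and> (\<forall>f\<in>H. \<forall>g\<in>H. B f g = ip f (S g))"
proof -
  obtain C where C: "\<And>f g. f \<in> H \<Longrightarrow> g \<in> H \<Longrightarrow> cmod (B f g) \<le> C * nrm f * nrm g"
    using B unfolding bounded_form_def by blast
  have "\<exists>z\<in>H. \<forall>f\<in>H. B f g = ip f z" if "g \<in> H" for g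
    by (rule Riesz_representation[where K = "C * nrm g"])
       (use C that in \<open>auto simp: bounded_form_add[OF B] bounded_form_scale[OF B] mult.assoc mult.left_commute mult.commute\<close>)
  then obtain S where S: "\<And>g. g \<in> H \<Longrightarrow> S g \<in> H" "\<And>f g. f \<in> H \<Longrightarrow> g \<in> H \<Longrightarrow> B f g = ip f (S g)"
    by metis
  have eqI: "f = g" if "f \<in> H" "g \<in> H" "\<And>h. h \<in> H \<Longrightarrow> ip h f = ip h g" for f g
    using ip_eqI[of f g] that by (metis ip_commute)
  have "S (f + g) = S f + S g" if "f \<in> H" "g \<in> H" for f g
    by (rule eqI) (use that S in \<open>auto simp: ip_add_right bounded_form_add[OF B] simp flip: S(2)\<close>)
  moreover have "S (c \<odot> f) = c \<odot> S f" if "f \<in> H" for c f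
    by (rule eqI) (use that S in \<open>auto simp: ip_scale_right bounded_form_scale[OF B] simp flip: S(2)\<close>)
  moreover have "nrm (S f) \<le> C * nrm f" if f: "f \<in> H" for f
  proof (cases "nrm (S f) = 0")
    case True
    have "0 \<le> C * nrm f * nrm f"
      using C[OF f f] norm_ge_zero order_trans by blast
    then show ?thesis
      using True f nrm_nonneg[of f] by (cases "nrm f = 0") (auto simp: zero_le_mult_iff simp del: nrm_nonneg)
  next
    case False
    have "(nrm (S f))\<^sup>2 = cmod (ip (S f) (S f))"
      using ip_self[of "S f"] S(1)[OF f] by (simp add: norm_power)
    also have "\<dots> = cmod (B (S f) f)"
      using S f by simp
    also have "\<dots> \<le> C * nrm (S f) * nrm f"
      using C[of "S f" f] S f by simp
    finally have "nrm (S f) * nrm (S f) \<le> nrm (S f) * (C * nrm f)"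
      by (simp add: power2_eq_square mult_ac)
    then show ?thesis
      using False nrm_nonneg[OF S(1)[OF f]] by (simp add: mult_le_cancel_left less_le)
  qed
  ultimately have "bounded_operator S"
    unfolding bounded_operator_def using S(1) by blast
  with S(2) show ?thesis by blast
qed

section \<open>The exponential of a bounded operator\<close>

definition exp_op :: "('a \<Rightarrow> 'a) \<Rightarrow> 'a \<Rightarrow> 'a" where
  "exp_op T f = (SOME l. l \<in> H \<and> (\<lambda>N. nrm (exp_partial T N f - l)) \<longlonglongrightarrow> 0)"

lemma exp_op_limit:
  assumes T: "bounded_operator T" and f: "f \<in> H"
  shows "exp_op T f \<in> H" "(\<lambda>N. nrm (exp_partial T N f - exp_op T f)) \<longlonglongrightarrow> 0"
proof -
  obtain K where K: "K \<ge> 0" "\<And>f. f \<in> H \<Longrightarrow> nrm (T f) \<le> K * nrm f"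
    using bounded_operator_bound[OF T] by blast
  let ?s = "\<lambda>N. \<Sum>k<N. K ^ k / fact k"
  have "Cauchy (\<lambda>N. ?s N * nrm f)"
    by (intro convergent_Cauchy convergentI[OF tendsto_mult[OF exp_sums_real tendsto_const]])
  have le: "nrm (exp_partial T M f - exp_partial T N f) \<le> dist (?s M * nrm f) (?s N * nrm f)" for M N
  proof (induction M N rule: linorder_wlog)
    case (le M N)
    then show ?case
      using exp_partial_diff_bound[OF T K f, of M N] by (simp add: dist_real_def left_diff_distrib)
  next
    case (sym M N)
    then show ?case
      using T f by (simp add: dist_commute nrm_minus_commute[of "exp_partial T M f"])
  qed
  have "\<exists>N. \<forall>m\<ge>N. \<forall>n\<ge>N. nrm (exp_partial T m f - exp_partial T n f) < e" if "e > 0" for e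
    using \<open>Cauchy _\<close> le \<open>e > 0\<close> unfolding Cauchy_def by (meson order_le_less_trans)
  then have "\<exists>l. l \<in> H \<and> (\<lambda>N. nrm (exp_partial T N f - l)) \<longlonglongrightarrow> 0"
    using complete[of "\<lambda>N. exp_partial T N f"] T f by auto
  from someI_ex[OF this]
  show "exp_op T f \<in> H" "(\<lambda>N. nrm (exp_partial T N f - exp_op T f)) \<longlonglongrightarrow> 0"
    unfolding exp_op_def by auto
qed

lemma exp_op_eqI:
  assumes "bounded_operator T" "f \<in> H" "l \<in> H" "(\<lambda>N. nrm (exp_partial T N f - l)) \<longlonglongrightarrow> 0"
  shows "exp_op T f = l"
  by (rule nrm_limit_unique[of "\<lambda>N. exp_partial T N f" _ _ sequentially])
     (use assms exp_op_limit in auto)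

text \<open>
  The case \<open>N = 0\<close> bounds the exponential; the cases \<open>N = 1\<close> and \<open>N = 2\<close> give its continuity and its
  derivative along \<open>t \<mapsto> tY\<close> at \<open>t = 0\<close>.
\<close>

lemma exp_op_remainder:
  assumes T: "bounded_operator T" and K: "K \<ge> 0" "\<And>f. f \<in> H \<Longrightarrow> nrm (T f) \<le> K * nrm f"
    and f: "f \<in> H"
  shows "nrm (exp_partial T N f - exp_op T f) \<le> (exp K - (\<Sum>k<N. K ^ k / fact k)) * nrm f"
proof -
  let ?s = "\<lambda>N. \<Sum>k<N. K ^ k / fact k"
  have "(\<lambda>M. (?s M - ?s N) * nrm f + nrm (exp_partial T M f - exp_op T f))
      \<longlonglongrightarrow> (exp K - ?s N) * nrm f + 0"
    by (intro tendsto_intros exp_sums_real exp_op_limit T f)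
  moreover have "nrm (exp_partial T N f - exp_op T f)
      \<le> (?s M - ?s N) * nrm f + nrm (exp_partial T M f - exp_op T f)" if "M \<ge> N" for M
    using nrm_triangle_diff[of "exp_partial T N f" "exp_partial T M f" "exp_op T f"]
      exp_partial_diff_bound[OF T K f that] exp_op_limit(1)[OF T f] T f by simp
  ultimately show ?thesis
    by (intro LIMSEQ_le_const[of _ "(exp K - ?s N) * nrm f"]) auto
qed

lemma exp_op_bounded:
  assumes T: "bounded_operator T" and K: "K \<ge> 0" "\<And>f. f \<in> H \<Longrightarrow> nrm (T f) \<le> K * nrm f"
    and f: "f \<in> H"
  shows "nrm (exp_op T f) \<le> exp K * nrm f"
  using exp_op_remainder[OF assms, of 0] exp_op_limit(1)[OF T f]
  by (simp add: exp_partial_def nrm_minus)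

lemma bounded_operator_exp_op:
  assumes T: "bounded_operator T"
  shows "bounded_operator (exp_op T)"
proof -
  have "exp_op T (f + g) = exp_op T f + exp_op T g" if "f \<in> H" "g \<in> H" for f g
  proof (rule exp_op_eqI[OF T])
    have b: "(\<lambda>N. nrm (exp_partial T N f - exp_op T f) + nrm (exp_partial T N g - exp_op T g)) \<longlonglongrightarrow> 0"
      using tendsto_add[OF exp_op_limit(2)[OF T \<open>f \<in> H\<close>] exp_op_limit(2)[OF T \<open>g \<in> H\<close>]] by simp
    have "nrm (exp_partial T N (f + g) - (exp_op T f + exp_op T g))
       \<le> nrm (exp_partial T N f - exp_op T f) + nrm (exp_partial T N g - exp_op T g)" for N
      using nrm_triangle[of "exp_partial T N f - exp_op T f" "exp_partial T N g - exp_op T g"] that T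
      by (simp add: exp_partial_add exp_op_limit algebra_simps)
    then show "(\<lambda>N. nrm (exp_partial T N (f + g) - (exp_op T f + exp_op T g))) \<longlonglongrightarrow> 0"
      by (intro nrm_tendsto_squeeze[OF b]) (use that T exp_op_limit in auto)
  qed (use that exp_op_limit(1)[OF T] in auto)
  moreover have "exp_op T (c \<odot> f) = c \<odot> exp_op T f" if "f \<in> H" for c f
  proof (rule exp_op_eqI[OF T])
    have "nrm (exp_partial T N (c \<odot> f) - c \<odot> exp_op T f) = cmod c * nrm (exp_partial T N f - exp_op T f)" for N
      using that T exp_op_limit(1)[OF T that]
      by (simp add: exp_partial_scale nrm_scale scale_right_diff_distrib[symmetric])
    then show "(\<lambda>N. nrm (exp_partial T N (c \<odot> f) - c \<odot> exp_op T f)) \<longlonglongrightarrow> 0"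
      using tendsto_mult_left[OF exp_op_limit(2)[OF T that], of "cmod c"] by simp
  qed (use that exp_op_limit(1)[OF T] in auto)
  moreover obtain K where K: "K \<ge> 0" "\<And>f. f \<in> H \<Longrightarrow> nrm (T f) \<le> K * nrm f"
    using bounded_operator_bound[OF T] by blast
  ultimately show ?thesis
    unfolding bounded_operator_def
    by (intro conjI exI[of _ "exp K"]) (simp_all add: exp_op_limit(1)[OF T] exp_op_bounded[OF T K])
qed

lemma exp_op_adjoint:
  assumes B: "bounded_form B" and T: "bounded_operator T" and S: "bounded_operator S"
    and adj: "\<And>f g. \<lbrakk>f \<in> H; g \<in> H\<rbrakk> \<Longrightarrow> B (T f) g = B f (S g)" and "f \<in> H" "g \<in> H"
  shows "B (exp_op T f) g = B f (exp_op S g)"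
proof -
  note mem = \<open>f \<in> H\<close> \<open>g \<in> H\<close>
  note closed = bounded_operator_closed[OF bounded_operator_funpow]
  have pow: "B ((T ^^ k) f) g = B f ((S ^^ k) g)" for k
    using \<open>g \<in> H\<close>
  proof (induction k arbitrary: g)
    case (Suc k)
    then have "B ((T ^^ Suc k) f) g = B ((T ^^ k) f) (S g)"
      using adj[of "(T ^^ k) f" g] closed[OF T] mem by simp
    also have "\<dots> = B f ((S ^^ k) (S g))"
      using Suc S by simp
    finally show ?case
      by (simp only: funpow_Suc_right o_apply)
  qed simp
  have "B (exp_partial T N f) g = B f (exp_partial S N g)" for N
    unfolding exp_partial_def
    using mem T S closed by (simp add: bounded_form_sum[OF B] bounded_form_scale[OF B] pow)
  moreover have "(\<lambda>N. B (exp_partial T N f) g) \<longlonglongrightarrow> B (exp_op T f) g"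
    by (rule bounded_form_tendsto[OF B]) (use mem T exp_op_limit in auto)
  moreover have "(\<lambda>N. B f (exp_partial S N g)) \<longlonglongrightarrow> B f (exp_op S g)"
    by (rule bounded_form_tendsto[OF B]) (use mem S exp_op_limit in auto)
  ultimately show ?thesis
    using LIMSEQ_unique by auto
qed

text \<open>
  The product of two partial sums is a sum over the square \<open>k, j < N\<close>. On the triangle \<open>k + j < N\<close>
  the binomial theorem with \<open>1 + (-1) = 0\<close> leaves only \<open>f\<close>. The rest of the square is dominated by
  the same part of the scalar product \<open>e\<^sup>K e\<^sup>K\<close>, which is \<open>s\<^sub>N(K)\<^sup>2 - s\<^sub>N(2K)\<close> for the scalar partial
  sums \<open>s\<^sub>N\<close> and hence tends to \<open>0\<close>.
\<close>

lemma exp_op_inverse: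
  assumes T: "bounded_operator T" and S: "bounded_operator S"
    and neg: "\<And>f. f \<in> H \<Longrightarrow> S f = - T f" and f: "f \<in> H"
  shows "exp_op T (exp_op S f) = f"
proof -
  obtain K where K: "K \<ge> 0" "\<And>f. f \<in> H \<Longrightarrow> nrm (T f) \<le> K * nrm f"
    using bounded_operator_bound[OF T] by blast
  let ?s = "\<lambda>K N. \<Sum>k<N. K ^ k / fact k :: real"
  define c :: "nat \<Rightarrow> nat \<Rightarrow> complex" where "c k j = (1 ^ k / fact k) * ((- 1) ^ j / fact j)" for k j
  note pow_closed = funpow_bounded(1)[OF T K]
  have S_pow: "(S ^^ j) f = (- 1) ^ j \<odot> (T ^^ j) f" for j
    by (induction j) (use pow_closed f in \<open>auto simp: neg bounded_operator_scale[OF T]\<close>)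
  have product: "exp_partial T N (exp_partial S N f)
      = (\<Sum>(k, j)\<in>{..<N} \<times> {..<N}. c k j \<odot> (T ^^ (k + j)) f)" for N
  proof -
    have "(T ^^ k) (exp_partial S N f) = (\<Sum>j<N. ((- 1) ^ j / fact j) \<odot> (T ^^ (k + j)) f)" for k
      using pow_closed f unfolding exp_partial_def S_pow
      by (simp add: bounded_operator_sum[OF bounded_operator_funpow[OF T]]
          bounded_operator_scale[OF bounded_operator_funpow[OF T]] funpow_add)
    then show ?thesis
      unfolding exp_partial_def[of T N] sum.cartesian_product[symmetric]
      by (simp add: c_def scale_sum_right)
  qed
  have error: "nrm (exp_partial T N (exp_partial S N f) - f) \<le> ((?s K N)\<^sup>2 - ?s (K + K) N) * nrm f"
    if "N > 0" for N
  proof -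
    let ?D = "{(k, j). k + j < N}" and ?Q = "{..<N} \<times> {..<N}"
    let ?t = "\<lambda>(k, j). c k j \<odot> (T ^^ (k + j)) f"
    let ?b = "\<lambda>(k, j). (K ^ k / fact k) * (K ^ j / fact j)"
    have D: "?D \<subseteq> ?Q" by auto
    have "sum ?t ?D = (\<Sum>n<N. \<Sum>i\<le>n. c i (n - i) \<odot> (T ^^ n) f)"
      by (simp add: sum.triangle_reindex)
    also have "\<dots> = (\<Sum>n<N. ((1 + (- 1)) ^ n / fact n) \<odot> (T ^^ n) f)"
      unfolding c_def scale_sum_left[symmetric] sum_exp_coefficients ..
    also have "\<dots> = (\<Sum>n<N. if n = 0 then f else 0)"
      by (intro sum.cong) auto
    also have "\<dots> = f"
      using that by (simp add: sum.delta)
    finally have "exp_partial T N (exp_partial S N f) - f = sum ?t (?Q - ?D)"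
      using D by (simp add: product sum_diff)
    also have "nrm \<dots> \<le> (\<Sum>p\<in>?Q - ?D. nrm (?t p))"
      by (rule nrm_sum_le) (use pow_closed f in auto)
    also have "\<dots> \<le> (\<Sum>p\<in>?Q - ?D. ?b p * nrm f)"
    proof (rule sum_mono)
      have "nrm (c k j \<odot> (T ^^ (k + j)) f) \<le> (K ^ k / fact k) * (K ^ j / fact j) * nrm f" for k j
        using funpow_bounded[OF T K f, of "k + j"]
        by (simp add: nrm_scale c_def norm_mult norm_divide norm_power power_add divide_right_mono)
      then show "nrm (?t p) \<le> ?b p * nrm f" for p
        by (cases p) simp
    qed
    also have "\<dots> = (sum ?b ?Q - sum ?b ?D) * nrm f"
      using D by (simp add: sum_distrib_right[symmetric] sum_diff)
    also have "sum ?b ?Q = (?s K N)\<^sup>2"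
      by (simp add: sum.cartesian_product[symmetric] power2_eq_square sum_product)
    also have "sum ?b ?D = ?s (K + K) N"
      by (simp add: sum.triangle_reindex sum_exp_coefficients del: times_divide_eq_left times_divide_eq_right)
    finally show ?thesis .
  qed
  have lim1: "(\<lambda>N. ((?s K N)\<^sup>2 - ?s (K + K) N) * nrm f) \<longlonglongrightarrow> ((exp K)\<^sup>2 - exp (K + K)) * nrm f"
    by (intro tendsto_intros exp_sums_real)
  have zero: "((exp K)\<^sup>2 - exp (K + K)) * nrm f = 0"
    unfolding exp_add power2_eq_square by simp
  let ?g = "exp_op S f"
  have g: "?g \<in> H" using exp_op_limit(1)[OF S f] .
  have lim: "(\<lambda>N. exp K * nrm (exp_partial S N f - ?g) + ((?s K N)\<^sup>2 - ?s (K + K) N) * nrm f) \<longlonglongrightarrow> 0"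
    using tendsto_add[OF tendsto_mult_left[OF exp_op_limit(2)[OF S f], of "exp K"] lim1]
    unfolding zero mult_zero_right add_0_right .
  have "(\<lambda>N. nrm (exp_partial T N ?g - f)) \<longlonglongrightarrow> 0"
  proof (rule nrm_tendsto_squeeze[OF lim])
    have "nrm (exp_partial T N ?g - f)
        \<le> exp K * nrm (exp_partial S N f - ?g) + ((?s K N)\<^sup>2 - ?s (K + K) N) * nrm f" if "N > 0" for N
    proof -
      let ?p = "exp_partial S N f"
      have p: "?p \<in> H" using S f by simp
      have "exp_partial T N (?g - ?p) = exp_partial T N ?g - exp_partial T N ?p"
        using exp_partial_add[OF T, of "?g - ?p" ?p N] g p by simp
      then have "nrm (exp_partial T N ?g - exp_partial T N ?p) \<le> ?s K N * nrm (?g - ?p)"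
        using exp_partial_bound[OF T K, of "?g - ?p" N] g p by simp
      also have "\<dots> \<le> exp K * nrm (?p - ?g)"
        using exp_partial_sum_le[OF K(1), of N] g p nrm_minus_commute[of ?g ?p]
        by (simp add: mult_right_mono)
      finally show ?thesis
        using nrm_triangle_diff[of "exp_partial T N ?g" "exp_partial T N ?p" f] error[OF that] T p g f
        by simp
    qed
    then show "\<forall>\<^sub>F N in sequentially. nrm (exp_partial T N ?g - f)
        \<le> exp K * nrm (exp_partial S N f - ?g) + ((?s K N)\<^sup>2 - ?s (K + K) N) * nrm f"
      by (rule eventually_mono[OF eventually_gt_at_top[of 0]])
  qed (use T g f in simp)
  then show ?thesis
    by (rule exp_op_eqI[OF T g f])
qed

lemma exp_op_derivative:
  assumes Y: "bounded_operator Y" and f: "f \<in> H"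
  shows "((\<lambda>t::real. nrm (exp_op (\<lambda>f. of_real t \<odot> Y f) f - f)) \<longlongrightarrow> 0) (at 0)"
    and "((\<lambda>t::real. nrm ((1 / of_real t) \<odot> (exp_op (\<lambda>f. of_real t \<odot> Y f) f - f) - Y f)) \<longlongrightarrow> 0) (at 0)"
proof -
  obtain K where K: "K \<ge> 0" "\<And>f. f \<in> H \<Longrightarrow> nrm (Y f) \<le> K * nrm f"
    using bounded_operator_bound[OF Y] by blast
  let ?Y = "\<lambda>t::real. \<lambda>f. of_real t \<odot> Y f"
  have tY: "bounded_operator (?Y t)" for t
    by (rule bounded_operator_scaled[OF Y])
  have tK: "\<bar>t\<bar> * K \<ge> 0" "nrm (?Y t f) \<le> \<bar>t\<bar> * K * nrm f" if "f \<in> H" for t f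
    using K that Y by (auto simp: nrm_scale mult.assoc intro: mult_left_mono)
  note rem = exp_op_remainder[OF tY tK(1)[OF f] tK(2) f]
  have E: "exp_op (?Y t) f \<in> H" for t
    by (rule exp_op_limit(1)[OF tY f])
  have "nrm (exp_op (?Y t) f - f) \<le> (exp (\<bar>t\<bar> * K) - 1) * nrm f" for t
    using rem[of t 1] nrm_minus_commute[OF f E[of t]] by (simp add: exp_partial_def)
  moreover have "((\<lambda>t. (exp (\<bar>t\<bar> * K) - 1) * nrm f) \<longlongrightarrow> (exp (\<bar>0\<bar> * K) - 1) * nrm f) (at 0)"
    by (intro tendsto_intros)
  ultimately show "((\<lambda>t. nrm (exp_op (?Y t) f - f)) \<longlongrightarrow> 0) (at 0)"
    by (intro nrm_tendsto_squeeze[of "\<lambda>t. (exp (\<bar>t\<bar> * K) - 1) * nrm f"]) (use E f in simp_all)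
  have bound: "nrm ((1 / of_real t) \<odot> (exp_op (?Y t) f - f) - Y f) \<le> \<bar>t\<bar> * (K\<^sup>2 * nrm f)"
    if "\<bar>t\<bar> * K < 1" "t \<noteq> 0" for t
  proof -
    have part: "exp_partial (?Y t) 2 f = f + of_real t \<odot> Y f"
      by (simp add: exp_partial_def numeral_2_eq_2)
    have "exp (\<bar>t\<bar> * K) - (\<Sum>k<2. (\<bar>t\<bar> * K) ^ k / fact k) \<le> (\<bar>t\<bar> * K)\<^sup>2"
      using exp_bound[of "\<bar>t\<bar> * K"] that tK(1)[OF f, of t] by (simp add: numeral_2_eq_2)
    from order_trans[OF rem[of t 2, unfolded part] mult_right_mono[OF this nrm_nonneg[OF f]]]
    have "nrm (f + of_real t \<odot> Y f - exp_op (?Y t) f) \<le> (\<bar>t\<bar> * K)\<^sup>2 * nrm f" .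
    moreover have "(1 / of_real t) \<odot> (exp_op (?Y t) f - f) - Y f
        = (- 1 / of_real t) \<odot> (f + of_real t \<odot> Y f - exp_op (?Y t) f)"
      using that(2) by (simp add: scale_right_diff_distrib scale_right_distrib)
    ultimately have "nrm ((1 / of_real t) \<odot> (exp_op (?Y t) f - f) - Y f) \<le> 1 / \<bar>t\<bar> * ((\<bar>t\<bar> * K)\<^sup>2 * nrm f)"
      using f Y E[of t] nrm_scale[of "f + of_real t \<odot> Y f - exp_op (?Y t) f" "- 1 / of_real t"]
      by (simp add: norm_divide divide_right_mono del: scale_minus_left)
    also have "\<dots> = \<bar>t\<bar> * (K\<^sup>2 * nrm f)"
      using that(2) by (simp add: power2_eq_square)
    finally show ?thesis .
  qed
  have "((\<lambda>t. \<bar>t\<bar> * K) \<longlongrightarrow> \<bar>0\<bar> * K) (at 0)"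
    by (intro tendsto_intros)
  then have "\<forall>\<^sub>F t in at 0. \<bar>t\<bar> * K < 1"
    by (rule order_tendstoD) simp
  then have "\<forall>\<^sub>F t in at 0. nrm ((1 / of_real t) \<odot> (exp_op (?Y t) f - f) - Y f) \<le> \<bar>t\<bar> * (K\<^sup>2 * nrm f)"
    using eventually_neq_at_within by eventually_elim (rule bound)
  moreover have "((\<lambda>t. \<bar>t\<bar> * (K\<^sup>2 * nrm f)) \<longlongrightarrow> \<bar>0\<bar> * (K\<^sup>2 * nrm f)) (at 0)"
    by (intro tendsto_intros)
  ultimately show "((\<lambda>t. nrm ((1 / of_real t) \<odot> (exp_op (?Y t) f - f) - Y f)) \<longlongrightarrow> 0) (at 0)"
    by (intro nrm_tendsto_squeeze[of "\<lambda>t. \<bar>t\<bar> * (K\<^sup>2 * nrm f)"]) (use E f Y in simp_all)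
qed

text \<open>
  One direction differentiates at \<open>t = 0\<close>; the other writes \<open>B (E t f) (E t g) = B f (E (- t) (E t g))\<close>.
\<close>

theorem exp_op_preserves_form_iff:
  assumes B: "bounded_form B" and Y: "bounded_operator Y"
  defines "E \<equiv> \<lambda>t::real. exp_op (\<lambda>f. of_real t \<odot> Y f)"
  shows "(\<forall>t. \<forall>f\<in>H. \<forall>g\<in>H. B (E t f) (E t g) = B f g) \<longleftrightarrow>
    (\<forall>f\<in>H. \<forall>g\<in>H. B (Y f) g + B f (Y g) = 0)"
proof (intro iffI allI ballI)
  fix f g
  assume inv: "\<forall>t. \<forall>f\<in>H. \<forall>g\<in>H. B (E t f) (E t g) = B f g" and mem: "f \<in> H" "g \<in> H"
  have E: "E t f \<in> H" if "f \<in> H" for t f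
    unfolding E_def by (rule exp_op_limit(1)[OF bounded_operator_scaled[OF Y] that])
  let ?q = "\<lambda>t f. (1 / of_real t) \<odot> (E t f - f)"
  have deriv: "((\<lambda>t. nrm (E t f - f)) \<longlongrightarrow> 0) (at 0)" "((\<lambda>t. nrm (?q t f - Y f)) \<longlongrightarrow> 0) (at 0)"
    if "f \<in> H" for f
    unfolding E_def by (fact exp_op_derivative[OF Y that])+
  have q: "?q t f \<in> H" if "f \<in> H" for t f
    using that E by simp
  have "B (?q t f) (E t g) + B f (?q t g) = 0" for t
    using mem E inv by (simp add: bounded_form_scale[OF B] bounded_form_diff[OF B]
        flip: add_divide_distrib del: scale_right_diff_distrib)
  moreover have "((\<lambda>t. B (?q t f) (E t g) + B f (?q t g)) \<longlongrightarrow> B (Y f) g + B f (Y g)) (at 0)"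
  proof (rule tendsto_add)
    show "((\<lambda>t. B (?q t f) (E t g)) \<longlongrightarrow> B (Y f) g) (at 0)"
      by (rule bounded_form_tendsto[OF B]) (use q E Y deriv mem in simp_all)
    show "((\<lambda>t. B f (?q t g)) \<longlongrightarrow> B f (Y g)) (at 0)"
      by (rule bounded_form_tendsto[OF B]) (use q E Y deriv mem in simp_all)
  qed
  ultimately have "((\<lambda>t::real. 0) \<longlongrightarrow> B (Y f) g + B f (Y g)) (at 0)"
    by simp
  then show "B (Y f) g + B f (Y g) = 0"
    using LIM_unique[OF tendsto_const] by metis
next
  fix t f g
  assume skew: "\<forall>f\<in>H. \<forall>g\<in>H. B (Y f) g + B f (Y g) = 0" and mem: "f \<in> H" "g \<in> H"
  let ?T = "\<lambda>t::real. \<lambda>f. of_real t \<odot> Y f"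
  have T: "bounded_operator (?T t)" for t
    by (rule bounded_operator_scaled[OF Y])
  have "B (E t f) (E t g) = B f (E (- t) (E t g))"
    unfolding E_def
  proof (rule exp_op_adjoint[OF B T T])
    fix f g assume fg: "f \<in> H" "g \<in> H"
    then have "B (Y f) g = - B f (Y g)"
      using skew by (simp add: eq_neg_iff_add_eq_0)
    then show "B (?T t f) g = B f (?T (- t) g)"
      using fg bounded_form_scale(1)[OF B, of "Y f" g "of_real t"]
        bounded_form_scale(2)[OF B, of f "Y g" "of_real (- t)"] Y by simp
  qed (use mem exp_op_limit(1)[OF T] in auto)
  also have "E (- t) (E t g) = g"
    unfolding E_def by (rule exp_op_inverse[OF T T _ mem(2)]) simp
  finally show "B (E t f) (E t g) = B f g" .
qed

lemma exp_op_cong: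
  assumes T: "bounded_operator T" and eq: "\<And>f. f \<in> H \<Longrightarrow> S f = T f" and f: "f \<in> H"
  shows "exp_op S f = exp_op T f"
  using exp_partial_cong[OF T eq f] by (simp add: exp_op_def)

text \<open>
  A limit of limits of elements of \<open>T\<close> is again a limit of elements of \<open>T\<close>: pick for the \<open>n\<close>-th
  term an approximation in \<open>T\<close> with error below \<open>1 / (n + 1)\<close>.
\<close>

lemma closure_of_subspace:
  assumes T: "subspace T" "T \<subseteq> H"
  shows "complex_hilbert_space scale {f \<in> H. \<exists>t. (\<forall>k::nat. t k \<in> T) \<and> (\<lambda>k. nrm (f - t k)) \<longlonglongrightarrow> 0} ip"
    (is "complex_hilbert_space _ ?C _")
proof unfold_locales
  note TH = subsetD[OF T(2)]
  show "subspace ?C"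
    unfolding subspace_def
  proof (intro conjI ballI allI)
    show "0 \<in> ?C"
      using subspace_0[OF T(1)] by (auto intro!: exI[of _ "\<lambda>_. 0"])
    fix f g c
    assume "f \<in> ?C"
    then obtain s where s: "f \<in> H" "\<And>k. s k \<in> T" "(\<lambda>k. nrm (f - s k)) \<longlonglongrightarrow> 0" by auto
    have "nrm (c \<odot> f - c \<odot> s k) = cmod c * nrm (f - s k)" for k
      using s TH[OF s(2)[of k]] by (simp only: scale_right_diff_distrib[symmetric] nrm_scale carrier_closed)
    then have "(\<lambda>k. nrm (c \<odot> f - c \<odot> s k)) \<longlonglongrightarrow> 0"
      using tendsto_mult_left[OF s(3), of "cmod c"] by simp
    moreover have "\<forall>k. c \<odot> s k \<in> T"
      using subspace_scale[OF T(1)] s(2) by simp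
    ultimately show "c \<odot> f \<in> ?C"
      using s(1) by auto
    assume "g \<in> ?C"
    then obtain t where t: "g \<in> H" "\<And>k. t k \<in> T" "(\<lambda>k. nrm (g - t k)) \<longlonglongrightarrow> 0" by auto
    have "nrm (f + g - (s k + t k)) \<le> nrm (f - s k) + nrm (g - t k)" for k
      using nrm_triangle[of "f - s k" "g - t k"] s t TH[OF s(2)[of k]] TH[OF t(2)[of k]]
      by (simp add: algebra_simps)
    then have "(\<lambda>k. nrm (f + g - (s k + t k))) \<longlonglongrightarrow> 0"
      using tendsto_add[OF s(3) t(3)] s(1) t(1) TH[OF s(2)] TH[OF t(2)]
      by (intro nrm_tendsto_squeeze[of "\<lambda>k. nrm (f - s k) + nrm (g - t k)"]) simp_all
    moreover have "\<forall>k. s k + t k \<in> T"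
      using subspace_add[OF T(1)] s(2) t(2) by simp
    ultimately show "f + g \<in> ?C"
      using s(1) t(1) by (auto intro!: exI[of _ "\<lambda>k. s k + t k"])
  qed
next
  fix x :: "nat \<Rightarrow> 'a"
  assume x: "\<And>n. x n \<in> ?C"
    and Cauchy: "\<And>e. e > 0 \<Longrightarrow> \<exists>N. \<forall>m\<ge>N. \<forall>n\<ge>N. nrm (x m - x n) < e"
  note TH = subsetD[OF T(2)]
  have xH: "x n \<in> H" for n using x by blast
  from complete[OF xH Cauchy] obtain l where l: "l \<in> H" "(\<lambda>n. nrm (x n - l)) \<longlonglongrightarrow> 0" by blast
  have "\<forall>n. \<exists>t. t \<in> T \<and> nrm (x n - t) < 1 / real (Suc n)"
  proof
    fix n
    obtain t where t: "\<And>k. t k \<in> T" "(\<lambda>k. nrm (x n - t k)) \<longlonglongrightarrow> 0"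
      using x[of n] by auto
    have "\<forall>\<^sub>F k in sequentially. nrm (x n - t k) < 1 / real (Suc n)"
      by (rule order_tendstoD(2)[OF t(2)]) simp
    then obtain k where "nrm (x n - t k) < 1 / real (Suc n)"
      by (auto simp: eventually_sequentially)
    then show "\<exists>t. t \<in> T \<and> nrm (x n - t) < 1 / real (Suc n)"
      using t(1) by blast
  qed
  then obtain t where "\<forall>n. t n \<in> T \<and> nrm (x n - t n) < 1 / real (Suc n)"
    by (rule choice[THEN exE])
  then have t: "\<And>n. t n \<in> T" "\<And>n. nrm (x n - t n) \<le> 1 / real (Suc n)"
    by (simp_all add: less_imp_le)
  have b: "(\<lambda>n. nrm (x n - l) + 1 / real (Suc n)) \<longlonglongrightarrow> 0"
    using tendsto_add[OF l(2) LIMSEQ_Suc[OF lim_1_over_n]] by simp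
  have "nrm (l - t n) \<le> nrm (x n - l) + 1 / real (Suc n)" for n
    using nrm_triangle_diff[of l "x n" "t n"] t(2)[of n] nrm_minus_commute[of l "x n"] l(1) xH TH[OF t(1)]
    by simp
  then have "(\<lambda>n. nrm (l - t n)) \<longlonglongrightarrow> 0"
    using l(1) TH[OF t(1)] by (intro nrm_tendsto_squeeze[OF b]) simp_all
  then have "l \<in> ?C"
    using l(1) t(1) by auto
  with l(2) show "\<exists>l\<in>?C. (\<lambda>n. nrm (x n - l)) \<longlonglongrightarrow> 0" by blast
qed (auto simp: ip_add_left ip_scale_left ip_self_nonneg intro: ip_commute ip_self_eq_0)

end

section \<open>Square integrable functions\<close>

lemma cnj_measurable [measurable]: "cnj \<in> borel_measurable borel"
  by (intro borel_measurable_continuous_onI continuous_intros)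

lemma square_integrable_times:
  fixes f g :: "'a \<Rightarrow> complex"
  assumes [measurable]: "f \<in> borel_measurable M" "g \<in> borel_measurable M"
    and "integrable M (\<lambda>x. (cmod (f x))\<^sup>2)" "integrable M (\<lambda>x. (cmod (g x))\<^sup>2)"
  shows "integrable M (\<lambda>x. f x * g x)"
proof (rule Bochner_Integration.integrable_bound)
  show "integrable M (\<lambda>x. (cmod (f x))\<^sup>2 + (cmod (g x))\<^sup>2)"
    using assms by simp
  have "cmod a * cmod b \<le> (cmod a)\<^sup>2 + (cmod b)\<^sup>2" for a b
    using sum_squares_bound[of "cmod a" "cmod b"] mult_nonneg_nonneg[OF norm_ge_zero norm_ge_zero, of a b]
    by linarith
  then show "AE x in M. norm (f x * g x) \<le> norm ((cmod (f x))\<^sup>2 + (cmod (g x))\<^sup>2)"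
    by (simp add: norm_mult)
qed simp

lemma square_integrable_add:
  fixes f g :: "'a \<Rightarrow> complex"
  assumes [measurable]: "f \<in> borel_measurable M" "g \<in> borel_measurable M"
    and "integrable M (\<lambda>x. (cmod (f x))\<^sup>2)" "integrable M (\<lambda>x. (cmod (g x))\<^sup>2)"
  shows "integrable M (\<lambda>x. (cmod (f x + g x))\<^sup>2)"
proof (rule Bochner_Integration.integrable_bound)
  show "integrable M (\<lambda>x. 2 * (cmod (f x))\<^sup>2 + 2 * (cmod (g x))\<^sup>2)"
    using assms by simp
  have "(cmod (a + b))\<^sup>2 \<le> 2 * (cmod a)\<^sup>2 + 2 * (cmod b)\<^sup>2" for a b
  proof -
    have "(cmod (a + b))\<^sup>2 \<le> (cmod a + cmod b)\<^sup>2"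
      by (intro power_mono norm_triangle_ineq norm_ge_zero)
    also have "\<dots> \<le> 2 * (cmod a)\<^sup>2 + 2 * (cmod b)\<^sup>2"
      using sum_squares_bound[of "cmod a" "cmod b"] by (simp add: power2_sum)
    finally show ?thesis .
  qed
  then show "AE x in M. norm ((cmod (f x + g x))\<^sup>2) \<le> norm (2 * (cmod (f x))\<^sup>2 + 2 * (cmod (g x))\<^sup>2)"
    by simp
qed simp

lemma square_integrable_diff:
  fixes f g :: "'a \<Rightarrow> complex"
  assumes [measurable]: "f \<in> borel_measurable M" "g \<in> borel_measurable M"
    and "integrable M (\<lambda>x. (cmod (f x))\<^sup>2)" "integrable M (\<lambda>x. (cmod (g x))\<^sup>2)"
  shows "integrable M (\<lambda>x. (cmod (f x - g x))\<^sup>2)"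
  using square_integrable_add[of f M "\<lambda>x. - g x"] assms by simp

text \<open>
  The weight \<open>2\<^sup>k\<close> makes the sum of \<open>2\<^sup>k \<bar>F\<^sub>k\<^sub>+\<^sub>1 - F\<^sub>k\<bar>\<^sup>2\<close> integrable, so it is finite almost everywhere,
  and there the increments are eventually below \<open>2\<^sup>-\<^sup>k\<^sup>/\<^sup>2\<close> and thus summable.
\<close>

lemma rapidly_Cauchy_AE_convergent:
  fixes F :: "nat \<Rightarrow> 'a \<Rightarrow> complex"
  assumes [measurable]: "\<And>k. F k \<in> borel_measurable M"
    and int: "\<And>k. integrable M (\<lambda>x. (cmod (F (Suc k) x - F k x))\<^sup>2)"
    and small: "\<And>k. (LINT x|M. (cmod (F (Suc k) x - F k x))\<^sup>2) \<le> (1/4) ^ k"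
  shows "AE x in M. convergent (\<lambda>k. F k x)"
proof -
  define d where "d k x = 2 ^ k * (cmod (F (Suc k) x - F k x))\<^sup>2" for k x
  have [measurable]: "d k \<in> borel_measurable M" for k
    unfolding d_def by measurable
  have "(\<integral>\<^sup>+x. (\<Sum>k. ennreal (d k x)) \<partial>M) = (\<Sum>k. \<integral>\<^sup>+x. ennreal (d k x) \<partial>M)"
    by (intro nn_integral_suminf) simp
  also have "\<dots> \<le> (\<Sum>k. ennreal ((1/2) ^ k))"
  proof (intro suminf_le allI)
    fix k
    have "(\<integral>\<^sup>+x. ennreal (d k x) \<partial>M) = ennreal (LINT x|M. d k x)"
      using int by (intro nn_integral_eq_integral) (auto simp: d_def)
    also have "(LINT x|M. d k x) \<le> 2 ^ k * (1/4) ^ k"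
      unfolding d_def using small by simp
    also have "2 ^ k * (1/4) ^ k = (1/2 :: real) ^ k"
      by (simp add: power_mult_distrib[symmetric])
    finally show "(\<integral>\<^sup>+x. ennreal (d k x) \<partial>M) \<le> ennreal ((1/2) ^ k)"
      by (simp add: ennreal_leI)
  qed auto
  also have "\<dots> = ennreal (\<Sum>k. (1/2) ^ k)"
    by (intro suminf_ennreal2) (auto intro: summable_geometric)
  finally have "(\<integral>\<^sup>+x. (\<Sum>k. ennreal (d k x)) \<partial>M) \<noteq> \<infinity>"
    by (auto simp: top_unique)
  then have "AE x in M. (\<Sum>k. ennreal (d k x)) \<noteq> \<infinity>"
    by (intro nn_integral_PInf_AE) auto
  then show ?thesis
  proof eventually_elim
    fix x assume "(\<Sum>k. ennreal (d k x)) \<noteq> \<infinity>"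
    then have "summable (\<lambda>k. d k x)"
      by (intro summable_suminf_not_top) (auto simp: d_def)
    then have "\<forall>\<^sub>F k in sequentially. d k x < 1"
      by (intro order_tendstoD(2)[OF summable_LIMSEQ_zero]) auto
    then have "\<forall>\<^sub>F k in sequentially. norm (F (Suc k) x - F k x) \<le> sqrt (1/2) ^ k"
    proof eventually_elim
      case (elim k)
      have "(cmod (F (Suc k) x - F k x))\<^sup>2 \<le> (1/2) ^ k"
        using elim by (simp add: d_def field_simps)
      then show ?case
        by (metis real_le_rsqrt real_sqrt_power)
    qed
    then have "summable (\<lambda>k. F (Suc k) x - F k x)"
      by (rule summable_comparison_test_ev) (auto intro: summable_geometric)
    then have "convergent (\<lambda>n. \<Sum>k<n. F (Suc k) x - F k x)"
      by (simp add: summable_iff_convergent)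
    then have "convergent (\<lambda>n. F n x - F 0 x)"
      unfolding sum_lessThan_telescope[of "\<lambda>n. F n x"] .
    then have "convergent (\<lambda>n. F n x - F 0 x + F 0 x)"
      by (intro convergent_add convergent_const)
    then show "convergent (\<lambda>n. F n x)" by simp
  qed
qed

text \<open>
  A rapidly Cauchy subsequence converges almost everywhere, and Fatou's lemma turns its limit into the
  limit in the mean. The subsequence is part of the conclusion because the pointwise limit inherits
  the set on which all \<open>F n\<close> vanish.
\<close>

lemma Riesz_Fischer:
  fixes F :: "nat \<Rightarrow> 'a \<Rightarrow> complex"
  assumes meas [measurable]: "\<And>n. F n \<in> borel_measurable M"
    and int: "\<And>n. integrable M (\<lambda>x. (cmod (F n x))\<^sup>2)"
    and Cauchy: "\<And>e. e > 0 \<Longrightarrow> \<exists>N. \<forall>m\<ge>N. \<forall>n\<ge>N. (LINT x|M. (cmod (F m x - F n x))\<^sup>2) < e"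
  shows "\<exists>f\<in>borel_measurable M. \<exists>r. integrable M (\<lambda>x. (cmod (f x))\<^sup>2) \<and>
    (AE x in M. (\<lambda>k. F (r k) x) \<longlonglongrightarrow> f x) \<and> (\<lambda>n. LINT x|M. (cmod (F n x - f x))\<^sup>2) \<longlonglongrightarrow> 0"
proof -
  note int_diff = square_integrable_diff[OF meas meas int int]
  let ?P = "\<lambda>k N. \<forall>m\<ge>N. \<forall>n\<ge>N. (LINT x|M. (cmod (F m x - F n x))\<^sup>2) < (1/4) ^ k"
  have "\<exists>r. \<forall>k. ?P k (r k) \<and> r k < r (Suc k)"
  proof (rule dependent_nat_choice)
    show "\<exists>N. ?P 0 N"
      using Cauchy[of 1] by simp
    show "\<exists>N'. ?P (Suc k) N' \<and> N < N'" for N k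
    proof -
      obtain N' where "?P (Suc k) N'"
        using Cauchy[of "(1/4) ^ Suc k"] by (auto simp del: power_Suc)
      then show ?thesis
        by (intro exI[of _ "max N' (Suc N)"]) auto
    qed
  qed
  then obtain r where r: "\<And>k. ?P k (r k)" "\<And>k. r k < r (Suc k)" by blast
  then have "strict_mono r"
    by (simp add: strict_mono_Suc_iff)
  define f where "f x = lim (\<lambda>k. F (r k) x)" for x
  have f [measurable]: "f \<in> borel_measurable M"
    unfolding f_def by (intro borel_measurable_lim_metric) simp
  have "AE x in M. convergent (\<lambda>k. F (r k) x)"
  proof (rule rapidly_Cauchy_AE_convergent)
    show "(LINT x|M. (cmod (F (r (Suc k)) x - F (r k) x))\<^sup>2) \<le> (1/4) ^ k" for k
      using r(1)[of k] r(2)[of k] by (intro less_imp_le) auto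
  qed (use int_diff in auto)
  then have lim: "AE x in M. (\<lambda>k. F (r k) x) \<longlonglongrightarrow> f x"
    by eventually_elim (simp add: f_def convergent_LIMSEQ_iff)
  \<comment> \<open>Fatou's lemma along the subsequence.\<close>
  have bound: "(\<integral>\<^sup>+x. ennreal ((cmod (F n x - f x))\<^sup>2) \<partial>M) \<le> ennreal e"
    if N: "\<forall>m\<ge>N. \<forall>n\<ge>N. (LINT x|M. (cmod (F m x - F n x))\<^sup>2) < e" "n \<ge> N" for n N e
  proof -
    have "(\<integral>\<^sup>+x. ennreal ((cmod (F n x - f x))\<^sup>2) \<partial>M)
        = (\<integral>\<^sup>+x. liminf (\<lambda>k. ennreal ((cmod (F n x - F (r k) x))\<^sup>2)) \<partial>M)"
    proof (intro nn_integral_cong_AE)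
      show "AE x in M. ennreal ((cmod (F n x - f x))\<^sup>2) = liminf (\<lambda>k. ennreal ((cmod (F n x - F (r k) x))\<^sup>2))"
        using lim
      proof eventually_elim
        case (elim x)
        then have "(\<lambda>k. ennreal ((cmod (F n x - F (r k) x))\<^sup>2)) \<longlonglongrightarrow> ennreal ((cmod (F n x - f x))\<^sup>2)"
          by (intro tendsto_intros)
        then show ?case
          by (rule lim_imp_Liminf[OF sequentially_bot, symmetric])
      qed
    qed
    also have "\<dots> \<le> liminf (\<lambda>k. \<integral>\<^sup>+x. ennreal ((cmod (F n x - F (r k) x))\<^sup>2) \<partial>M)"
      by (intro nn_integral_liminf) simp
    also have "\<dots> \<le> ennreal e"
    proof (rule Liminf_le)
      have "(\<integral>\<^sup>+x. ennreal ((cmod (F n x - F (r k) x))\<^sup>2) \<partial>M) \<le> ennreal e" if "k \<ge> N" for k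
      proof -
        have "r k \<ge> N"
          using that seq_suble[OF \<open>strict_mono r\<close>, of k] by simp
        then have "(LINT x|M. (cmod (F n x - F (r k) x))\<^sup>2) \<le> e"
          using N by (intro less_imp_le) auto
        then show ?thesis
          by (subst nn_integral_eq_integral[OF int_diff]) (auto intro: ennreal_leI)
      qed
      then show "\<forall>\<^sub>F k in sequentially. (\<integral>\<^sup>+x. ennreal ((cmod (F n x - F (r k) x))\<^sup>2) \<partial>M) \<le> ennreal e"
        by (auto simp: eventually_sequentially)
    qed simp
    finally show ?thesis .
  qed
  have int_f: "integrable M (\<lambda>x. (cmod (f x))\<^sup>2)"
  proof -
    obtain N where "\<forall>m\<ge>N. \<forall>n\<ge>N. (LINT x|M. (cmod (F m x - F n x))\<^sup>2) < 1"
      using Cauchy[of 1] by auto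
    then have "(\<integral>\<^sup>+x. ennreal ((cmod (F N x - f x))\<^sup>2) \<partial>M) \<le> ennreal 1"
      by (rule bound) simp
    also have "\<dots> < \<infinity>" by simp
    finally have "integrable M (\<lambda>x. (cmod (F N x - f x))\<^sup>2)"
      by (intro integrableI_bounded) auto
    then show ?thesis
      using square_integrable_diff[of "F N" M "\<lambda>x. F N x - f x"] int by simp
  qed
  have "(\<lambda>n. LINT x|M. (cmod (F n x - f x))\<^sup>2) \<longlonglongrightarrow> 0"
  proof (rule LIMSEQ_I)
    fix e :: real assume "e > 0"
    obtain N where N: "\<forall>m\<ge>N. \<forall>n\<ge>N. (LINT x|M. (cmod (F m x - F n x))\<^sup>2) < e / 2"
      using Cauchy[of "e / 2"] \<open>e > 0\<close> by auto
    have "norm ((LINT x|M. (cmod (F n x - f x))\<^sup>2) - 0) < e" if "n \<ge> N" for n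
    proof -
      have "integrable M (\<lambda>x. (cmod (F n x - f x))\<^sup>2)"
        by (intro square_integrable_diff int int_f) auto
      then have "ennreal (LINT x|M. (cmod (F n x - f x))\<^sup>2) \<le> ennreal (e / 2)"
        using bound[OF N that] by (simp add: nn_integral_eq_integral)
      then show ?thesis
        using \<open>e > 0\<close> by simp
    qed
    then show "\<exists>N. \<forall>n\<ge>N. norm ((LINT x|M. (cmod (F n x - f x))\<^sup>2) - 0) < e" by blast
  qed
  then show ?thesis
    using f int_f lim by blast
qed

lemma ae_equal_refl [simp]: "ae_equal f f \<longleftrightarrow> f \<in> borel_measurable lebesgue"
  by (simp add: ae_equal_def)

lemma mfun_cases:
  fixes f :: "'n::finite mfun"
  obtains F where "F \<in> borel_measurable lebesgue" "f = abs_mfun F"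
  using that[of "rep_mfun f"] Quotient3_abs_rep[OF Quotient3_mfun, of f]
    Quotient3_rep_reflp[OF Quotient3_mfun, of f] by auto

lemma abs_mfun_eq_iff:
  "\<lbrakk>F \<in> borel_measurable lebesgue; G \<in> borel_measurable lebesgue\<rbrakk>
    \<Longrightarrow> abs_mfun F = abs_mfun G \<longleftrightarrow> (AE x in lebesgue. F x = G x)"
  using Quotient3_rel_abs[OF Quotient3_mfun] Quotient3_rel[OF Quotient3_mfun, of F G]
  by (auto simp: ae_equal_def)

lemma cscale_abs_mfun:
  "F \<in> borel_measurable lebesgue \<Longrightarrow> cscale c (abs_mfun F) = abs_mfun (\<lambda>x. c * F x)"
  by (simp add: cscale.abs_eq)

lemma abs_mfun_in_L2_iff:
  "F \<in> borel_measurable lebesgue \<Longrightarrow> abs_mfun F \<in> L2 \<Omega> \<longleftrightarrow>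
     integrable lebesgue (\<lambda>x. (cmod (F x))\<^sup>2) \<and> (AE x in lebesgue. x \<notin> \<Omega> \<longrightarrow> F x = 0)"
  by (simp add: L2_def is_L2.abs_eq)

lemma binary_abs_mfun:
  assumes "F \<in> borel_measurable lebesgue" "G \<in> borel_measurable lebesgue"
  shows "abs_mfun F + abs_mfun G = abs_mfun (\<lambda>x. F x + G x)"
    "abs_mfun F - abs_mfun G = abs_mfun (\<lambda>x. F x - G x)"
    "l2_inner (abs_mfun F) (abs_mfun G) = (LINT x|lebesgue. F x * cnj (G x))"
    "weak_partial \<Omega> i (abs_mfun F) (abs_mfun G) \<longleftrightarrow> (\<forall>\<phi>. test_fun \<Omega> \<phi> \<longrightarrow>
       (LINT x|lebesgue. F x * partial i \<phi> x) = - (LINT x|lebesgue. G x * \<phi> x))"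
  using assms
  by (simp_all add: plus_mfun.abs_eq minus_mfun.abs_eq l2_inner.abs_eq weak_partial.abs_eq)

lemmas abs_mfun_simps = cscale_abs_mfun abs_mfun_in_L2_iff binary_abs_mfun

interpretation mfun: vector_space "cscale :: complex \<Rightarrow> 'n::finite mfun \<Rightarrow> 'n mfun"
proof
  fix c d :: complex and f g :: "'n mfun"
  obtain F G where "F \<in> borel_measurable lebesgue" "f = abs_mfun F"
    "G \<in> borel_measurable lebesgue" "g = abs_mfun G"
    using mfun_cases[of f] mfun_cases[of g] by metis
  then show "cscale c (f + g) = cscale c f + cscale c g" "cscale (c + d) f = cscale c f + cscale d f"
    "cscale c (cscale d f) = cscale (c * d) f" "cscale 1 f = f"
    by (simp_all add: abs_mfun_simps distrib_left distrib_right mult.assoc)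
qed

lemma L2_cases:
  assumes "f \<in> L2 \<Omega>"
  obtains F where "F \<in> borel_measurable lebesgue" "f = abs_mfun F"
    "integrable lebesgue (\<lambda>x. (cmod (F x))\<^sup>2)" "AE x in lebesgue. x \<notin> \<Omega> \<longrightarrow> F x = 0"
proof -
  obtain F where "F \<in> borel_measurable lebesgue" "f = abs_mfun F"
    by (rule mfun_cases)
  with assms show thesis
    by (intro that[of F]) (simp_all add: abs_mfun_in_L2_iff)
qed

interpretation L2: complex_inner_space cscale "L2 \<Omega>" l2_inner for \<Omega> :: "(real^'n::finite) set"
proof unfold_locales
  show "mfun.subspace (L2 \<Omega>)"
    unfolding mfun.subspace_def
  proof (intro conjI ballI allI)
    show "0 \<in> L2 \<Omega>"
      unfolding zero_mfun_def using abs_mfun_in_L2_iff[of "\<lambda>x. 0" \<Omega>] by simp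
    fix f g :: "'n mfun" and c
    assume "f \<in> L2 \<Omega>"
    then obtain F where F: "F \<in> borel_measurable lebesgue" "f = abs_mfun F"
      "integrable lebesgue (\<lambda>x. (cmod (F x))\<^sup>2)" "AE x in lebesgue. x \<notin> \<Omega> \<longrightarrow> F x = 0"
      by (rule L2_cases)
    show "cscale c f \<in> L2 \<Omega>"
      using F by (auto simp: abs_mfun_simps norm_mult power_mult_distrib elim: eventually_mono)
    assume "g \<in> L2 \<Omega>"
    then obtain G where G: "G \<in> borel_measurable lebesgue" "g = abs_mfun G"
      "integrable lebesgue (\<lambda>x. (cmod (G x))\<^sup>2)" "AE x in lebesgue. x \<notin> \<Omega> \<longrightarrow> G x = 0"
      by (rule L2_cases)
    have "AE x in lebesgue. x \<notin> \<Omega> \<longrightarrow> F x + G x = 0"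
      using F(4) G(4) by eventually_elim auto
    then show "f + g \<in> L2 \<Omega>"
      using F G by (simp add: abs_mfun_simps square_integrable_add)
  qed
next
  fix f g h :: "'n mfun"
  assume "f \<in> L2 \<Omega>" "g \<in> L2 \<Omega>" "h \<in> L2 \<Omega>"
  then show "l2_inner (f + g) h = l2_inner f h + l2_inner g h"
    by (elim L2_cases)
       (simp add: abs_mfun_simps distrib_right square_integrable_times)
next
  fix f g :: "'n mfun" and c
  assume "f \<in> L2 \<Omega>" "g \<in> L2 \<Omega>"
  then show "l2_inner (cscale c f) g = c * l2_inner f g"
    by (elim L2_cases) (simp add: abs_mfun_simps mult.assoc)
next
  fix f g :: "'n mfun"
  assume "f \<in> L2 \<Omega>" "g \<in> L2 \<Omega>"
  then obtain F G where "F \<in> borel_measurable lebesgue" "f = abs_mfun F"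
    "G \<in> borel_measurable lebesgue" "g = abs_mfun G"
    by (elim L2_cases)
  then show "l2_inner f g = cnj (l2_inner g f)"
    using Bochner_Integration.integral_cnj[of lebesgue "\<lambda>x. G x * cnj (F x)"] by (simp add: abs_mfun_simps mult.commute)
next
  fix f :: "'n mfun"
  assume "f \<in> L2 \<Omega>"
  then obtain F where F: "F \<in> borel_measurable lebesgue" "f = abs_mfun F"
      "integrable lebesgue (\<lambda>x. (cmod (F x))\<^sup>2)"
    by (rule L2_cases)
  have eq: "l2_inner f f = of_real (LINT x|lebesgue. (cmod (F x))\<^sup>2)"
    using F by (simp add: abs_mfun_simps complex_norm_square[symmetric] del: of_real_power)
  show "0 \<le> Re (l2_inner f f)"
    unfolding eq by (simp add: integral_nonneg)
  assume "l2_inner f f = 0"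
  then have "(LINT x|lebesgue. (cmod (F x))\<^sup>2) = 0"
    unfolding eq by simp
  then have "AE x in lebesgue. (cmod (F x))\<^sup>2 = 0"
    using integral_nonneg_eq_0_iff_AE[OF F(3)] by simp
  then show "f = 0"
    unfolding F(2) zero_mfun_def using F(1) by (subst abs_mfun_eq_iff) auto
qed

lemma L2_nrm_power2:
  assumes "F \<in> borel_measurable lebesgue" "integrable lebesgue (\<lambda>x. (cmod (F x))\<^sup>2)"
  shows "(L2.nrm (abs_mfun F))\<^sup>2 = (LINT x|lebesgue. (cmod (F x))\<^sup>2)"
proof -
  have "abs_mfun F \<in> L2 UNIV"
    using assms by (simp add: abs_mfun_simps)
  then show ?thesis
    using assms by (subst L2.nrm_power2)
     (auto simp: abs_mfun_simps complex_norm_square[symmetric] simp del: of_real_power)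
qed

interpretation L2: complex_hilbert_space cscale "L2 \<Omega>" l2_inner for \<Omega> :: "(real^'n::finite) set"
proof unfold_locales
  fix x :: "nat \<Rightarrow> 'n mfun"
  assume x: "\<And>n. x n \<in> L2 \<Omega>" and Cauchy: "\<And>e. e > 0 \<Longrightarrow> \<exists>N. \<forall>m\<ge>N. \<forall>n\<ge>N. L2.nrm (x m - x n) < e"
  have "\<forall>n. \<exists>F. F \<in> borel_measurable lebesgue \<and> x n = abs_mfun F \<and>
      integrable lebesgue (\<lambda>x. (cmod (F x))\<^sup>2) \<and> (AE x in lebesgue. x \<notin> \<Omega> \<longrightarrow> F x = 0)"
    by (rule allI, rule L2_cases[OF x]) blast
  then obtain F where "\<forall>n. F n \<in> borel_measurable lebesgue \<and> x n = abs_mfun (F n) \<and>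
      integrable lebesgue (\<lambda>x. (cmod (F n x))\<^sup>2) \<and> (AE x in lebesgue. x \<notin> \<Omega> \<longrightarrow> F n x = 0)"
    by (rule choice[THEN exE])
  then have F: "\<And>n. F n \<in> borel_measurable lebesgue" "\<And>n. x n = abs_mfun (F n)"
      "\<And>n. integrable lebesgue (\<lambda>x. (cmod (F n x))\<^sup>2)" "\<And>n. AE x in lebesgue. x \<notin> \<Omega> \<longrightarrow> F n x = 0"
    by simp_all
  have dist: "(L2.nrm (abs_mfun G - abs_mfun G'))\<^sup>2 = (LINT x|lebesgue. (cmod (G x - G' x))\<^sup>2)"
    if "G \<in> borel_measurable lebesgue" "G' \<in> borel_measurable lebesgue"
      "integrable lebesgue (\<lambda>x. (cmod (G x))\<^sup>2)" "integrable lebesgue (\<lambda>x. (cmod (G' x))\<^sup>2)" for G G'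
    using that by (simp add: abs_mfun_simps L2_nrm_power2 square_integrable_diff)
  have "\<exists>N. \<forall>m\<ge>N. \<forall>n\<ge>N. (LINT x|lebesgue. (cmod (F m x - F n x))\<^sup>2) < e" if "e > 0" for e
  proof -
    obtain N where N: "\<forall>m\<ge>N. \<forall>n\<ge>N. L2.nrm (x m - x n) < sqrt e"
      using Cauchy[of "sqrt e"] \<open>e > 0\<close> by auto
    have "(LINT x|lebesgue. (cmod (F m x - F n x))\<^sup>2) < e" if "m \<ge> N" "n \<ge> N" for m n
    proof -
      have "(L2.nrm (x m - x n))\<^sup>2 < (sqrt e)\<^sup>2"
        using N that L2.nrm_nonneg[of "x m - x n" \<Omega>] x by (intro power_strict_mono) auto
      then show ?thesis
        using F \<open>e > 0\<close> by (simp add: dist)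
    qed
    then show ?thesis by blast
  qed
  then have "\<exists>f\<in>borel_measurable lebesgue. \<exists>r. integrable lebesgue (\<lambda>x. (cmod (f x))\<^sup>2) \<and>
      (AE x in lebesgue. (\<lambda>k. F (r k) x) \<longlonglongrightarrow> f x) \<and>
      (\<lambda>n. LINT x|lebesgue. (cmod (F n x - f x))\<^sup>2) \<longlonglongrightarrow> 0"
    by (rule Riesz_Fischer[OF F(1,3)])
  then obtain f r where f: "f \<in> borel_measurable lebesgue"
    "integrable lebesgue (\<lambda>x. (cmod (f x))\<^sup>2)" "AE x in lebesgue. (\<lambda>k. F (r k) x) \<longlonglongrightarrow> f x"
    "(\<lambda>n. LINT x|lebesgue. (cmod (F n x - f x))\<^sup>2) \<longlonglongrightarrow> 0"
    by (elim bexE exE conjE)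
  have "AE x in lebesgue. \<forall>n. x \<notin> \<Omega> \<longrightarrow> F n x = 0"
    unfolding AE_all_countable using F(4) by blast
  with f(3) have "AE x in lebesgue. x \<notin> \<Omega> \<longrightarrow> f x = 0"
  proof eventually_elim
    case (elim x)
    then show ?case
      by (auto simp: LIMSEQ_const_iff)
  qed
  then have "abs_mfun f \<in> L2 \<Omega>"
    using f by (simp add: abs_mfun_simps)
  moreover have "L2.nrm (x n - abs_mfun f) = sqrt (LINT x|lebesgue. (cmod (F n x - f x))\<^sup>2)" for n
    using L2.nrm_nonneg[OF L2.carrier_closed(3)[OF x \<open>abs_mfun f \<in> L2 \<Omega>\<close>], of n] F f
    by (simp add: dist[symmetric])
  then have "(\<lambda>n. L2.nrm (x n - abs_mfun f)) \<longlonglongrightarrow> 0"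
    using tendsto_real_sqrt[OF f(4)] by simp
  ultimately show "\<exists>l\<in>L2 \<Omega>. (\<lambda>n. L2.nrm (x n - l)) \<longlonglongrightarrow> 0"
    by blast
qed

section \<open>Calculus of test functions\<close>

lemma partial_eq: "(f has_derivative D) (at x) \<Longrightarrow> partial i f x = D (axis i 1)"
  unfolding partial_def by (simp add: frechet_derivative_at[symmetric])

lemma C_k_SucD: "C_k (Suc k) f \<Longrightarrow> C_k k f"
proof (induction k arbitrary: f)
  case 0
  then show ?case
    by (auto simp: continuous_on_eq_continuous_at intro: differentiable_imp_continuous_within)
next
  case (Suc k)
  then show ?case
    unfolding C_k.simps(2) by blast
qed

lemma C_k_const: "C_k k (\<lambda>x. c)"
proof (induction k arbitrary: c)
  case (Suc k)
  have "partial i (\<lambda>x. c) = (\<lambda>x. 0)" for i :: 'a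
    by (rule ext, rule partial_eq[THEN trans]) (rule has_derivative_const, rule refl)
  with Suc show ?case by simp
qed simp

lemma C_k_add: "C_k k f \<Longrightarrow> C_k k g \<Longrightarrow> C_k k (\<lambda>x. f x + g x)"
proof (induction k arbitrary: f g)
  case (Suc k)
  have "partial i (\<lambda>x. f x + g x) = (\<lambda>x. partial i f x + partial i g x)" for i
  proof
    fix x
    have "f differentiable (at x)" "g differentiable (at x)"
      using Suc.prems by auto
    then show "partial i (\<lambda>x. f x + g x) x = partial i f x + partial i g x"
      using partial_eq[OF has_derivative_add, of f "frechet_derivative f (at x)" x g "frechet_derivative g (at x)" i]
      by (simp add: partial_def frechet_derivative_works)
  qed
  with Suc show ?case by simp
qed (auto intro: continuous_intros)

lemma partial_mult:
  assumes "f differentiable (at x)" "g differentiable (at x)"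
  shows "partial i (\<lambda>x. f x * g x) x = f x * partial i g x + partial i f x * g x"
proof -
  have "(f has_derivative frechet_derivative f (at x)) (at x)"
    "(g has_derivative frechet_derivative g (at x)) (at x)"
    using assms by (simp_all add: frechet_derivative_works)
  from partial_eq[OF has_derivative_mult[OF this]] show ?thesis
    by (simp add: partial_def)
qed

lemma C_k_mult: "C_k k f \<Longrightarrow> C_k k g \<Longrightarrow> C_k k (\<lambda>x. f x * g x)"
proof (induction k arbitrary: f g)
  case (Suc k)
  have "partial i (\<lambda>x. f x * g x) = (\<lambda>x. f x * partial i g x + partial i f x * g x)" for i
    using Suc.prems by (intro ext partial_mult) auto
  moreover have "C_k k (\<lambda>x. f x * partial i g x + partial i f x * g x)" for i
    using Suc.prems C_k_SucD[OF Suc.prems(1)] C_k_SucD[OF Suc.prems(2)]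
    by (intro C_k_add Suc.IH) auto
  ultimately show ?case
    using Suc.prems by simp
qed (auto intro: continuous_intros)

lemma C_k_prod: "(\<And>i. i \<in> I \<Longrightarrow> C_k k (f i)) \<Longrightarrow> C_k k (\<lambda>x. \<Prod>i\<in>I. f i x)"
  by (induction I rule: infinite_finite_induct) (auto intro: C_k_mult C_k_const)

lemma test_funI:
  assumes "\<And>k. C_k k \<phi>" "compact K" "K \<subseteq> \<Omega>" "\<And>x. x \<notin> K \<Longrightarrow> \<phi> x = 0"
  shows "test_fun \<Omega> \<phi>"
proof -
  have sub: "closure {x. \<phi> x \<noteq> 0} \<subseteq> K"
    using assms(2,4) by (intro closure_minimal compact_imp_closed) auto
  then have "compact (closure {x. \<phi> x \<noteq> 0})"
    using compact_Int_closed[OF assms(2) closed_closure, of "{x. \<phi> x \<noteq> 0}"] by (simp add: Int_absorb1)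
  then show ?thesis
    unfolding test_fun_def using assms(1) order_trans[OF sub assms(3)] by (intro conjI allI)
qed

lemma test_fun_zero: "test_fun \<Omega> (\<lambda>x. 0)"
  by (rule test_funI[of _ "{}"]) (auto intro: C_k_const)

lemma test_funE:
  assumes "test_fun \<Omega> \<phi>"
  obtains K where "compact K" "K \<subseteq> \<Omega>" "\<forall>x. x \<notin> K \<longrightarrow> \<phi> x = 0 \<and> (\<forall>i. partial i \<phi> x = 0)"
proof
  let ?K = "closure {x. \<phi> x \<noteq> 0}"
  show "compact ?K" "?K \<subseteq> \<Omega>"
    using assms by (auto simp: test_fun_def)
  have zero: "\<phi> x = 0" if "x \<notin> ?K" for x
    using that closure_subset[of "{x. \<phi> x \<noteq> 0}"] by auto
  have "partial i \<phi> x = 0" if "x \<notin> ?K" for i x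
  proof -
    have "open (- ?K)" "x \<in> - ?K" "\<And>y. y \<in> - ?K \<Longrightarrow> 0 = \<phi> y"
      using that zero by (simp_all only: open_Compl closed_closure Compl_iff not_False_eq_True)
    from has_derivative_transform_within_open[OF has_derivative_const this]
    have "(\<phi> has_derivative (\<lambda>h. 0)) (at x)" .
    then show ?thesis
      by (simp add: partial_eq)
  qed
  with zero show "\<forall>x. x \<notin> ?K \<longrightarrow> \<phi> x = 0 \<and> (\<forall>i. partial i \<phi> x = 0)"
    by (intro allI impI conjI)
qed

lemma test_fun_add: 
  assumes "test_fun \<Omega> \<phi>" "test_fun \<Omega> \<psi>"
  shows "test_fun \<Omega> (\<lambda>x. \<phi> x + \<psi> x)"
proof -
  obtain K where K: "compact K" "K \<subseteq> \<Omega>" "\<forall>x. x \<notin> K \<longrightarrow> \<phi> x = 0 \<and> (\<forall>i. partial i \<phi> x = 0)"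
    by (rule test_funE[OF assms(1)])
  obtain L where L: "compact L" "L \<subseteq> \<Omega>" "\<forall>x. x \<notin> L \<longrightarrow> \<psi> x = 0 \<and> (\<forall>i. partial i \<psi> x = 0)"
    by (rule test_funE[OF assms(2)])
  show ?thesis
    using assms by (intro test_funI[of _ "K \<union> L"] C_k_add compact_Un Un_least K L) (auto simp: test_fun_def K(3) L(3))
qed

lemma test_fun_mult:
  assumes "test_fun \<Omega> \<phi>" "\<And>k. C_k k \<psi>"
  shows "test_fun \<Omega> (\<lambda>x. \<psi> x * \<phi> x)"
proof -
  obtain K where K: "compact K" "K \<subseteq> \<Omega>" "\<forall>x. x \<notin> K \<longrightarrow> \<phi> x = 0 \<and> (\<forall>i. partial i \<phi> x = 0)"
    by (rule test_funE[OF assms(1)])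
  show ?thesis
    using assms by (intro test_funI[of _ K] C_k_mult K) (auto simp: test_fun_def K(3))
qed

lemma test_fun_continuous:
  assumes "test_fun \<Omega> \<phi>"
  shows "continuous_on UNIV \<phi>" "continuous_on UNIV (partial i \<phi>)" "\<phi> differentiable (at x)"
proof -
  have "C_k 0 \<phi>" "C_k (Suc 0) \<phi>"
    using assms by (simp_all only: test_fun_def)
  then show "continuous_on UNIV \<phi>" "continuous_on UNIV (partial i \<phi>)" "\<phi> differentiable (at x)"
    by simp_all
qed

section \<open>Integration by parts\<close>

lemma integrable_continuous_compact_support:
  fixes f :: "real^'n::finite \<Rightarrow> 'b::{banach, second_countable_topology}"
  assumes "continuous_on UNIV f" "compact K" "\<And>x. x \<notin> K \<Longrightarrow> f x = 0"
  shows "integrable lebesgue f"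
proof -
  have [measurable]: "f \<in> borel_measurable borel"
    using assms(1) by (rule borel_measurable_continuous_onI)
  have "(\<lambda>x. indicator K x *\<^sub>R f x) = f"
    using assms(3) by (auto simp: fun_eq_iff indicator_def)
  then have "integrable lborel f"
    using borel_integrable_compact[OF assms(2) continuous_on_subset[OF assms(1) subset_UNIV]] by simp
  then show ?thesis
    by (simp add: integrable_completion)
qed

lemma square_integrable_continuous_compact_support:
  fixes f :: "real^'n::finite \<Rightarrow> complex"
  assumes "continuous_on UNIV f" "compact K" "\<And>x. x \<notin> K \<Longrightarrow> f x = 0"
  shows "integrable lebesgue (\<lambda>x. (cmod (f x))\<^sup>2)"
  by (rule integrable_continuous_compact_support[of _ K]) (use assms in \<open>auto intro!: continuous_intros\<close>)

lemma integral_translate: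
  fixes f :: "real^'n::finite \<Rightarrow> 'b::{banach, second_countable_topology}"
  assumes "f \<in> borel_measurable borel"
  shows "(LINT x|lebesgue. f (c + x)) = (LINT x|lebesgue. f x)"
proof -
  have "(LINT x|lborel. f x) = (LINT x|distr lborel borel ((+) c). f x)"
    by (simp add: lborel_distr_plus)
  also have "\<dots> = (LINT x|lborel. f (c + x))"
    using assms by (intro integral_distr) auto
  finally show ?thesis
    using assms by (simp add: integral_completion)
qed

lemma norm_difference_quotient_le:
  fixes u :: "real^'n::finite \<Rightarrow> complex"
  assumes diff: "\<And>x. u differentiable (at x)" and M: "\<And>x. norm (partial i u x) \<le> M"
  shows "norm (u (h *\<^sub>R axis i 1 + x) - u x) \<le> M * \<bar>h\<bar>"
proof -
  let ?e = "axis i 1 :: real^'n"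
  have "norm (u (h *\<^sub>R ?e + x) - u (0 *\<^sub>R ?e + x)) \<le> M * norm (h - 0)"
  proof (rule differentiable_bound[of UNIV "\<lambda>t. u (t *\<^sub>R ?e + x)" "\<lambda>t s. s *\<^sub>R partial i u (t *\<^sub>R ?e + x)"])
    fix t :: real
    let ?D = "frechet_derivative u (at (t *\<^sub>R ?e + x))"
    have D: "(u has_derivative ?D) (at (t *\<^sub>R ?e + x))"
      using diff frechet_derivative_works by blast
    have "((\<lambda>t. u (t *\<^sub>R ?e + x)) has_derivative (\<lambda>s. ?D (s *\<^sub>R ?e))) (at t)"
      by (rule has_derivative_compose[of "\<lambda>t. t *\<^sub>R ?e + x" "\<lambda>s. s *\<^sub>R ?e", OF _ D])
         (auto intro!: derivative_eq_intros)
    moreover have "?D (s *\<^sub>R ?e) = s *\<^sub>R partial i u (t *\<^sub>R ?e + x)" for s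
      using linear_frechet_derivative[OF diff] by (simp add: partial_def linear_cmul)
    ultimately show "((\<lambda>t. u (t *\<^sub>R ?e + x)) has_derivative (\<lambda>s. s *\<^sub>R partial i u (t *\<^sub>R ?e + x)))
        (at t within UNIV)"
      by simp
    have "0 \<le> M" using M norm_ge_zero order_trans by blast
    then show "onorm (\<lambda>s. s *\<^sub>R partial i u (t *\<^sub>R ?e + x)) \<le> M"
      by (rule onorm_bound) (use mult_right_mono[OF M abs_ge_zero] in \<open>simp add: mult.commute\<close>)
  qed auto
  then show ?thesis by simp
qed

text \<open>
  By translation invariance the difference quotients of \<open>u\<close> in the direction of the \<open>i\<close>-th axis have
  integral zero. They converge to the derivative, and they are dominated by the maximum of the
  derivative on a ball that contains all translates of the support by vectors of length at most \<open>1\<close>.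
\<close>

lemma integral_partial_eq_0:
  fixes u :: "real^'n::finite \<Rightarrow> complex"
  assumes diff: "\<And>x. u differentiable (at x)" and cont: "continuous_on UNIV (partial i u)"
    and K: "compact K" "\<And>x. x \<notin> K \<Longrightarrow> u x = 0" "\<And>x. x \<notin> K \<Longrightarrow> partial i u x = 0"
  shows "(LINT x|lebesgue. partial i u x) = 0"
proof -
  let ?e = "axis i 1 :: real^'n"
  have u_cont: "continuous_on UNIV u"
    using diff by (auto simp: continuous_on_eq_continuous_at intro: differentiable_imp_continuous_within)
  have [measurable]: "u \<in> borel_measurable borel" "partial i u \<in> borel_measurable borel"
    using u_cont cont by (auto intro: borel_measurable_continuous_onI)
  have "compact (partial i u ` K)"
    using K(1) cont by (intro compact_continuous_image) (auto intro: continuous_on_subset)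
  then obtain M0 where M0: "\<And>x. x \<in> K \<Longrightarrow> norm (partial i u x) \<le> M0"
    using compact_imp_bounded bounded_iff by (metis imageI)
  define M where "M = max M0 0"
  have M: "norm (partial i u x) \<le> M" for x
    using M0[of x] K(3)[of x] by (cases "x \<in> K") (auto simp: M_def)
  obtain R where R: "\<And>x. x \<in> K \<Longrightarrow> norm x \<le> R"
    using compact_imp_bounded[OF K(1)] bounded_iff by blast
  define h where "h n = 1 / real (Suc n)" for n
  have h: "h n > 0" "h n \<le> 1" for n
    by (auto simp: h_def)
  have h_lim: "h \<longlonglongrightarrow> 0"
    unfolding h_def by (rule LIMSEQ_Suc[OF lim_1_over_n])
  define q where "q n x = (u (h n *\<^sub>R ?e + x) - u x) /\<^sub>R h n" for n x
  have u_int: "integrable lebesgue u"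
    by (rule integrable_continuous_compact_support[OF u_cont K(1,2)])
  have shift_cont: "continuous_on UNIV (\<lambda>x. u (c + x))" for c
    by (rule continuous_on_compose2[OF u_cont]) (auto intro!: continuous_intros)
  have shift_int: "integrable lebesgue (\<lambda>x. u (c + x))" for c
  proof (rule integrable_continuous_compact_support[OF shift_cont])
    show "compact ((\<lambda>x. x - c) ` K)"
      by (intro compact_continuous_image K continuous_intros)
    fix x assume "x \<notin> (\<lambda>x. x - c) ` K"
    then have "c + x \<notin> K"
      by (metis add_diff_cancel_left' imageI)
    then show "u (c + x) = 0" by (rule K)
  qed
  have "(LINT x|lebesgue. q n x) = 0" for n
    unfolding q_def using u_int shift_int by (simp add: integral_translate)
  moreover have "(\<lambda>n. LINT x|lebesgue. q n x) \<longlonglongrightarrow> (LINT x|lebesgue. partial i u x)"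
  proof (rule integral_dominated_convergence)
    show "integrable lebesgue (\<lambda>x. M * indicator (cball 0 (R + 1)) x :: real)"
      by (intro integrable_mult_right integrable_real_indicator) (use emeasure_lborel_cball_finite[of 0 "R + 1"] in auto)
    show "AE x in lebesgue. (\<lambda>n. q n x) \<longlonglongrightarrow> partial i u x"
    proof (rule AE_I2)
      fix x
      let ?D = "frechet_derivative u (at x)"
      have "(u has_derivative ?D) (at x)"
        using diff frechet_derivative_works by blast
      then have "(\<lambda>v. norm (u (x + v) - u x - ?D v) / norm v) \<midarrow>0\<rightarrow> 0"
        by (simp add: has_derivative_at)
      moreover have "(\<lambda>n. h n *\<^sub>R ?e) \<longlonglongrightarrow> 0"
        using tendsto_scaleR[OF h_lim tendsto_const[of ?e]] by simp
      then have "filterlim (\<lambda>n. h n *\<^sub>R ?e) (at 0) sequentially"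
        unfolding filterlim_at using h(1) by (auto simp: less_imp_neq[symmetric] axis_eq_0_iff intro!: always_eventually)
      ultimately have "(\<lambda>n. norm (u (x + h n *\<^sub>R ?e) - u x - ?D (h n *\<^sub>R ?e)) / norm (h n *\<^sub>R ?e)) \<longlonglongrightarrow> 0"
        by (rule filterlim_compose)
      moreover have "norm (u (x + h n *\<^sub>R ?e) - u x - ?D (h n *\<^sub>R ?e)) / norm (h n *\<^sub>R ?e) = norm (q n x - partial i u x)" for n
      proof -
        have "q n x - partial i u x = (u (x + h n *\<^sub>R ?e) - u x - ?D (h n *\<^sub>R ?e)) /\<^sub>R h n"
          using linear_frechet_derivative[OF diff] h(1)[of n]
          by (simp add: q_def partial_def linear_cmul scaleR_diff_right add.commute)
        then show ?thesis
          using h(1)[of n] by (simp add: norm_axis_1 divide_inverse mult.commute)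
      qed
      ultimately have "(\<lambda>n. norm (q n x - partial i u x)) \<longlonglongrightarrow> 0" by simp
      then show "(\<lambda>n. q n x) \<longlonglongrightarrow> partial i u x"
        by (simp add: tendsto_norm_zero_iff LIM_zero_iff)
    qed
    show "AE x in lebesgue. norm (q n x) \<le> M * indicator (cball 0 (R + 1)) x" for n
    proof (rule AE_I2)
      fix x :: "real^'n"
      show "norm (q n x) \<le> M * indicator (cball 0 (R + 1)) x"
      proof (cases "x \<in> cball 0 (R + 1)")
        case True
        have "norm (q n x) = norm (u (h n *\<^sub>R ?e + x) - u x) / h n"
          unfolding q_def norm_scaleR using h(1)[of n] by (simp add: divide_inverse mult.commute)
        also have "\<dots> \<le> M"
          using norm_difference_quotient_le[OF diff M, of "h n" x] h(1)[of n] by (simp add: divide_le_eq)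
        finally show ?thesis
          using True by simp
      next
        case False
        then have "norm x > R + 1" by simp
        moreover have "norm x \<le> norm (h n *\<^sub>R ?e + x) + norm (h n *\<^sub>R ?e)"
          using norm_triangle_ineq4[of "h n *\<^sub>R ?e + x" "h n *\<^sub>R ?e"] by simp
        ultimately have "norm x > R" "norm (h n *\<^sub>R ?e + x) > R"
          using h[of n] by (auto simp: norm_axis_1)
        then have "x \<notin> K" "h n *\<^sub>R ?e + x \<notin> K"
          using R by (meson not_le)+
        then show ?thesis
          using K(2) False by (simp add: q_def)
      qed
    qed
    have "(\<lambda>x. u (h n *\<^sub>R ?e + x)) \<in> borel_measurable borel" for n
      by (rule borel_measurable_continuous_onI[OF shift_cont])
    then show "q n \<in> borel_measurable lebesgue" for n
      unfolding q_def[abs_def] by (intro measurable_completion) measurable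
    show "partial i u \<in> borel_measurable lebesgue"
      by (intro measurable_completion) measurable
  qed
  ultimately show ?thesis
    by (simp add: LIMSEQ_const_iff)
qed

lemma integration_by_parts:
  assumes \<phi>: "test_fun \<Omega> \<phi>" and \<psi>: "test_fun \<Omega>' \<psi>"
  shows "(LINT x|lebesgue. \<phi> x * partial i \<psi> x) = - (LINT x|lebesgue. partial i \<phi> x * \<psi> x)"
proof -
  obtain K where K: "compact K" "K \<subseteq> \<Omega>" "\<forall>x. x \<notin> K \<longrightarrow> \<phi> x = 0 \<and> (\<forall>i. partial i \<phi> x = 0)"
    by (rule test_funE[OF \<phi>])
  note cont = test_fun_continuous[OF \<phi>] test_fun_continuous[OF \<psi>]
  have eq: "partial i (\<lambda>x. \<phi> x * \<psi> x) = (\<lambda>x. \<phi> x * partial i \<psi> x + partial i \<phi> x * \<psi> x)"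
    by (intro ext partial_mult cont)
  have "(LINT x|lebesgue. partial i (\<lambda>x. \<phi> x * \<psi> x) x) = 0"
  proof (rule integral_partial_eq_0[OF _ _ K(1)])
    show "continuous_on UNIV (partial i (\<lambda>x. \<phi> x * \<psi> x))"
      unfolding eq by (intro continuous_intros cont)
  qed (use cont K in \<open>auto simp: eq intro: differentiable_mult\<close>)
  moreover have "integrable lebesgue (\<lambda>x. \<phi> x * partial i \<psi> x)"
    by (rule integrable_continuous_compact_support[OF _ K(1)]) (use K in \<open>auto intro!: continuous_intros cont\<close>)
  moreover have "integrable lebesgue (\<lambda>x. partial i \<phi> x * \<psi> x)"
    by (rule integrable_continuous_compact_support[OF _ K(1)]) (use K in \<open>auto intro!: continuous_intros cont\<close>)
  ultimately show ?thesis
    unfolding eq by (simp add: eq_neg_iff_add_eq_0)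
qed

section \<open>Bump functions\<close>

text \<open>
  The functions \<open>p(1/t) e\<^sup>-\<^sup>1\<^sup>/\<^sup>t\<close>, extended by zero to \<open>t \<le> 0\<close>. Allowing a polynomial factor makes the
  family closed under differentiation, so smoothness follows from a single derivative.
\<close>

definition exp_tail :: "real poly \<Rightarrow> real \<Rightarrow> real" where
  "exp_tail p t = (if t > 0 then poly p (1 / t) * exp (- (1 / t)) else 0)"

lemma poly_times_exp_minus_tendsto_0: "((\<lambda>s. poly p s * exp (- s)) \<longlongrightarrow> (0::real)) at_top"
proof -
  have "((\<lambda>s. \<Sum>k\<le>degree p. coeff p k * (s ^ k / exp s)) \<longlongrightarrow> (\<Sum>k\<le>degree p. coeff p k * 0)) at_top"
    by (intro tendsto_sum tendsto_mult tendsto_const tendsto_power_div_exp_0)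
  moreover have "(\<Sum>k\<le>degree p. coeff p k * (s ^ k / exp s)) = poly p s * exp (- s)" for s
    by (simp add: poly_altdef exp_minus sum_distrib_right divide_inverse mult.assoc)
  ultimately show ?thesis by simp
qed

lemma exp_tail_tendsto_0: "(exp_tail p \<longlongrightarrow> 0) (at 0)"
proof (rule filterlim_split_at)
  show "(exp_tail p \<longlongrightarrow> 0) (at_left 0)"
    by (rule tendsto_eventually) (auto simp: exp_tail_def eventually_at_filter)
  have "((\<lambda>t. poly p (inverse t) * exp (- (inverse t))) \<longlongrightarrow> (0::real)) (at_right 0)"
    by (rule filterlim_compose[OF poly_times_exp_minus_tendsto_0 filterlim_inverse_at_top_right])
  then show "(exp_tail p \<longlongrightarrow> 0) (at_right 0)"
    by (rule Lim_transform_eventually) (auto simp: exp_tail_def eventually_at_filter inverse_eq_divide)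
qed

lemma exp_tail_has_derivative:
  "(exp_tail p has_real_derivative exp_tail (pCons 0 (pCons 0 (p - pderiv p))) t) (at t)"
proof -
  consider "t > 0" | "t < 0" | "t = 0" by linarith
  then show ?thesis
  proof cases
    case 1
    have "((\<lambda>t. poly p (1 / t) * exp (- (1 / t))) has_real_derivative
        exp_tail (pCons 0 (pCons 0 (p - pderiv p))) t) (at t)"
      using 1 by (auto intro!: derivative_eq_intros DERIV_chain'[OF _ poly_DERIV]
          simp: exp_tail_def field_simps power2_eq_square)
    then show ?thesis
      by (rule has_field_derivative_transform_within_open[of _ _ _ "{0<..}"]) (use 1 in \<open>auto simp: exp_tail_def\<close>)
  next
    case 2
    have "((\<lambda>t. 0) has_real_derivative exp_tail (pCons 0 (pCons 0 (p - pderiv p))) t) (at t)"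
      using 2 by (simp add: exp_tail_def)
    then show ?thesis
      by (rule has_field_derivative_transform_within_open[of _ _ _ "{..<0}"]) (use 2 in \<open>auto simp: exp_tail_def\<close>)
  next
    case 3
    have "(exp_tail p (0 + h) - exp_tail p 0) / h = exp_tail (pCons 0 p) h" for h
      by (simp add: exp_tail_def)
    then show ?thesis
      using exp_tail_tendsto_0[of "pCons 0 p"] 3 by (simp add: DERIV_def exp_tail_def[of _ 0])
  qed
qed

lemma C_k_exp_tail_coordinate:
  "C_k k (\<lambda>x::real^'n::finite. complex_of_real (exp_tail p (c * x $ j + d)))"
proof (induction k arbitrary: p)
  let ?f = "\<lambda>p (x::real^'n). complex_of_real (exp_tail p (c * x $ j + d))"
  let ?q = "\<lambda>p. pCons 0 (pCons 0 (p - pderiv p))"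
  have deriv: "(?f p has_derivative (\<lambda>h. of_real (exp_tail (?q p) (c * x $ j + d) * (c * h $ j)))) (at x)" for p x
  proof -
    have "((\<lambda>x::real^'n. c * x $ j + d) has_derivative (\<lambda>h. c * h $ j)) (at x)"
      by (auto intro!: derivative_eq_intros bounded_linear_imp_has_derivative bounded_linear_vec_nth)
    moreover have "(exp_tail p has_derivative (*) (exp_tail (?q p) (c * x $ j + d))) (at (c * x $ j + d))"
      using exp_tail_has_derivative[of p "c * x $ j + d"] by (simp add: has_field_derivative_def)
    ultimately have "((\<lambda>x. exp_tail p (c * x $ j + d)) has_derivative
        (\<lambda>h. exp_tail (?q p) (c * x $ j + d) * (c * h $ j))) (at x)"
      by (rule has_derivative_compose)
    then show ?thesis
      by (rule has_derivative_of_real)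
  qed
  {
    case 0
    show ?case
      unfolding C_k.simps continuous_on_eq_continuous_at[OF open_UNIV]
      using has_derivative_continuous[OF deriv] by blast
  next
    case (Suc k)
    have "partial i (?f p) = (\<lambda>x. of_real (c * axis i 1 $ j) * ?f (?q p) x)" for i
      by (rule ext) (simp add: partial_eq[OF deriv])
    then have "C_k k (partial i (?f p))" for i
      using C_k_mult[OF C_k_const Suc.IH[of "?q p"], of "of_real (c * axis i 1 $ j)"] by simp
    moreover have "?f p differentiable (at x)" for x
      using deriv[of p x] by (auto simp: differentiable_def)
    ultimately show ?case by simp
  }
qed

text \<open>
  Every factor is \<open>e\<^sup>-\<^sup>1\<^sup>/\<^sup>n\<^sup>s\<close> for the coordinate distance \<open>s\<close> to a face (with \<open>n + 1\<close> for \<open>n\<close>).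
  It lies between \<open>0\<close> and
  \<open>1\<close> and tends to \<open>1\<close> inside the box.
\<close>

definition box_bump :: "real^'n \<Rightarrow> real^'n \<Rightarrow> nat \<Rightarrow> real^'n::finite \<Rightarrow> complex" where
  "box_bump a b n x = (\<Prod>i\<in>UNIV. of_real (exp_tail 1 (real (Suc n) * (x $ i - a $ i))) *
     of_real (exp_tail 1 (real (Suc n) * (b $ i - x $ i))))"

lemma box_bump_eq_0: 
  fixes a b x :: "real^'n::finite"
  assumes "x \<notin> box a b"
  shows "box_bump a b n x = 0"
proof -
  obtain i where "x $ i \<le> a $ i \<or> b $ i \<le> x $ i"
    using assms by (auto simp: mem_box_cart not_less)
  then have "exp_tail 1 (real (Suc n) * (x $ i - a $ i)) = 0 \<or> exp_tail 1 (real (Suc n) * (b $ i - x $ i)) = 0"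
    by (auto simp: exp_tail_def zero_less_mult_iff)
  then show ?thesis
    unfolding box_bump_def by (intro prod_zero) auto
qed

lemma norm_box_bump_le_1: "norm (box_bump a b n x) \<le> 1"
proof -
  have le: "\<bar>exp_tail 1 t\<bar> \<le> 1" for t
    by (simp add: exp_tail_def)
  show ?thesis
    unfolding box_bump_def prod_norm[symmetric]
    by (intro prod_le_1) (auto simp: norm_mult intro!: mult_le_one le)
qed

lemma box_bump_tendsto_indicator:
  fixes a b x :: "real^'n::finite"
  shows "(\<lambda>n. box_bump a b n x) \<longlonglongrightarrow> indicator (box a b) x"
proof (cases "x \<in> box a b")
  case True
  have lim: "(\<lambda>n. of_real (exp_tail 1 (real (Suc n) * t))) \<longlonglongrightarrow> (1::complex)" if "t > 0" for t
  proof -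
    have "(\<lambda>n. exp (- (1 / real (Suc n) * (1 / t)))) \<longlonglongrightarrow> exp (- (0 * (1 / t)))"
      by (intro tendsto_intros LIMSEQ_Suc[OF lim_1_over_n])
    then have "(\<lambda>n. exp_tail 1 (real (Suc n) * t)) \<longlonglongrightarrow> 1"
      using that by (simp add: exp_tail_def zero_less_mult_iff)
    from tendsto_of_real[OF this, where 'a = complex] show ?thesis by simp
  qed
  have "(\<lambda>n. box_bump a b n x) \<longlonglongrightarrow> (\<Prod>i::'n\<in>UNIV. 1 * 1)"
    unfolding box_bump_def using True
    by (intro tendsto_prod tendsto_mult lim) (auto simp: mem_box_cart)
  then show ?thesis
    using True by simp
next
  case False
  then show ?thesis
    by (simp add: box_bump_eq_0)
qed

lemma test_fun_box_bump:
  assumes "cbox a b \<subseteq> \<Omega>"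
  shows "test_fun \<Omega> (box_bump a b n)"
proof (rule test_funI[of _ "cbox a b"])
  show "C_k k (box_bump a b n)" for k
  proof -
    have "C_k k (\<lambda>x. of_real (exp_tail 1 (real (Suc n) * (x $ i - a $ i))) *
        of_real (exp_tail 1 (real (Suc n) * (b $ i - x $ i))))" for i
      using C_k_mult[OF C_k_exp_tail_coordinate[of k 1 "real (Suc n)" i "- real (Suc n) * a $ i"]
          C_k_exp_tail_coordinate[of k 1 "- real (Suc n)" i "real (Suc n) * b $ i"]]
      by (simp add: algebra_simps)
    then show ?thesis
      unfolding box_bump_def[abs_def] by (rule C_k_prod)
  qed
  show "box_bump a b n x = 0" if "x \<notin> cbox a b" for x
    using that box_subset_cbox[of a b] by (intro box_bump_eq_0) blast
qed (use assms in auto)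

section \<open>The fundamental lemma of the calculus of variations\<close>

lemma square_integrable_times_indicator:
  assumes "F \<in> borel_measurable M" "integrable M (\<lambda>x. (cmod (F x))\<^sup>2)"
    and A: "A \<in> sets M" "emeasure M A < \<infinity>"
  shows "integrable M (\<lambda>x. F x * indicator A x)"
proof -
  have "(\<lambda>x. (cmod (indicator A x))\<^sup>2) = indicator A"
    by (auto simp: fun_eq_iff indicator_def)
  then have "integrable M (\<lambda>x. (cmod (indicator A x))\<^sup>2)"
    using A by (simp add: integrable_real_indicator)
  then show ?thesis
    by (intro square_integrable_times assms borel_measurable_indicator)
qed

text \<open>
  Dominated convergence along the bump functions of the box.
\<close>

lemma integral_box_eq_0:
  fixes F :: "real^'n::finite \<Rightarrow> complex"
  assumes F [measurable]: "F \<in> borel_measurable lebesgue" and int: "integrable lebesgue (\<lambda>x. (cmod (F x))\<^sup>2)"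
    and test: "\<And>\<phi>. test_fun \<Omega> \<phi> \<Longrightarrow> (LINT x|lebesgue. F x * \<phi> x) = 0"
    and box: "cbox a b \<subseteq> \<Omega>"
  shows "(LINT x|lebesgue. F x * indicator (box a b) x) = 0"
proof -
  have bump: "(\<lambda>x. box_bump a b n x) \<in> borel_measurable lebesgue" for n
    by (rule test_fun_measurable[OF test_fun_box_bump[OF box]])
  have "(\<lambda>n. LINT x|lebesgue. F x * box_bump a b n x) \<longlonglongrightarrow> (LINT x|lebesgue. F x * indicator (box a b) x)"
  proof (rule integral_dominated_convergence)
    have "integrable lebesgue (\<lambda>x. F x * indicator (cbox a b) x)"
      by (intro square_integrable_times_indicator F int) (use emeasure_lborel_cbox_finite[of a b] in auto)
    then show "integrable lebesgue (\<lambda>x. norm (F x * indicator (cbox a b) x))"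
      by (rule integrable_norm)
    show "AE x in lebesgue. (\<lambda>n. F x * box_bump a b n x) \<longlonglongrightarrow> F x * indicator (box a b) x"
      by (intro AE_I2 tendsto_mult tendsto_const box_bump_tendsto_indicator)
    show "AE x in lebesgue. norm (F x * box_bump a b n x) \<le> norm (F x * indicator (cbox a b) x)" for n
    proof (rule AE_I2)
      fix x
      have "norm (box_bump a b n x) \<le> norm (indicator (cbox a b) x :: complex)"
        using norm_box_bump_le_1[of a b n x] box_bump_eq_0[of x a b n] box_subset_cbox[of a b]
        by (cases "x \<in> box a b") (auto simp: indicator_def)
      then show "norm (F x * box_bump a b n x) \<le> norm (F x * indicator (cbox a b) x)"
        by (simp add: norm_mult mult_left_mono)
    qed
    show "(\<lambda>x. F x * box_bump a b n x) \<in> borel_measurable lebesgue" for n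
      using bump by measurable
    show "(\<lambda>x. F x * indicator (box a b) x) \<in> borel_measurable lebesgue"
      by (intro borel_measurable_times F borel_measurable_indicator) auto
  qed
  then show ?thesis
    using test[OF test_fun_box_bump[OF box]] by (simp add: LIMSEQ_const_iff)
qed

lemma sigma_finite_lebesgue: "sigma_finite_measure (lebesgue :: 'a::euclidean_space measure)"
proof
  obtain A :: "'a set set" where A: "countable A" "A \<subseteq> sets lborel" "\<Union>A = space lborel"
    "\<forall>a\<in>A. emeasure lborel a \<noteq> \<infinity>"
    using lborel.sigma_finite_countable by (elim exE conjE)
  have "A \<subseteq> sets lebesgue" "\<Union>A = space lebesgue"
    using A(2,3) by auto
  moreover have "\<forall>a\<in>A. emeasure lebesgue a \<noteq> \<infinity>"
    using A(2,4) by (auto simp: subset_iff)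
  ultimately show "\<exists>A::'a set set. countable A \<and> A \<subseteq> sets lebesgue \<and> \<Union>A = space lebesgue \<and>
      (\<forall>a\<in>A. emeasure lebesgue a \<noteq> \<infinity>)"
    using A(1) by (intro exI[of _ A] conjI)
qed

lemma box_Int_box:
  fixes a b c d :: "real^'n::finite"
  shows "box a b \<inter> box c d = box (\<chi> i. max (a $ i) (c $ i)) (\<chi> i. min (b $ i) (d $ i))"
  by (auto simp: set_eq_iff mem_box_cart)

text \<open>
  Boxes are stable under intersection and generate the Borel sets, so a Dynkin argument extends the
  vanishing of the integrals from boxes to all Borel sets; Lebesgue sets differ from these by null sets.
\<close>

lemma AE_zero_of_box_integrals_zero:
  fixes G :: "real^'n::finite \<Rightarrow> complex"
  assumes int: "integrable lebesgue G"
    and box: "\<And>c d. (LINT x|lebesgue. indicator (box c d) x * G x) = 0"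
    and total: "(LINT x|lebesgue. G x) = 0"
  shows "AE x in lebesgue. G x = 0"
proof (rule sigma_finite_measure.density_zero[OF sigma_finite_lebesgue int])
  have [measurable]: "G \<in> borel_measurable lebesgue"
    using int by auto
  have int_ind: "integrable lebesgue (\<lambda>x. indicator A x * G x)" if "A \<in> sets lebesgue" for A
  proof -
    have "(\<lambda>x. indicator A x *\<^sub>R G x) = (\<lambda>x. indicator A x * G x)"
      by (auto simp: fun_eq_iff indicator_def)
    then show ?thesis
      using integrable_mult_indicator[OF that int] by simp
  qed
  have borel: "(LINT x|lebesgue. indicator A x * G x) = 0" if "A \<in> sets borel" for A
  proof -
    let ?B = "range (\<lambda>(a, b). box a b :: (real^'n) set)"
    have sets_eq: "sigma_sets UNIV ?B = sets borel"
      by (subst borel_eq_box) (rule sets_measure_of[symmetric], simp)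
    have "box a b \<inter> box c d \<in> ?B" for a b c d :: "real^'n"
      unfolding box_Int_box by (rule range_eqI[where x = "(_, _)"]) simp
    then have Int: "Int_stable ?B"
      by (auto simp: Int_stable_def)
    have Pow: "?B \<subseteq> Pow UNIV" by simp
    have "A \<in> sigma_sets UNIV ?B"
      using that sets_eq by simp
    with Int Pow show ?thesis
    proof (induction rule: sigma_sets_induct_disjoint)
      case (basic A)
      then show ?case using box by auto
    next
      case empty
      then show ?case by simp
    next
      case (compl A)
      then have A: "A \<in> sets lebesgue"
        using sets_eq by auto
      have "(LINT x|lebesgue. indicator (UNIV - A) x * G x) = (LINT x|lebesgue. G x - indicator A x * G x)"
        by (intro Bochner_Integration.integral_cong) (auto simp: indicator_def)
      also have "\<dots> = 0"
        using int int_ind[OF A] compl total by simp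
      finally show ?case .
    next
      case (union A)
      then have A: "A i \<in> sets lebesgue" for i
        using sets_eq by auto
      have "(LINT x:(\<Union>i. A i)|lebesgue. G x) = (\<Sum>i. (LINT x:(A i)|lebesgue. G x))"
      proof (rule lebesgue_integral_countable_add)
        show "set_integrable lebesgue (\<Union>i. A i) G"
          unfolding set_integrable_def using A by (intro integrable_mult_indicator int) auto
      qed (use A union in \<open>auto simp: disjoint_family_on_def\<close>)
      moreover have "(LINT x:C|lebesgue. G x) = (LINT x|lebesgue. indicator C x * G x)" for C
        unfolding set_lebesgue_integral_def
        by (intro Bochner_Integration.integral_cong) (auto simp: indicator_def)
      ultimately show ?case
        using union by simp
    qed
  qed
  fix A :: "(real^'n) set"
  assume "A \<in> sets lebesgue"
  then obtain S N N' where A: "A = S \<union> N" "N \<subseteq> N'" "N' \<in> null_sets lborel" "S \<in> sets lborel"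
    by (rule sets_completionE)
  have "N' \<in> null_sets lebesgue"
    using A(3) by (rule null_sets_completionI)
  then have "AE x in lebesgue. x \<notin> N'"
    by (rule AE_not_in)
  then have "AE x in lebesgue. indicator A x *\<^sub>R G x = indicator S x * G x"
    by eventually_elim (use A in \<open>auto simp: indicator_def\<close>)
  then have "(LINT x:A|lebesgue. G x) = (LINT x|lebesgue. indicator S x * G x)"
    unfolding set_lebesgue_integral_def
  proof (rule integral_cong_AE[rotated 2])
    show "(\<lambda>x. indicator S x * G x) \<in> borel_measurable lebesgue"
      using A(4) by (intro borel_measurable_integrable int_ind) auto
  qed (use \<open>A \<in> sets lebesgue\<close> in simp)
  then show "(LINT x:A|lebesgue. G x) = 0"
    using borel A(4) by simp
qed

text \<open>
  An open set is a countable union of closed boxes, so it suffices to treat one of them. There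
  \<open>F\<close> is integrable, and its integral over the intersection with any other box vanishes, as the
  intersection is again a box inside \<open>\<Omega>\<close>.
\<close>

theorem fundamental_lemma_calculus_of_variations:
  fixes F :: "real^'n::finite \<Rightarrow> complex"
  assumes \<Omega>: "open \<Omega>"
    and F [measurable]: "F \<in> borel_measurable lebesgue" and int: "integrable lebesgue (\<lambda>x. (cmod (F x))\<^sup>2)"
    and test: "\<And>\<phi>. test_fun \<Omega> \<phi> \<Longrightarrow> (LINT x|lebesgue. F x * \<phi> x) = 0"
  shows "AE x in lebesgue. x \<in> \<Omega> \<longrightarrow> F x = 0"
proof -
  have cbox: "AE x in lebesgue. x \<in> cbox a b \<longrightarrow> F x = 0" if "cbox a b \<subseteq> \<Omega>" for a b
  proof -
    have null: "cbox a b - box a b \<in> null_sets lebesgue"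
      using negligible_frontier_interval negligible_iff_null_sets by blast
    let ?G = "\<lambda>x. F x * indicator (box a b) x"
    have G: "integrable lebesgue ?G"
      by (intro square_integrable_times_indicator F int) (use emeasure_lborel_box_finite[of a b] in auto)
    have "AE x in lebesgue. ?G x = 0"
    proof (rule AE_zero_of_box_integrals_zero[OF G])
      show "(LINT x|lebesgue. ?G x) = 0"
        by (rule integral_box_eq_0[OF F int test that])
      fix c d
      let ?l = "\<chi> i. max (a $ i) (c $ i)" and ?u = "\<chi> i. min (b $ i) (d $ i)"
      have sub: "cbox ?l ?u \<subseteq> \<Omega>"
        using that by (auto simp: mem_box_cart subset_iff)
      have "(LINT x|lebesgue. F x * indicator (box ?l ?u) x) = 0"
        by (rule integral_box_eq_0[OF F int test sub])
      then show "(LINT x|lebesgue. indicator (box c d) x * ?G x) = 0"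
        unfolding box_Int_box[symmetric] indicator_inter_arith by (simp add: mult_ac)
    qed
    then show ?thesis
      using AE_not_in[OF null] by eventually_elim (auto simp: indicator_def split: if_splits)
  qed
  show ?thesis
  proof (rule open_countable_Union_open_cbox[OF \<Omega>])
    fix D assume D: "countable D" "D \<subseteq> Pow \<Omega>" "\<And>X. X \<in> D \<Longrightarrow> \<exists>a b. X = cbox a b" "\<Union>D = \<Omega>"
    have "AE x in lebesgue. \<forall>X\<in>D. x \<in> X \<longrightarrow> F x = 0"
    proof (rule AE_ball_countable'[OF _ D(1)])
      fix X assume "X \<in> D"
      then obtain a b where "X = cbox a b" "cbox a b \<subseteq> \<Omega>"
        using D(2,3) by blast
      then show "AE x in lebesgue. x \<in> X \<longrightarrow> F x = 0"
        using cbox by simp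
    qed
    then show "AE x in lebesgue. x \<in> \<Omega> \<longrightarrow> F x = 0"
      by eventually_elim (use D(4) in auto)
  qed
qed

section \<open>Sobolev spaces as Hilbert spaces\<close>

lemma test_fun_in_L2:
  assumes "test_fun \<Omega> \<phi>"
  shows "abs_mfun (\<lambda>x. cnj (\<phi> x)) \<in> L2 \<Omega>" "abs_mfun (\<lambda>x. cnj (partial i \<phi> x)) \<in> L2 \<Omega>"
    "abs_mfun \<phi> \<in> L2 \<Omega>" "abs_mfun (partial i \<phi>) \<in> L2 \<Omega>"
proof -
  note [measurable] = test_fun_measurable[OF assms]
  obtain K where K: "compact K" "K \<subseteq> \<Omega>" "\<forall>x. x \<notin> K \<longrightarrow> \<phi> x = 0 \<and> (\<forall>i. partial i \<phi> x = 0)"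
    by (rule test_funE[OF assms])
  have out: "x \<notin> \<Omega> \<Longrightarrow> \<phi> x = 0" "x \<notin> \<Omega> \<Longrightarrow> partial i \<phi> x = 0" for x
    using K(2,3) by auto
  have "integrable lebesgue (\<lambda>x. (cmod (\<phi> x))\<^sup>2)" "integrable lebesgue (\<lambda>x. (cmod (partial i \<phi> x))\<^sup>2)"
    using K by (auto intro!: square_integrable_continuous_compact_support test_fun_continuous[OF assms])
  then show "abs_mfun (\<lambda>x. cnj (\<phi> x)) \<in> L2 \<Omega>" "abs_mfun (\<lambda>x. cnj (partial i \<phi> x)) \<in> L2 \<Omega>"
    "abs_mfun \<phi> \<in> L2 \<Omega>" "abs_mfun (partial i \<phi>) \<in> L2 \<Omega>"
    by (simp_all add: abs_mfun_in_L2_iff out)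
qed

text \<open>
  Written with inner products, the equations of a weak derivative are visibly linear and stable under
  \<open>L\<^sup>2\<close> limits. The conjugates compensate that of the inner product.
\<close>

lemma weak_partial_iff_l2_inner:
  assumes "f \<in> L2 \<Omega>" "g \<in> L2 \<Omega>"
  shows "weak_partial \<Omega> i f g \<longleftrightarrow> (\<forall>\<phi>. test_fun \<Omega> \<phi> \<longrightarrow>
    l2_inner f (abs_mfun (\<lambda>x. cnj (partial i \<phi> x))) = - l2_inner g (abs_mfun (\<lambda>x. cnj (\<phi> x))))"
proof -
  obtain F where F: "F \<in> borel_measurable lebesgue" "f = abs_mfun F"
    by (rule mfun_cases)
  obtain G where G: "G \<in> borel_measurable lebesgue" "g = abs_mfun G"
    by (rule mfun_cases)
  have "l2_inner f (abs_mfun (\<lambda>x. cnj (partial i \<phi> x))) = (LINT x|lebesgue. F x * partial i \<phi> x)"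
    "l2_inner g (abs_mfun (\<lambda>x. cnj (\<phi> x))) = (LINT x|lebesgue. G x * \<phi> x)" if "test_fun \<Omega> \<phi>" for \<phi>
  proof -
    note [measurable] = test_fun_measurable[OF that]
    show "l2_inner f (abs_mfun (\<lambda>x. cnj (partial i \<phi> x))) = (LINT x|lebesgue. F x * partial i \<phi> x)"
      "l2_inner g (abs_mfun (\<lambda>x. cnj (\<phi> x))) = (LINT x|lebesgue. G x * \<phi> x)"
      using F G by (simp_all add: abs_mfun_simps)
  qed
  then show ?thesis
    unfolding F(2) G(2) using F(1) G(1) by (simp add: abs_mfun_simps)
qed

lemma weak_partial_unique:
  assumes "open \<Omega>" "g \<in> L2 \<Omega>" "g' \<in> L2 \<Omega>" "weak_partial \<Omega> i f g" "weak_partial \<Omega> i f g'"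
  shows "g = g'"
proof -
  obtain F where F: "F \<in> borel_measurable lebesgue" "f = abs_mfun F"
    by (rule mfun_cases)
  obtain G where G: "G \<in> borel_measurable lebesgue" "g = abs_mfun G"
    "integrable lebesgue (\<lambda>x. (cmod (G x))\<^sup>2)" "AE x in lebesgue. x \<notin> \<Omega> \<longrightarrow> G x = 0"
    by (rule L2_cases[OF assms(2)])
  obtain G' where G': "G' \<in> borel_measurable lebesgue" "g' = abs_mfun G'"
    "integrable lebesgue (\<lambda>x. (cmod (G' x))\<^sup>2)" "AE x in lebesgue. x \<notin> \<Omega> \<longrightarrow> G' x = 0"
    by (rule L2_cases[OF assms(3)])
  have "AE x in lebesgue. x \<in> \<Omega> \<longrightarrow> G x - G' x = 0"
  proof (rule fundamental_lemma_calculus_of_variations[OF assms(1)])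
    fix \<phi> assume \<phi>: "test_fun \<Omega> \<phi>"
    have "integrable lebesgue (\<lambda>x. (cmod (\<phi> x))\<^sup>2)"
      using test_fun_in_L2(3)[OF \<phi>] test_fun_measurable(1)[OF \<phi>] by (simp add: abs_mfun_in_L2_iff)
    note times = square_integrable_times[OF _ test_fun_measurable(1)[OF \<phi>] _ this]
    have "(LINT x|lebesgue. (G x - G' x) * \<phi> x) = (LINT x|lebesgue. G x * \<phi> x) - (LINT x|lebesgue. G' x * \<phi> x)"
      by (simp add: left_diff_distrib times G(1,3) G'(1,3))
    moreover have "(LINT x|lebesgue. F x * partial i \<phi> x) = - (LINT x|lebesgue. G x * \<phi> x)"
      using assms(4) \<phi> by (simp add: F(2) G(2) binary_abs_mfun(4)[OF F(1) G(1)])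
    moreover have "(LINT x|lebesgue. F x * partial i \<phi> x) = - (LINT x|lebesgue. G' x * \<phi> x)"
      using assms(5) \<phi> by (simp add: F(2) G'(2) binary_abs_mfun(4)[OF F(1) G'(1)])
    ultimately show "(LINT x|lebesgue. (G x - G' x) * \<phi> x) = 0" by simp
  qed (use G G' in \<open>auto intro: square_integrable_diff\<close>)
  with G(4) G'(4) have "AE x in lebesgue. G x = G' x"
    by eventually_elim auto
  then show ?thesis
    using G G' by (simp add: abs_mfun_eq_iff)
qed

lemma wderiv_eqI:
  assumes "open \<Omega>" "g \<in> L2 \<Omega>" "weak_partial \<Omega> i f g"
  shows "wderiv \<Omega> i f = g"
  unfolding wderiv_def using assms weak_partial_unique[OF assms(1)] by (intro the_equality) auto

lemma wderiv_is_weak_partial: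
  assumes "open \<Omega>" "f \<in> H1 \<Omega>"
  shows "wderiv \<Omega> i f \<in> L2 \<Omega>" "weak_partial \<Omega> i f (wderiv \<Omega> i f)"
proof -
  obtain g where "g \<in> L2 \<Omega>" "weak_partial \<Omega> i f g"
    using assms(2) by (auto simp: H1_def)
  then show "wderiv \<Omega> i f \<in> L2 \<Omega>" "weak_partial \<Omega> i f (wderiv \<Omega> i f)"
    using wderiv_eqI[OF assms(1)] by auto
qed

lemma H1_subset_L2: "f \<in> H1 \<Omega> \<Longrightarrow> f \<in> L2 \<Omega>"
  by (simp add: H1_def)

lemma H1I:
  assumes "open \<Omega>" "f \<in> L2 \<Omega>" "\<And>i. g i \<in> L2 \<Omega>" "\<And>i. weak_partial \<Omega> i f (g i)"
  shows "f \<in> H1 \<Omega>" "wderiv \<Omega> i f = g i"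
  using assms wderiv_eqI[OF assms(1,3,4)] by (auto simp: H1_def)

lemma H1_add:
  assumes "open \<Omega>" "f \<in> H1 \<Omega>" "g \<in> H1 \<Omega>"
  shows "f + g \<in> H1 \<Omega>" "wderiv \<Omega> i (f + g) = wderiv \<Omega> i f + wderiv \<Omega> i g"
proof -
  note mem = H1_subset_L2[OF assms(2)] H1_subset_L2[OF assms(3)]
    wderiv_is_weak_partial(1)[OF assms(1,2)] wderiv_is_weak_partial(1)[OF assms(1,3)]
  have "weak_partial \<Omega> i (f + g) (wderiv \<Omega> i f + wderiv \<Omega> i g)" for i
    using wderiv_is_weak_partial(2)[OF assms(1,2), of i] wderiv_is_weak_partial(2)[OF assms(1,3), of i] mem
    by (simp add: weak_partial_iff_l2_inner[where \<Omega> = \<Omega>] L2.ip_add_left[where \<Omega> = \<Omega>] test_fun_in_L2)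
  from H1I[OF assms(1) _ _ this] mem
  show "f + g \<in> H1 \<Omega>" "wderiv \<Omega> i (f + g) = wderiv \<Omega> i f + wderiv \<Omega> i g" by auto
qed

lemma H1_scale:
  assumes "open \<Omega>" "f \<in> H1 \<Omega>"
  shows "cscale c f \<in> H1 \<Omega>" "wderiv \<Omega> i (cscale c f) = cscale c (wderiv \<Omega> i f)"
proof -
  note mem = H1_subset_L2[OF assms(2)] wderiv_is_weak_partial(1)[OF assms]
  have "weak_partial \<Omega> i (cscale c f) (cscale c (wderiv \<Omega> i f))" for i
    using wderiv_is_weak_partial(2)[OF assms, of i] mem
    by (simp add: weak_partial_iff_l2_inner[where \<Omega> = \<Omega>] L2.ip_scale_left[where \<Omega> = \<Omega>] test_fun_in_L2)
  from H1I[OF assms(1) _ _ this] mem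
  show "cscale c f \<in> H1 \<Omega>" "wderiv \<Omega> i (cscale c f) = cscale c (wderiv \<Omega> i f)" by auto
qed

lemma test_fun_in_H1:
  assumes "open \<Omega>" "test_fun \<Omega> \<phi>"
  shows "abs_mfun \<phi> \<in> H1 \<Omega>"
proof (rule H1I[OF assms(1)])
  show "weak_partial \<Omega> i (abs_mfun \<phi>) (abs_mfun (partial i \<phi>))" for i
    using test_fun_measurable[OF assms(2)] integration_by_parts[OF assms(2)] by (simp add: abs_mfun_simps)
qed (use test_fun_in_L2[OF assms(2)] in auto)

lemma complex_inner_space_H1:
  assumes "open \<Omega>"
  shows "complex_inner_space cscale (H1 \<Omega>) (h1_inner \<Omega>)"
proof unfold_locales
  note mem = H1_subset_L2[where \<Omega> = \<Omega>] wderiv_is_weak_partial(1)[OF assms]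
  show "mfun.subspace (H1 \<Omega>)"
    unfolding mfun.subspace_def
    using test_fun_in_H1[OF assms test_fun_zero] H1_add[OF assms] H1_scale[OF assms]
    by (auto simp: zero_mfun_def)
  fix f g h :: "'a mfun" and c
  assume f: "f \<in> H1 \<Omega>"
  have nonneg: "0 \<le> Re (l2_inner (wderiv \<Omega> i f) (wderiv \<Omega> i f))" for i
    using L2.ip_self_nonneg[OF mem(2)[OF f]] .
  have Re: "Re (h1_inner \<Omega> f f) = Re (l2_inner f f) + (\<Sum>i\<in>UNIV. Re (l2_inner (wderiv \<Omega> i f) (wderiv \<Omega> i f)))"
    by (simp add: h1_inner_def)
  have sum: "0 \<le> (\<Sum>i\<in>UNIV. Re (l2_inner (wderiv \<Omega> i f) (wderiv \<Omega> i f)))"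
    by (intro sum_nonneg nonneg)
  then show "0 \<le> Re (h1_inner \<Omega> f f)"
    using L2.ip_self_nonneg[OF mem(1)[OF f]] by (simp add: Re)
  show "f = 0" if "h1_inner \<Omega> f f = 0"
  proof -
    have "Re (l2_inner f f) = 0"
      using that Re sum L2.ip_self_nonneg[OF mem(1)[OF f]] by simp
    then have "l2_inner f f = 0"
      using L2.ip_self[OF mem(1)[OF f]] by simp
    then show ?thesis
      using L2.ip_self_eq_0[OF mem(1)[OF f]] by simp
  qed
  assume g: "g \<in> H1 \<Omega>"
  show "h1_inner \<Omega> (cscale c f) g = c * h1_inner \<Omega> f g"
    using f g mem by (simp add: h1_inner_def H1_scale[OF assms] L2.ip_scale_left[where \<Omega> = \<Omega>]
        distrib_left sum_distrib_left)
  have "l2_inner (wderiv \<Omega> i f) (wderiv \<Omega> i g) = cnj (l2_inner (wderiv \<Omega> i g) (wderiv \<Omega> i f))" for i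
    using L2.ip_commute[OF mem(2)[OF f] mem(2)[OF g]] .
  then show "h1_inner \<Omega> f g = cnj (h1_inner \<Omega> g f)"
    using L2.ip_commute[OF mem(1)[OF f] mem(1)[OF g]] by (simp add: h1_inner_def)
  assume h: "h \<in> H1 \<Omega>"
  show "h1_inner \<Omega> (f + g) h = h1_inner \<Omega> f h + h1_inner \<Omega> g h"
    using f g h mem by (simp add: h1_inner_def H1_add[OF assms] L2.ip_add_left[where \<Omega> = \<Omega>] sum.distrib)
qed

lemma h1_norm_power2:
  assumes "open \<Omega>" "f \<in> H1 \<Omega>"
  shows "(h1_norm \<Omega> f)\<^sup>2 = (L2.nrm f)\<^sup>2 + (\<Sum>i\<in>UNIV. (L2.nrm (wderiv \<Omega> i f))\<^sup>2)"
proof -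
  have "(h1_norm \<Omega> f)\<^sup>2 = Re (h1_inner \<Omega> f f)"
    using complex_inner_space.ip_self_nonneg[OF complex_inner_space_H1[OF assms(1)] assms(2)]
    by (simp add: h1_norm_def)
  then show ?thesis
    using L2.nrm_power2[OF H1_subset_L2[OF assms(2)]] L2.nrm_power2[OF wderiv_is_weak_partial(1)[OF assms]]
    by (simp add: h1_inner_def)
qed

lemma L2_nrm_le_h1_norm:
  assumes "open \<Omega>" "f \<in> H1 \<Omega>"
  shows "L2.nrm f \<le> h1_norm \<Omega> f" "L2.nrm (wderiv \<Omega> i f) \<le> h1_norm \<Omega> f"
proof -
  have nn: "0 \<le> h1_norm \<Omega> f"
    using complex_inner_space.ip_self_nonneg[OF complex_inner_space_H1[OF assms(1)] assms(2)]
    by (simp add: h1_norm_def)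
  have "(L2.nrm (wderiv \<Omega> i f))\<^sup>2 \<le> (\<Sum>i\<in>UNIV. (L2.nrm (wderiv \<Omega> i f))\<^sup>2)"
    by (rule member_le_sum) auto
  moreover have "0 \<le> (\<Sum>i\<in>UNIV. (L2.nrm (wderiv \<Omega> i f))\<^sup>2)"
    by (intro sum_nonneg) auto
  ultimately have "(L2.nrm f)\<^sup>2 \<le> (h1_norm \<Omega> f)\<^sup>2" "(L2.nrm (wderiv \<Omega> i f))\<^sup>2 \<le> (h1_norm \<Omega> f)\<^sup>2"
    unfolding h1_norm_power2[OF assms] by (simp_all add: add_increasing)
  then show "L2.nrm f \<le> h1_norm \<Omega> f" "L2.nrm (wderiv \<Omega> i f) \<le> h1_norm \<Omega> f"
    using nn by (auto intro: power2_le_imp_le)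
qed

text \<open>
  A Cauchy sequence in \<open>H\<^sup>1\<close> and its weak derivatives converge in \<open>L\<^sup>2\<close>, and the limits of the
  derivatives are the derivatives of the limit.
\<close>

theorem complex_hilbert_space_H1:
  assumes "open \<Omega>"
  shows "complex_hilbert_space cscale (H1 \<Omega>) (h1_inner \<Omega>)"
proof -
  interpret H1: complex_inner_space cscale "H1 \<Omega>" "h1_inner \<Omega>"
    by (rule complex_inner_space_H1[OF assms])
  have nrm: "H1.nrm f = h1_norm \<Omega> f" for f
    by (simp add: H1.nrm_def h1_norm_def)
  show ?thesis
  proof
    fix x :: "nat \<Rightarrow> 'a mfun"
    assume x: "\<And>n. x n \<in> H1 \<Omega>"
      and Cauchy: "\<And>e. e > 0 \<Longrightarrow> \<exists>N. \<forall>m\<ge>N. \<forall>n\<ge>N. H1.nrm (x m - x n) < e"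
    note mem = H1_subset_L2[OF x] wderiv_is_weak_partial(1)[OF assms x]
    have wderiv_diff: "wderiv \<Omega> i (f - g) = wderiv \<Omega> i f - wderiv \<Omega> i g" if "f \<in> H1 \<Omega>" "g \<in> H1 \<Omega>" for f g i
      using H1_add(2)[OF assms, of "f - g" g i] that by simp
    have step: "\<exists>l\<in>L2 \<Omega>. (\<lambda>n. L2.nrm (y n - l)) \<longlonglongrightarrow> 0"
      if y: "\<And>n. y n \<in> L2 \<Omega>" "\<And>m n. L2.nrm (y m - y n) \<le> H1.nrm (x m - x n)" for y
    proof (rule L2.complete[OF y(1)])
      fix e :: real assume "e > 0"
      obtain N where N: "\<forall>m\<ge>N. \<forall>n\<ge>N. H1.nrm (x m - x n) < e"
        using Cauchy[OF \<open>e > 0\<close>] by (rule exE)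
      show "\<exists>N. \<forall>m\<ge>N. \<forall>n\<ge>N. L2.nrm (y m - y n) < e"
        using N le_less_trans[OF y(2)] by (intro exI[of _ N]) simp
    qed
    note xx = H1.carrier_closed(3)[OF x x]
    have "\<exists>l\<in>L2 \<Omega>. (\<lambda>n. L2.nrm (x n - l)) \<longlonglongrightarrow> 0"
      by (rule step[OF mem(1) L2_nrm_le_h1_norm(1)[OF assms xx, folded nrm]])
    then obtain l where l: "l \<in> L2 \<Omega>" "(\<lambda>n. L2.nrm (x n - l)) \<longlonglongrightarrow> 0"
      by (rule bexE)
    have "\<exists>g\<in>L2 \<Omega>. (\<lambda>n. L2.nrm (wderiv \<Omega> i (x n) - g)) \<longlonglongrightarrow> 0" for i
      by (rule step[OF mem(2) L2_nrm_le_h1_norm(2)[OF assms xx, folded nrm, unfolded wderiv_diff[OF x x]]])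
    then have "\<forall>i. \<exists>g. g \<in> L2 \<Omega> \<and> (\<lambda>n. L2.nrm (wderiv \<Omega> i (x n) - g)) \<longlonglongrightarrow> 0"
      unfolding Bex_def by (rule allI)
    then obtain g where "\<forall>i. g i \<in> L2 \<Omega> \<and> (\<lambda>n. L2.nrm (wderiv \<Omega> i (x n) - g i)) \<longlonglongrightarrow> 0"
      by (rule choice[THEN exE])
    then have g: "\<And>i. g i \<in> L2 \<Omega>" "\<And>i. (\<lambda>n. L2.nrm (wderiv \<Omega> i (x n) - g i)) \<longlonglongrightarrow> 0"
      by auto
    have weak: "weak_partial \<Omega> i l (g i)" for i
      unfolding weak_partial_iff_l2_inner[OF l(1) g(1)]
    proof (intro allI impI)
      fix \<phi> assume \<phi>: "test_fun \<Omega> \<phi>"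
      note test = test_fun_in_L2(1)[OF \<phi>] test_fun_in_L2(2)[OF \<phi>, of i]
      have lim: "(\<lambda>n. l2_inner (y n) h) \<longlonglongrightarrow> l2_inner k h"
        if "\<And>n. y n \<in> L2 \<Omega>" "k \<in> L2 \<Omega>" "h \<in> L2 \<Omega>" "(\<lambda>n. L2.nrm (y n - k)) \<longlonglongrightarrow> 0" for y h k
        by (rule L2.bounded_form_tendsto[OF L2.bounded_form_ip, where \<Omega> = \<Omega>]) (use that in simp_all)
      have "l2_inner (x n) (abs_mfun (\<lambda>x. cnj (partial i \<phi> x))) = - l2_inner (wderiv \<Omega> i (x n)) (abs_mfun (\<lambda>x. cnj (\<phi> x)))" for n
        using wderiv_is_weak_partial(2)[OF assms x, of i n] \<phi> mem by (simp add: weak_partial_iff_l2_inner[where \<Omega> = \<Omega>])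
      then have "(\<lambda>n. l2_inner (x n) (abs_mfun (\<lambda>x. cnj (partial i \<phi> x)))) \<longlonglongrightarrow> - l2_inner (g i) (abs_mfun (\<lambda>x. cnj (\<phi> x)))"
        using tendsto_minus[OF lim[OF mem(2) g(1) test(1) g(2)]] by simp
      with lim[OF mem(1) l(1) test(2) l(2)]
      show "l2_inner l (abs_mfun (\<lambda>x. cnj (partial i \<phi> x))) = - l2_inner (g i) (abs_mfun (\<lambda>x. cnj (\<phi> x)))"
        by (rule LIMSEQ_unique)
    qed
    note lH = H1I[OF assms l(1) g(1) weak]
    have "h1_norm \<Omega> (x n - l) = sqrt ((L2.nrm (x n - l))\<^sup>2 + (\<Sum>i\<in>UNIV. (L2.nrm (wderiv \<Omega> i (x n) - g i))\<^sup>2))" for n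
      using h1_norm_power2[OF assms H1.carrier_closed(3)[OF x lH(1)], of n] wderiv_diff[OF x lH(1)] lH(2)
        H1.nrm_nonneg[OF H1.carrier_closed(3)[OF x lH(1)], of n]
      by (simp add: nrm real_sqrt_unique)
    moreover have "(\<lambda>n. sqrt ((L2.nrm (x n - l))\<^sup>2 + (\<Sum>i\<in>UNIV. (L2.nrm (wderiv \<Omega> i (x n) - g i))\<^sup>2)))
        \<longlonglongrightarrow> sqrt (0\<^sup>2 + (\<Sum>i::'a\<in>UNIV. 0\<^sup>2))"
      by (intro tendsto_intros l g)
    ultimately have "(\<lambda>n. H1.nrm (x n - l)) \<longlonglongrightarrow> 0"
      by (simp add: nrm)
    with lH(1) show "\<exists>l\<in>H1 \<Omega>. (\<lambda>n. H1.nrm (x n - l)) \<longlonglongrightarrow> 0" by blast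
  qed
qed

theorem complex_hilbert_space_H10:
  assumes "open \<Omega>"
  shows "complex_hilbert_space cscale (H10 \<Omega>) (h1_inner \<Omega>)"
proof -
  interpret H1: complex_hilbert_space cscale "H1 \<Omega>" "h1_inner \<Omega>"
    by (rule complex_hilbert_space_H1[OF assms])
  have nrm: "H1.nrm f = h1_norm \<Omega> f" for f
    by (simp add: H1.nrm_def h1_norm_def)
  let ?T = "abs_mfun ` {\<phi>. test_fun \<Omega> \<phi>}"
  have sub: "mfun.subspace ?T"
    unfolding mfun.subspace_def
  proof (intro conjI ballI allI)
    show "0 \<in> ?T"
      unfolding zero_mfun_def using test_fun_zero by blast
    fix f g c assume "f \<in> ?T"
    then obtain \<phi> where \<phi>: "test_fun \<Omega> \<phi>" "f = abs_mfun \<phi>" by blast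
    show "cscale c f \<in> ?T"
      using \<phi> test_fun_mult[OF \<phi>(1) C_k_const, of c] test_fun_measurable(1)[OF \<phi>(1)]
      by (auto simp: cscale_abs_mfun)
    assume "g \<in> ?T"
    then obtain \<psi> where \<psi>: "test_fun \<Omega> \<psi>" "g = abs_mfun \<psi>" by blast
    show "f + g \<in> ?T"
      using \<phi> \<psi> test_fun_add[OF \<phi>(1) \<psi>(1)] test_fun_measurable(1)[OF \<phi>(1)] test_fun_measurable(1)[OF \<psi>(1)]
      by (auto simp: binary_abs_mfun)
  qed
  have "H10 \<Omega> = {f \<in> H1 \<Omega>. \<exists>t. (\<forall>k::nat. t k \<in> ?T) \<and> (\<lambda>k. H1.nrm (f - t k)) \<longlonglongrightarrow> 0}"
  proof (intro equalityI subsetI)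
    fix f assume "f \<in> H10 \<Omega>"
    then obtain \<phi> where "f \<in> H1 \<Omega>" "\<forall>k::nat. test_fun \<Omega> (\<phi> k)" "(\<lambda>k. h1_norm \<Omega> (f - abs_mfun (\<phi> k))) \<longlonglongrightarrow> 0"
      unfolding H10_def by blast
    then show "f \<in> {f \<in> H1 \<Omega>. \<exists>t. (\<forall>k::nat. t k \<in> ?T) \<and> (\<lambda>k. H1.nrm (f - t k)) \<longlonglongrightarrow> 0}"
      by (intro CollectI conjI exI[of _ "\<lambda>k. abs_mfun (\<phi> k)"]) (auto simp: nrm)
  next
    fix f assume "f \<in> {f \<in> H1 \<Omega>. \<exists>t. (\<forall>k::nat. t k \<in> ?T) \<and> (\<lambda>k. H1.nrm (f - t k)) \<longlonglongrightarrow> 0}"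
    then obtain t where t: "f \<in> H1 \<Omega>" "\<forall>k::nat. t k \<in> ?T" "(\<lambda>k. H1.nrm (f - t k)) \<longlonglongrightarrow> 0" by blast
    have "\<forall>k. \<exists>\<phi>. test_fun \<Omega> \<phi> \<and> t k = abs_mfun \<phi>"
      using t(2) by blast
    then obtain \<phi> where \<phi>: "\<forall>k. test_fun \<Omega> (\<phi> k) \<and> t k = abs_mfun (\<phi> k)"
      by (rule choice[THEN exE])
    then show "f \<in> H10 \<Omega>"
      unfolding H10_def using t by (intro CollectI conjI exI[of _ \<phi>]) (auto simp: nrm)
  qed
  moreover have "?T \<subseteq> H1 \<Omega>"
    using test_fun_in_H1[OF assms] by blast
  ultimately show ?thesis
    using H1.closure_of_subspace[OF sub] by simp
qed

section \<open>The group and its Lie algebra\<close>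

context
  fixes \<Omega> :: "(real^'n::finite) set"
  assumes open_\<Omega>: "open \<Omega>"
begin

interpretation H10: complex_hilbert_space cscale "H10 \<Omega>" "h1_inner \<Omega>"
  by (rule complex_hilbert_space_H10[OF open_\<Omega>])

lemma h1_norm_eq_nrm: "h1_norm \<Omega> f = H10.nrm f"
  by (simp add: H10.nrm_def h1_norm_def)

text \<open>
  The operators of the statement are the bounded operators of the Hilbert space locale, made unique by
  extensionality.
\<close>

lemma bounded_ops_iff: "T \<in> bounded_ops \<Omega> \<longleftrightarrow> T \<in> extensional (H10 \<Omega>) \<and> H10.bounded_operator T"
  unfolding bounded_ops_def H10.bounded_operator_def h1_norm_eq_nrm PiE_iff by auto

lemma restrict_in_bounded_ops:
  assumes "H10.bounded_operator S" "\<And>f. f \<in> H10 \<Omega> \<Longrightarrow> T f = S f" "T \<in> extensional (H10 \<Omega>)"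
  shows "T \<in> bounded_ops \<Omega>"
  using assms H10.bounded_operator_cong[OF assms(1,2)] by (simp add: bounded_ops_iff)

lemma bounded_ops_eqI:
  assumes "S \<in> bounded_ops \<Omega>" "T \<in> bounded_ops \<Omega>" "\<And>f. f \<in> H10 \<Omega> \<Longrightarrow> S f = T f"
  shows "S = T"
  using assms by (intro extensionalityI[of S "H10 \<Omega>" T]) (auto simp: bounded_ops_iff)

lemma bounded_form_l2_inner: "H10.bounded_form l2_inner"
proof -
  have H1: "f \<in> H1 \<Omega>" and L2: "f \<in> L2 \<Omega>" if "f \<in> H10 \<Omega>" for f
    using that by (auto simp: H10_def H1_subset_L2)
  have "cmod (l2_inner f g) \<le> 1 * H10.nrm f * H10.nrm g" if "f \<in> H10 \<Omega>" "g \<in> H10 \<Omega>" for f g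
  proof -
    have "cmod (l2_inner f g) \<le> L2.nrm f * L2.nrm g"
      by (rule L2.Cauchy_Schwarz[OF L2 L2]) (use that in auto)
    also have "\<dots> \<le> H10.nrm f * H10.nrm g"
      using L2_nrm_le_h1_norm(1)[OF open_\<Omega> H1] that L2.nrm_nonneg[OF L2]
      unfolding h1_norm_eq_nrm by (intro mult_mono) auto
    finally show ?thesis by simp
  qed
  then show ?thesis
    unfolding H10.bounded_form_def
    by (intro conjI exI[of _ 1])
      (simp_all add: L2 L2.ip_add_left[where \<Omega> = \<Omega>] L2.ip_add_right[where \<Omega> = \<Omega>]
        L2.ip_scale_left[where \<Omega> = \<Omega>] L2.ip_scale_right[where \<Omega> = \<Omega>])
qed

lemma l2_inner_commute: "\<lbrakk>f \<in> H10 \<Omega>; g \<in> H10 \<Omega>\<rbrakk> \<Longrightarrow> l2_inner f g = cnj (l2_inner g f)"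
  by (rule L2.ip_commute[where \<Omega> = \<Omega>]) (auto simp: H10_def H1_subset_L2)

lemma h1_inner_right_eqI:
  assumes "f \<in> H10 \<Omega>" "g \<in> H10 \<Omega>" "\<And>h. h \<in> H10 \<Omega> \<Longrightarrow> h1_inner \<Omega> h f = h1_inner \<Omega> h g"
  shows "f = g"
  using assms H10.ip_commute[of _ f] H10.ip_commute[of _ g] complex_cnj_cancel_iff
  by (intro H10.ip_eqI) auto

lemma op_adjoint_spec:
  assumes T: "T \<in> bounded_ops \<Omega>"
  shows "op_adjoint \<Omega> T \<in> bounded_ops \<Omega>"
    "\<lbrakk>f \<in> H10 \<Omega>; g \<in> H10 \<Omega>\<rbrakk> \<Longrightarrow> h1_inner \<Omega> (T f) g = h1_inner \<Omega> f (op_adjoint \<Omega> T g)"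
proof -
  let ?P = "\<lambda>S. S \<in> bounded_ops \<Omega> \<and>
     (\<forall>f\<in>H10 \<Omega>. \<forall>g\<in>H10 \<Omega>. h1_inner \<Omega> (T f) g = h1_inner \<Omega> f (S g))"
  have "H10.bounded_operator T"
    using T by (simp add: bounded_ops_iff)
  from H10.adjoint_exists[OF H10.bounded_form_operator_left[OF H10.bounded_form_ip this]]
  obtain S where S: "H10.bounded_operator S" "\<forall>f\<in>H10 \<Omega>. \<forall>g\<in>H10 \<Omega>. h1_inner \<Omega> (T f) g = h1_inner \<Omega> f (S g)"
    by (elim exE conjE)
  have P: "?P (restrict S (H10 \<Omega>))"
    using S by (auto intro: restrict_in_bounded_ops)
  have "?P (THE S. ?P S)"
  proof (rule theI[of ?P, OF P])
    fix S' assume S': "?P S'"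
    show "S' = restrict S (H10 \<Omega>)"
    proof (rule bounded_ops_eqI)
      fix g assume g: "g \<in> H10 \<Omega>"
      have "S' g = S g"
        by (rule h1_inner_right_eqI) (use S S' g in \<open>auto simp: bounded_ops_iff\<close>)
      then show "S' g = restrict S (H10 \<Omega>) g"
        using g by simp
    qed (use P S' in auto)
  qed
  then show "op_adjoint \<Omega> T \<in> bounded_ops \<Omega>"
    "\<lbrakk>f \<in> H10 \<Omega>; g \<in> H10 \<Omega>\<rbrakk> \<Longrightarrow> h1_inner \<Omega> (T f) g = h1_inner \<Omega> f (op_adjoint \<Omega> T g)"
    unfolding op_adjoint_def by auto
qed

lemma op_A_spec:
  shows "op_A \<Omega> \<in> bounded_ops \<Omega>"
    "\<lbrakk>f \<in> H10 \<Omega>; g \<in> H10 \<Omega>\<rbrakk> \<Longrightarrow> h1_inner \<Omega> (op_A \<Omega> f) g = l2_inner f g"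
proof -
  let ?P = "\<lambda>S. S \<in> bounded_ops \<Omega> \<and>
     (\<forall>f\<in>H10 \<Omega>. \<forall>g\<in>H10 \<Omega>. h1_inner \<Omega> (S f) g = l2_inner f g)"
  from H10.adjoint_exists[OF bounded_form_l2_inner]
  obtain S where S: "H10.bounded_operator S" "\<forall>f\<in>H10 \<Omega>. \<forall>g\<in>H10 \<Omega>. l2_inner f g = h1_inner \<Omega> f (S g)"
    by (elim exE conjE)
  have S_eq: "h1_inner \<Omega> (S f) g = l2_inner f g" if "f \<in> H10 \<Omega>" "g \<in> H10 \<Omega>" for f g
    using S that H10.ip_commute[of "S f" g] l2_inner_commute[of f g] by simp
  have P: "?P (restrict S (H10 \<Omega>))"
    using S S_eq by (auto intro: restrict_in_bounded_ops)
  have "?P (THE S. ?P S)"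
  proof (rule theI[of ?P, OF P])
    fix S' assume S': "?P S'"
    show "S' = restrict S (H10 \<Omega>)"
    proof (rule bounded_ops_eqI)
      fix g assume g: "g \<in> H10 \<Omega>"
      have "S' g = S g"
        by (rule H10.ip_eqI) (use S(1) S_eq S' g in \<open>auto simp: bounded_ops_iff\<close>)
      then show "S' g = restrict S (H10 \<Omega>) g"
        using g by simp
    qed (use P S' in auto)
  qed
  then show "op_A \<Omega> \<in> bounded_ops \<Omega>"
    "\<lbrakk>f \<in> H10 \<Omega>; g \<in> H10 \<Omega>\<rbrakk> \<Longrightarrow> h1_inner \<Omega> (op_A \<Omega> f) g = l2_inner f g"
    unfolding op_A_def by auto
qed

text \<open>
  Membership in \<open>\<Gamma>\<close> is skewness for the \<open>L\<^sup>2\<close> form: \<open>[X\<^sup>*Af, g] = [Af, Xg] = \<langle>f, Xg\<rangle>\<close> and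
  \<open>[AXf, g] = \<langle>Xf, g\<rangle>\<close>.
\<close>

lemma Gamma_alg_iff:
  assumes X: "X \<in> bounded_ops \<Omega>"
  shows "X \<in> Gamma_alg \<Omega> \<longleftrightarrow> (\<forall>f\<in>H10 \<Omega>. \<forall>g\<in>H10 \<Omega>. l2_inner (X f) g + l2_inner f (X g) = 0)"
proof -
  let ?A = "op_A \<Omega>" and ?X' = "op_adjoint \<Omega> X"
  have closed: "X f \<in> H10 \<Omega>" "?A f \<in> H10 \<Omega>" "?X' f \<in> H10 \<Omega>" if "f \<in> H10 \<Omega>" for f
    using X op_A_spec(1) op_adjoint_spec(1)[OF X] that by (auto simp: bounded_ops_iff)
  have "X \<in> Gamma_alg \<Omega> \<longleftrightarrow> (\<forall>f\<in>H10 \<Omega>. ?X' (?A f) + ?A (X f) = 0)"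
    using X closed by (auto simp: Gamma_alg_def op_add_def op_mult_def op_zero_def compose_def
        fun_eq_iff restrict_def)
  also have "\<dots> \<longleftrightarrow> (\<forall>f\<in>H10 \<Omega>. \<forall>g\<in>H10 \<Omega>. h1_inner \<Omega> (?X' (?A f) + ?A (X f)) g = 0)"
  proof (intro ball_cong refl iffI ballI)
    fix f g assume "f \<in> H10 \<Omega>" "g \<in> H10 \<Omega>" "?X' (?A f) + ?A (X f) = 0"
    then show "h1_inner \<Omega> (?X' (?A f) + ?A (X f)) g = 0" by simp
  next
    fix f assume "f \<in> H10 \<Omega>" "\<forall>g\<in>H10 \<Omega>. h1_inner \<Omega> (?X' (?A f) + ?A (X f)) g = 0"
    then show "?X' (?A f) + ?A (X f) = 0"
      using closed by (intro H10.ip_eqI) auto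
  qed
  also have "\<dots> \<longleftrightarrow> (\<forall>f\<in>H10 \<Omega>. \<forall>g\<in>H10 \<Omega>. l2_inner (X f) g + l2_inner f (X g) = 0)"
  proof (intro ball_cong refl)
    fix f g assume mem: "f \<in> H10 \<Omega>" "g \<in> H10 \<Omega>"
    have "h1_inner \<Omega> (?X' (?A f)) g = h1_inner \<Omega> (?A f) (X g)"
      using H10.ip_commute[of "?X' (?A f)" g] H10.ip_commute[of "?A f" "X g"]
        op_adjoint_spec(2)[OF X, of g "?A f"] closed mem by simp
    also have "\<dots> = l2_inner f (X g)"
      using op_A_spec(2) closed mem by simp
    finally have "h1_inner \<Omega> (?X' (?A f) + ?A (X f)) g = l2_inner f (X g) + l2_inner (X f) g"
      using closed mem by (simp add: H10.ip_add_left op_A_spec(2))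
    then show "h1_inner \<Omega> (?X' (?A f) + ?A (X f)) g = 0 \<longleftrightarrow> l2_inner (X f) g + l2_inner f (X g) = 0"
      by (simp add: add.commute)
  qed
  finally show ?thesis .
qed

lemma op_norm_bounds:
  assumes D: "H10.bounded_operator D"
  shows "0 \<le> op_norm \<Omega> D" "f \<in> H10 \<Omega> \<Longrightarrow> H10.nrm (D f) \<le> op_norm \<Omega> D * H10.nrm f"
    "\<lbrakk>0 \<le> c; \<And>f. f \<in> H10 \<Omega> \<Longrightarrow> H10.nrm (D f) \<le> c * H10.nrm f\<rbrakk> \<Longrightarrow> op_norm \<Omega> D \<le> c"
proof -
  let ?U = "{f \<in> H10 \<Omega>. H10.nrm f \<le> 1}"
  have op_norm: "op_norm \<Omega> D = (SUP f\<in>?U. H10.nrm (D f))"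
    by (simp add: op_norm_def h1_norm_eq_nrm)
  have le: "H10.nrm (D f) \<le> c" if "0 \<le> c" "f \<in> ?U" "\<And>f. f \<in> H10 \<Omega> \<Longrightarrow> H10.nrm (D f) \<le> c * H10.nrm f" for f c
    using that(3)[of f] mult_left_le[of "H10.nrm f" c] that(1,2) by simp
  obtain K where K: "K \<ge> 0" "\<And>f. f \<in> H10 \<Omega> \<Longrightarrow> H10.nrm (D f) \<le> K * H10.nrm f"
    using H10.bounded_operator_bound[OF D] by blast
  have bdd: "bdd_above ((\<lambda>f. H10.nrm (D f)) ` ?U)"
    using le[OF K(1) _ K(2)] by (auto simp: bdd_above_def)
  have upper: "H10.nrm (D f) \<le> op_norm \<Omega> D" if "f \<in> ?U" for f
    unfolding op_norm by (rule cSUP_upper[OF that bdd])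
  show nonneg: "0 \<le> op_norm \<Omega> D"
    using upper[of 0] H10.nrm_nonneg[of "D 0"] D by (simp del: H10.nrm_nonneg)
  show "op_norm \<Omega> D \<le> c" if "0 \<le> c" "\<And>f. f \<in> H10 \<Omega> \<Longrightarrow> H10.nrm (D f) \<le> c * H10.nrm f"
    unfolding op_norm by (rule cSUP_least) (use le[OF that(1) _ that(2)] in \<open>auto intro!: exI[of _ 0]\<close>)
  show "H10.nrm (D f) \<le> op_norm \<Omega> D * H10.nrm f" if f: "f \<in> H10 \<Omega>"
  proof (cases "H10.nrm f = 0")
    case True
    then show ?thesis using K(2)[OF f] by simp
  next
    case False
    then have pos: "H10.nrm f > 0" using H10.nrm_nonneg[OF f] by simp
    let ?c = "complex_of_real (1 / H10.nrm f)"
    have "cscale ?c f \<in> ?U"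
      using pos f by (simp add: H10.nrm_scale norm_divide)
    from upper[OF this] have "1 / H10.nrm f * H10.nrm (D f) \<le> op_norm \<Omega> D"
      using pos f D by (simp add: H10.bounded_operator_scale[OF D] H10.nrm_scale norm_divide)
    then show ?thesis
      using pos by (simp add: pos_divide_le_eq)
  qed
qed

text \<open>
  The remainder estimate is uniform on the unit ball, so the pointwise exponential is the limit in
  operator norm; any other such limit agrees with it pointwise.
\<close>

lemma op_exp_eq:
  assumes T: "T \<in> bounded_ops \<Omega>"
  shows "op_exp \<Omega> T = restrict (H10.exp_op T) (H10 \<Omega>)"
proof -
  have T': "H10.bounded_operator T"
    using T by (simp add: bounded_ops_iff)
  obtain K where K: "K \<ge> 0" "\<And>f. f \<in> H10 \<Omega> \<Longrightarrow> H10.nrm (T f) \<le> K * H10.nrm f"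
    using H10.bounded_operator_bound[OF T'] by blast
  let ?E = "restrict (H10.exp_op T) (H10 \<Omega>)"
  let ?D = "\<lambda>S N. op_diff \<Omega> (op_exp_partial \<Omega> T N) S"
  have diff: "?D S N f = H10.exp_partial T N f - S f" if "f \<in> H10 \<Omega>" for S N f
    using that by (simp add: op_diff_def op_exp_partial_def H10.exp_partial_def)
  have bounded: "H10.bounded_operator (?D S N)" if "S \<in> bounded_ops \<Omega>" for S N
  proof (rule H10.bounded_operator_cong)
    show "H10.bounded_operator (\<lambda>f. H10.exp_partial T N f - S f)"
      using that by (intro H10.bounded_operator_minus H10.bounded_operator_exp_partial T')
        (simp add: bounded_ops_iff)
  qed (rule diff)
  have E: "?E \<in> bounded_ops \<Omega>"
    by (rule restrict_in_bounded_ops[OF H10.bounded_operator_exp_op[OF T']]) auto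
  show ?thesis
    unfolding op_exp_def
  proof (rule the_equality, intro conjI E)
    let ?r = "\<lambda>N. exp K - (\<Sum>k<N. K ^ k / fact k)"
    have "?r \<longlonglongrightarrow> exp K - exp K"
      by (intro tendsto_intros exp_sums_real)
    then have r: "?r \<longlonglongrightarrow> 0" by simp
    show "(\<lambda>N. op_norm \<Omega> (?D ?E N)) \<longlonglongrightarrow> 0"
    proof (rule tendsto_sandwich[OF _ _ tendsto_const r])
      show "\<forall>\<^sub>F N in sequentially. 0 \<le> op_norm \<Omega> (?D ?E N)"
        using op_norm_bounds(1)[OF bounded[OF E]] by simp
      have "op_norm \<Omega> (?D ?E N) \<le> ?r N" for N
      proof (rule op_norm_bounds(3)[OF bounded[OF E]])
        show "0 \<le> ?r N"
          using exp_partial_sum_le[OF K(1)] by simp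
        fix f assume f: "f \<in> H10 \<Omega>"
        then show "H10.nrm (?D ?E N f) \<le> ?r N * H10.nrm f"
          using H10.exp_op_remainder[OF T' K f, of N] by (simp add: diff)
      qed
      then show "\<forall>\<^sub>F N in sequentially. op_norm \<Omega> (?D ?E N) \<le> ?r N"
        by simp
    qed
  next
    fix S assume "S \<in> bounded_ops \<Omega> \<and> (\<lambda>N. op_norm \<Omega> (?D S N)) \<longlonglongrightarrow> 0"
    then have S: "S \<in> bounded_ops \<Omega>" "(\<lambda>N. op_norm \<Omega> (?D S N)) \<longlonglongrightarrow> 0" by auto
    show "S = ?E"
    proof (rule bounded_ops_eqI[OF S(1) E])
      fix f assume f: "f \<in> H10 \<Omega>"
      have Sf: "S f \<in> H10 \<Omega>"
        using S(1) f by (simp add: bounded_ops_iff)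
      have lim: "(\<lambda>N. op_norm \<Omega> (?D S N) * H10.nrm f) \<longlonglongrightarrow> 0"
        using tendsto_mult_right[OF S(2), of "H10.nrm f"] by simp
      have "H10.nrm (H10.exp_partial T N f - S f) \<le> op_norm \<Omega> (?D S N) * H10.nrm f" for N
        using op_norm_bounds(2)[OF bounded[OF S(1)] f, of N] by (simp add: diff[OF f])
      then have "(\<lambda>N. H10.nrm (H10.exp_partial T N f - S f)) \<longlonglongrightarrow> 0"
        using T' f Sf by (intro H10.nrm_tendsto_squeeze[OF lim]) simp_all
      then show "S f = ?E f"
        using H10.exp_op_eqI[OF T' f Sf] f by simp
    qed
  qed
qed

lemma op_exp_op_scale:
  assumes Y: "Y \<in> bounded_ops \<Omega>"
  shows "op_scale \<Omega> c Y \<in> bounded_ops \<Omega>"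
    "op_exp \<Omega> (op_scale \<Omega> c Y) = restrict (H10.exp_op (\<lambda>f. cscale c (Y f))) (H10 \<Omega>)"
proof -
  have Y': "H10.bounded_operator Y"
    using Y by (simp add: bounded_ops_iff)
  note cY = H10.bounded_operator_scaled[OF Y', of c]
  have eq: "op_scale \<Omega> c Y f = cscale c (Y f)" if "f \<in> H10 \<Omega>" for f
    using that by (simp add: op_scale_def)
  show mem: "op_scale \<Omega> c Y \<in> bounded_ops \<Omega>"
    by (rule restrict_in_bounded_ops[OF cY eq]) (simp_all add: op_scale_def del: restrict_apply)
  show "op_exp \<Omega> (op_scale \<Omega> c Y) = restrict (H10.exp_op (\<lambda>f. cscale c (Y f))) (H10 \<Omega>)"
    unfolding op_exp_eq[OF mem] by (rule restrict_ext) (rule H10.exp_op_cong[OF cY eq])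
qed

lemma op_exp_in_Gl:
  assumes Y: "Y \<in> bounded_ops \<Omega>"
  shows "op_exp \<Omega> (op_scale \<Omega> (complex_of_real t) Y) \<in> Gl \<Omega>"
proof -
  have Y': "H10.bounded_operator Y"
    using Y by (simp add: bounded_ops_iff)
  let ?T = "\<lambda>t::real. \<lambda>f. cscale (complex_of_real t) (Y f)"
  let ?E = "\<lambda>t::real. op_exp \<Omega> (op_scale \<Omega> (complex_of_real t) Y)"
  have T: "H10.bounded_operator (?T t)" for t
    by (rule H10.bounded_operator_scaled[OF Y'])
  have E: "?E t = restrict (H10.exp_op (?T t)) (H10 \<Omega>)" for t
    by (rule op_exp_op_scale(2)[OF Y])
  have mem: "?E t \<in> bounded_ops \<Omega>" for t
    unfolding E by (rule restrict_in_bounded_ops[OF H10.bounded_operator_exp_op[OF T]]) auto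
  have inverse: "H10.exp_op (?T (- t)) (H10.exp_op (?T t) f) = f" if "f \<in> H10 \<Omega>" for t f
    by (rule H10.exp_op_inverse[OF T T _ that]) simp
  have "?E (- t) (?E t f) = f" if "f \<in> H10 \<Omega>" for t f
    by (simp only: E restrict_apply that if_True H10.exp_op_limit(1)[OF T that] inverse)
  then have "op_mult \<Omega> (?E (- t)) (?E t) = op_one \<Omega>" for t
    unfolding op_mult_def op_one_def compose_def by (intro restrict_ext)
  from this[of t] this[of "- t"] have inv: "op_mult \<Omega> (?E (- t)) (?E t) = op_one \<Omega>"
    "op_mult \<Omega> (?E t) (?E (- t)) = op_one \<Omega>"
    by (simp_all only: minus_minus)
  show ?thesis
    unfolding Gl_def by (intro CollectI conjI bexI[of _ "?E (- t)"] mem inv)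
qed

lemma lie_algebra_eq_Gamma_alg: "lie_algebra_GG \<Omega> = Gamma_alg \<Omega>"
proof -
  have "(\<forall>t::real. op_exp \<Omega> (op_scale \<Omega> (complex_of_real t) Y) \<in> GG \<Omega>) \<longleftrightarrow> Y \<in> Gamma_alg \<Omega>"
    if Y: "Y \<in> bounded_ops \<Omega>" for Y
  proof -
    have "H10.bounded_operator Y"
      using Y by (simp add: bounded_ops_iff)
    from H10.exp_op_preserves_form_iff[OF bounded_form_l2_inner this]
    show ?thesis
      using op_exp_in_Gl[OF Y, unfolded op_exp_op_scale(2)[OF Y]]
      by (simp add: Gamma_alg_iff[OF Y] GG_def op_exp_op_scale(2)[OF Y])
  qed
  moreover have "Gamma_alg \<Omega> \<subseteq> bounded_ops \<Omega>"
    by (auto simp: Gamma_alg_def)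
  ultimately show ?thesis
    unfolding lie_algebra_GG_def by (intro equalityI subsetI) auto
qed

end

theorem lemma3p2:
  fixes \<Omega> :: "(real^'n::finite) set"
  assumes "open \<Omega>"
  shows "lie_algebra_GG \<Omega> = Gamma_alg \<Omega>"
  by (rule lie_algebra_eq_Gamma_alg[OF assms])

end
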